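(* (1) The conjugacy relations on $\mathrm{Aut}(\infty\cdot C_3)$ and $\mathrm{Aut}(C_3[\infty])$ are both smooth. (2) For each $n\in\{1,2,\dots\}\cup\{\infty\}$, the conjugacy relations on $\mathrm{Aut}(n\cdot\mathbb{Q})$, $\mathrm{Aut}(\mathbb{Q}[n])$, $\mathrm{Aut}(n\cdot S(2))$, $\mathrm{Aut}(S(2)[n])$, $\mathrm{Aut}(n\cdot\mathcal{T})$, $\mathrm{Aut}(\mathcal{T}[n])$ are Borel complete. More generally, if $G$ is a countable tournament such that the conjugacy relation on $\mathrm{Aut}(G)$ is Borel complete, then the conjugacy relations on $\mathrm{Aut}(n\cdot G)$ and $\mathrm{Aut}(G[n])$ are Borel complete.
   Context: A digraph is a set with an irreflexive antisymmetric relation $\to$; a tournament is a digraph in which any two distinct vertices are joined by an edge. For a digraph $G$ and $n\leq\infty$, $n\cdot G$ is the disjoint union of $n$ copies of $G$ with no edges between copies, and $G[n]$ is obtained from $G$ by replacing each vertex by an independent set of size $n$, with $u\to v$ for $u$ in the set of $a$ and $v$ in the set of $b$ iff $a\to b$ in $G$. $C_3$ is the directed 3-cycle. $\mathbb{Q}$ is the rational order viewed as a tournament ($x\to y$ iff $x<y$). $S(2)$ is the local order: fix a countable dense subset $D$ of the unit circle such that for distinct $x,y\in D$ neither $\arg x$ nor $\arg(x/y)$ is a rational multiple of $\pi$, and put $x\to y$ iff $\arg(x/y)\in(0,\pi)$. $\mathcal{T}$ is the generic countable tournament. Conjugacy on $\mathrm{Aut}(M)$ identifies $\phi,\psi$ iff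 $\psi=\delta\phi\delta^{-1}$ for some $\delta\in\mathrm{Aut}(M)$. $E$ is smooth if there is a Borel $f$ into a standard Borel space with $x\mathrel{E}x'\iff f(x)=f(x')$; $E$ is Borel complete if isomorphism on every Borel class of countable structures in a countable relational language Borel reduces to $E$. *)

theory Defs
  imports "HOL-Analysis.Analysis" "HOL-Algebra.Bij"
begin

section \<open>Borel reducibility, smoothness, Borel completeness\<close>

definition borel_of :: "'a topology \<Rightarrow> 'a measure" where
  "borel_of X = sigma (topspace X) {U. openin X U}"

definition standard_borel :: "'a measure \<Rightarrow> bool" where
  "standard_borel N \<longleftrightarrow>
     (\<exists>X. completely_metrizable_space X \<and> second_countable X \<and>
          space N = topspace X \<and> sets N = sets (borel_of X))"

text \<open>Relations on a Borel space are sets of pairs; only their restriction to the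
  space of the measure matters.\<close>

definition borel_reducible :: "'a measure \<Rightarrow> 'a rel \<Rightarrow> 'b measure \<Rightarrow> 'b rel \<Rightarrow> bool" where
  "borel_reducible M E N F \<longleftrightarrow>
     (\<exists>f \<in> measurable M N. \<forall>x \<in> space M. \<forall>y \<in> space M. (x, y) \<in> E \<longleftrightarrow> (f x, f y) \<in> F)"

text \<open>HOL cannot quantify existentially over the type of points of the target. Taking this
  type to be \<^typ>\<open>real\<close> loses nothing: a standard Borel space has at most
  continuum many points, hence is isomorphic to one whose points are real numbers.\<close>

definition smooth :: "'a measure \<Rightarrow> 'a rel \<Rightarrow> bool" where
  "smooth M E \<longleftrightarrow>
     (\<exists>(N :: real measure) f. standard_borel N \<and> f \<in> measurable M N \<and>
        (\<forall>x \<in> space M. \<forall>y \<in> space M. (x, y) \<in> E \<longleftrightarrow> f x = f y))"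

text \<open>A countable relational language is given by a set \<open>I\<close> of relation symbols, coded as
  natural numbers, and an arity function \<open>ar\<close>. As usual in descriptive set theory, the
  countable structures are coded as structures with universe the natural numbers, i.e. as points
  of the product over \<open>i \<in> I\<close> of the spaces of subsets of \<open>\<nat>\<close> to the power \<open>ar i\<close>; a
  structure tells for each atom \<open>(i, xs)\<close> whether the relation \<open>i\<close> holds of the tuple
  \<open>xs\<close>.\<close>

definition atoms :: "nat set \<Rightarrow> (nat \<Rightarrow> nat) \<Rightarrow> (nat \<times> nat list) set" where
  "atoms I ar = {(i, xs). i \<in> I \<and> length xs = ar i}"

definition structures :: "nat set \<Rightarrow> (nat \<Rightarrow> nat) \<Rightarrow> (nat \<times> nat list \<Rightarrow> bool) topology" where
  "structures I ar = product_topology (\<lambda>_. discrete_topology UNIV) (atoms I ar)"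

definition structure_iso ::
    "nat set \<Rightarrow> (nat \<Rightarrow> nat) \<Rightarrow> (nat \<times> nat list \<Rightarrow> bool) rel" where
  "structure_iso I ar =
     {(S, S'). S \<in> topspace (structures I ar) \<and> S' \<in> topspace (structures I ar) \<and>
        (\<exists>p :: nat \<Rightarrow> nat. bij p \<and> (\<forall>(i, xs) \<in> atoms I ar. S (i, xs) \<longleftrightarrow> S' (i, map p xs)))}"

definition borel_class ::
    "nat set \<Rightarrow> (nat \<Rightarrow> nat) \<Rightarrow> (nat \<times> nat list \<Rightarrow> bool) set \<Rightarrow> bool" where
  "borel_class I ar C \<longleftrightarrow>
     C \<in> sets (borel_of (structures I ar)) \<and>
     (\<forall>S S'. S \<in> C \<and> (S, S') \<in> structure_iso I ar \<longrightarrow> S' \<in> C)"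

definition borel_complete :: "'a measure \<Rightarrow> 'a rel \<Rightarrow> bool" where
  "borel_complete M E \<longleftrightarrow>
     (\<forall>I ar C. borel_class I ar C \<longrightarrow>
        borel_reducible (restrict_space (borel_of (structures I ar)) C) (structure_iso I ar) M E)"


section \<open>Digraphs\<close>

record 'a digraph =
  verts :: "'a set"
  edges :: "'a rel"

definition is_digraph :: "'a digraph \<Rightarrow> bool" where
  "is_digraph G \<longleftrightarrow> edges G \<subseteq> verts G \<times> verts G \<and> irrefl (edges G) \<and> antisym (edges G)"

definition tournament :: "'a digraph \<Rightarrow> bool" where
  "tournament G \<longleftrightarrow> is_digraph G \<and> total_on (verts G) (edges G)"

definition copies :: "enat \<Rightarrow> 'a digraph \<Rightarrow> (nat \<times> 'a) digraph" where
  "copies n G =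
     \<lparr>verts = {i. enat i < n} \<times> verts G,
      edges = {((i, a), (j, b)). enat i < n \<and> i = j \<and> (a, b) \<in> edges G}\<rparr>"

definition blowup :: "'a digraph \<Rightarrow> enat \<Rightarrow> ('a \<times> nat) digraph" where
  "blowup G n =
     \<lparr>verts = verts G \<times> {i. enat i < n},
      edges = {((a, i), (b, j)). enat i < n \<and> enat j < n \<and> (a, b) \<in> edges G}\<rparr>"

definition C3 :: "nat digraph" where
  "C3 = \<lparr>verts = {0, 1, 2}, edges = {(0, 1), (1, 2), (2, 0)}\<rparr>"

definition rat_order :: "rat digraph" where
  "rat_order = \<lparr>verts = UNIV, edges = {(x, y). x < y}\<rparr>"

text \<open>The sets \<open>D\<close> that may be used as vertex set of the local order \<open>S(2)\<close>.\<close>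

definition local_order_points :: "complex set \<Rightarrow> bool" where
  "local_order_points D \<longleftrightarrow>
     countable D \<and> D \<subseteq> sphere 0 1 \<and> sphere 0 1 \<subseteq> closure D \<and>
     (\<forall>x \<in> D. \<forall>y \<in> D. x \<noteq> y \<longrightarrow>
        \<not> (\<exists>q \<in> \<rat>. Arg x = q * pi) \<and> \<not> (\<exists>q \<in> \<rat>. Arg (x / y) = q * pi))"

definition local_order :: "complex set \<Rightarrow> complex digraph" where
  "local_order D =
     \<lparr>verts = D, edges = {(x, y). x \<in> D \<and> y \<in> D \<and> Arg (x / y) \<in> {0<..<pi}}\<rparr>"


section \<open>Automorphism groups\<close>

definition automorphisms :: "'a digraph \<Rightarrow> ('a \<Rightarrow> 'a) set" where
  "automorphisms G =
     {f \<in> Bij (verts G).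
        \<forall>x \<in> verts G. \<forall>y \<in> verts G. (x, y) \<in> edges G \<longleftrightarrow> (f x, f y) \<in> edges G}"

definition aut_group :: "'a digraph \<Rightarrow> ('a \<Rightarrow> 'a) monoid" where
  "aut_group G = (BijGroup (verts G)) \<lparr>carrier := automorphisms G\<rparr>"

text \<open>The topology of pointwise convergence, the vertex set being discrete.\<close>

definition aut_topology :: "'a digraph \<Rightarrow> ('a \<Rightarrow> 'a) topology" where
  "aut_topology G =
     subtopology (product_topology (\<lambda>_. discrete_topology (verts G)) (verts G)) (automorphisms G)"

definition conjugacy :: "('g, 'b) monoid_scheme \<Rightarrow> 'g rel" where
  "conjugacy H =
     {(\<phi>, \<psi>). \<phi> \<in> carrier H \<and> \<psi> \<in> carrier H \<and>
        (\<exists>\<delta> \<in> carrier H. \<psi> = \<delta> \<otimes>\<^bsub>H\<^esub> \<phi> \<otimes>\<^bsub>H\<^esub> inv\<^bsub>H\<^esub> \<delta>)}"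

definition conjugacy_smooth :: "'a digraph \<Rightarrow> bool" where
  "conjugacy_smooth G \<longleftrightarrow> smooth (borel_of (aut_topology G)) (conjugacy (aut_group G))"

definition conjugacy_borel_complete :: "'a digraph \<Rightarrow> bool" where
  "conjugacy_borel_complete G \<longleftrightarrow>
     borel_complete (borel_of (aut_topology G)) (conjugacy (aut_group G))"


section \<open>The generic tournament\<close>

definition induced :: "'a digraph \<Rightarrow> 'a set \<Rightarrow> 'a digraph" where
  "induced G A = \<lparr>verts = A, edges = edges G \<inter> A \<times> A\<rparr>"

definition embedding :: "('a \<Rightarrow> 'b) \<Rightarrow> 'a digraph \<Rightarrow> 'b digraph \<Rightarrow> bool" where
  "embedding f H G \<longleftrightarrow>
     f \<in> verts H \<rightarrow> verts G \<and> inj_on f (verts H) \<and>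
     (\<forall>x \<in> verts H. \<forall>y \<in> verts H. (x, y) \<in> edges H \<longleftrightarrow> (f x, f y) \<in> edges G)"

text \<open>Every isomorphism between finite induced subdigraphs extends to an automorphism.\<close>

definition homogeneous :: "'a digraph \<Rightarrow> bool" where
  "homogeneous G \<longleftrightarrow>
     (\<forall>A f. finite A \<and> A \<subseteq> verts G \<and> embedding f (induced G A) G \<longrightarrow>
        (\<exists>g \<in> automorphisms G. \<forall>x \<in> A. g x = f x))"

text \<open>The generic countable tournament is the Fraisse limit of the class of finite tournaments;
  it is unique up to isomorphism.\<close>

definition generic_tournament :: "'a digraph \<Rightarrow> bool" where
  "generic_tournament T \<longleftrightarrow>
     tournament T \<and> countable (verts T) \<and> homogeneous T \<and>
     (\<forall>H :: nat digraph. finite (verts H) \<and> tournament H \<longrightarrow> (\<exists>f. embedding f H T))"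


section \<open>Basic facts\<close>

lemma topspace_aut_topology: "topspace (aut_topology G) = automorphisms G"
  by (auto simp: aut_topology_def automorphisms_def Bij_def bij_betw_def PiE_def)

lemma space_borel_of [simp]: "space (borel_of X) = topspace X"
  unfolding borel_of_def by (rule space_measure_of) (auto dest: openin_subset)

lemma sets_borel_of: "sets (borel_of X) = sigma_sets (topspace X) {U. openin X U}"
  unfolding borel_of_def by (rule sets_measure_of) (auto dest: openin_subset)

lemma subgroup_automorphisms: "subgroup (automorphisms G) (BijGroup (verts G))"
proof -
  interpret B: group "BijGroup (verts G)" by (rule group_BijGroup)
  show ?thesis
  proof (rule B.subgroupI)
    show "automorphisms G \<subseteq> carrier (BijGroup (verts G))"
      by (auto simp: automorphisms_def BijGroup_def)
    show "automorphisms G \<noteq> {}"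
    proof -
      have "(\<lambda>x\<in>verts G. x) \<in> automorphisms G"
        using id_Bij[of "verts G"] by (simp add: automorphisms_def)
      then show ?thesis by blast
    qed
  next
    fix f assume f: "f \<in> automorphisms G"
    then have fB: "f \<in> Bij (verts G)" by (simp add: automorphisms_def)
    then have bij: "bij_betw f (verts G) (verts G)" by (simp add: Bij_def)
    let ?g = "\<lambda>x\<in>verts G. inv_into (verts G) f x"
    have "?g \<in> automorphisms G"
      unfolding automorphisms_def
    proof (intro CollectI conjI ballI restrict_inv_into_Bij fB)
      fix x y assume xy: "x \<in> verts G" "y \<in> verts G"
      have mem: "?g x \<in> verts G" "?g y \<in> verts G"
        using xy fB by (simp_all add: Bij_inv_into_mem)
      have "f (?g x) = x" "f (?g y) = y"
        using xy by (simp_all add: bij_betw_inv_into_right[OF bij])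
      moreover have "(?g x, ?g y) \<in> edges G \<longleftrightarrow> (f (?g x), f (?g y)) \<in> edges G"
        using f mem unfolding automorphisms_def by blast
      ultimately show "(x, y) \<in> edges G \<longleftrightarrow> (?g x, ?g y) \<in> edges G"
        by simp
    qed
    then show "inv\<^bsub>BijGroup (verts G)\<^esub> f \<in> automorphisms G"
      by (simp add: inv_BijGroup fB)
  next
    fix f g assume fg: "f \<in> automorphisms G" "g \<in> automorphisms G"
    then have B: "f \<in> Bij (verts G)" "g \<in> Bij (verts G)" by (simp_all add: automorphisms_def)
    have "g x \<in> verts G" if "x \<in> verts G" for x
      using B(2) that Bij_imp_funcset by blast
    with fg B show "f \<otimes>\<^bsub>BijGroup (verts G)\<^esub> g \<in> automorphisms G"
      by (simp add: automorphisms_def BijGroup_def compose_Bij compose_eq)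
  qed
qed

lemma group_aut_group: "group (aut_group G)"
  unfolding aut_group_def
  using subgroup.subgroup_is_group[OF subgroup_automorphisms group_BijGroup] .

end

theory Submission
  imports Defs "HOL-Library.List_Lexorder"
begin

text \<open>Borel completeness. Countable structures are coded by a lexicographically ordered tree of finite
  sequences of rationals: the rationals are coloured so that every natural number is a dense colour,
  a node stands for the tuple of its colours, and its label records one atomic formula at that tuple.
  An isomorphism of structures lifts, by back and forth, to an order automorphism of the rationals
  that permutes the colours, hence to an automorphism of the tree with its order. One and the same
  countable dense order carries all the codes: only an automorphism of it varies with the structure,
  in such a way that its fixed points, as a linear order, replace each node by a finite block
  whose size gives the depth and the label of the node. As the nodes are densely ordered, the
  blocks can be recovered from the order of the fixed points, the parent of a node is the last node
  of the previous depth before it, and the structure is recovered from the labelled tree by back and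
  forth. This order is the rational order, with two dense colours it is \<open>S(2)\<close> cut at a point, and
  the generic tournament is built over it functorially with no new fixed points.

  For a tournament \<open>G\<close>, an automorphism of \<open>n \<cdot> G\<close> permutes the copies, and one of \<open>G[n]\<close> permutes
  the blown-up vertices, which reduces conjugacy on \<open>Aut(G)\<close> to conjugacy there.

  Smoothness. The cyclic rotation of the copies commutes with all automorphisms of \<open>\<infinity> \<cdot> C\<^sub>3\<close>, so
  conjugacy is isomorphism of actions of \<open>\<int> \<times> \<int>\<close>, and the numbers of orbits with given stabilizer are
  complete invariants. For \<open>C\<^sub>3[\<infinity>]\<close> the orbits also record which of the three parts they meet,
  and the invariants are complete up to the three rotations of the parts.\<close>


section \<open>Conjugacy in automorphism groups\<close>

text \<open>One fixed digraph must carry the codes of all structures, by a continuous map, so only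
  the automorphism may depend on the structure. Hence \<open>point\<close> puts a whole copy of the
  rationals at every node and index, and the structure only selects which of two maps acts on each
  copy: one with a single fixed point or one with none. Each selection reads at most one bit of the
  structure. Both maps preserve the colour of a rational, which is the 2-adic valuation of its
  denominator: an odd factor or an integer translation does not change it. So the colours serve a
  second time, for the two halves of the local order.

  The labels of the tree are rationals and not natural numbers because a well-ordered set of
  children is rigid, whereas an isomorphism of structures has to permute colours and keep the
  lexicographic order. Prefixes are not visible in that order alone, which is why the depth is
  stored too.

  On the smooth side the acting group is abelian, so a stabilizer belongs to an orbit rather than to
  a point, and it has only countably many subgroups, so countably many counts suffice.\<close>

lemma automorphism_mem: "f \<in> automorphisms G \<Longrightarrow> v \<in> verts G \<Longrightarrow> f v \<in> verts G"
  by (auto simp: automorphisms_def dest: Bij_imp_funcset)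

lemma automorphism_bij: "f \<in> automorphisms G \<Longrightarrow> bij_betw f (verts G) (verts G)"
  by (auto simp: automorphisms_def Bij_def)

lemma automorphism_inj:
  "f \<in> automorphisms G \<Longrightarrow> u \<in> verts G \<Longrightarrow> v \<in> verts G \<Longrightarrow> f u = f v \<longleftrightarrow> u = v"
  using automorphism_bij[of f G] by (auto simp: bij_betw_def inj_on_eq_iff)

lemma automorphism_edge:
  "f \<in> automorphisms G \<Longrightarrow> u \<in> verts G \<Longrightarrow> v \<in> verts G \<Longrightarrow>
    (f u, f v) \<in> edges G \<longleftrightarrow> (u, v) \<in> edges G"
  by (auto simp: automorphisms_def)

lemma automorphism_eqI:
  assumes "f \<in> automorphisms G" "g \<in> automorphisms G" "\<And>v. v \<in> verts G \<Longrightarrow> f v = g v"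
  shows "f = g"
proof
  fix v show "f v = g v"
    using assms by (cases "v \<in> verts G") (auto simp: automorphisms_def Bij_def extensional_def)
qed

lemma automorphism_mult:
  assumes "f \<in> automorphisms G" "g \<in> automorphisms G" "v \<in> verts G"
  shows "(f \<otimes>\<^bsub>aut_group G\<^esub> g) v = f (g v)"
  using assms by (simp add: aut_group_def BijGroup_def automorphisms_def compose_eq)

lemma restrict_automorphism:
  assumes "bij_betw f (verts G) (verts G)"
    "\<And>u v. u \<in> verts G \<Longrightarrow> v \<in> verts G \<Longrightarrow> (f u, f v) \<in> edges G \<longleftrightarrow> (u, v) \<in> edges G"
  shows "restrict f (verts G) \<in> automorphisms G"
  using assms by (auto simp: automorphisms_def Bij_def)

lemma carrier_aut_group [simp]: "carrier (aut_group G) = automorphisms G"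
  by (simp add: aut_group_def)

text \<open>Cancelling the inverse turns conjugacy into the existence of an intertwining \<delta>.
  This is a pointwise condition on vertices, since automorphisms are extensional, and later proofs
  use conjugacy only in this form.\<close>

lemma conjugacy_aut_iff:
  "(\<phi>, \<psi>) \<in> conjugacy (aut_group G) \<longleftrightarrow>
     \<phi> \<in> automorphisms G \<and> \<psi> \<in> automorphisms G \<and>
     (\<exists>\<delta>\<in>automorphisms G. \<forall>v\<in>verts G. \<delta> (\<phi> v) = \<psi> (\<delta> v))"
proof -
  interpret A: group "aut_group G" by (rule group_aut_group)
  have "\<psi> = \<delta> \<otimes>\<^bsub>aut_group G\<^esub> \<phi> \<otimes>\<^bsub>aut_group G\<^esub> inv\<^bsub>aut_group G\<^esub> \<delta> \<longleftrightarrow>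
      (\<forall>v\<in>verts G. \<delta> (\<phi> v) = \<psi> (\<delta> v))"
    if [simp]: "\<phi> \<in> automorphisms G" "\<psi> \<in> automorphisms G" "\<delta> \<in> automorphisms G" for \<delta>
  proof -
    have "\<psi> = \<delta> \<otimes>\<^bsub>aut_group G\<^esub> \<phi> \<otimes>\<^bsub>aut_group G\<^esub> inv\<^bsub>aut_group G\<^esub> \<delta> \<longleftrightarrow>
        \<psi> \<otimes>\<^bsub>aut_group G\<^esub> \<delta> = \<delta> \<otimes>\<^bsub>aut_group G\<^esub> \<phi>"
      using A.inv_solve_right[of \<psi> "\<delta> \<otimes>\<^bsub>aut_group G\<^esub> \<phi>" \<delta>] A.m_closed[of \<delta> \<phi>] by auto
    also have "\<dots> \<longleftrightarrow> (\<forall>v\<in>verts G. (\<psi> \<otimes>\<^bsub>aut_group G\<^esub> \<delta>) v = (\<delta> \<otimes>\<^bsub>aut_group G\<^esub> \<phi>) v)"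
      using automorphism_eqI[of "\<psi> \<otimes>\<^bsub>aut_group G\<^esub> \<delta>" G "\<delta> \<otimes>\<^bsub>aut_group G\<^esub> \<phi>"]
        A.m_closed[of \<delta> \<phi>] A.m_closed[of \<psi> \<delta>] by auto
    also have "\<dots> \<longleftrightarrow> (\<forall>v\<in>verts G. \<delta> (\<phi> v) = \<psi> (\<delta> v))"
      by (auto simp: automorphism_mult)
    finally show ?thesis .
  qed
  then show ?thesis unfolding conjugacy_def by auto
qed

section \<open>Continuity, measurability and the transfer of Borel completeness\<close>

lemma continuous_map_discreteI:
  assumes "f \<in> topspace X \<rightarrow> S" "\<And>w. w \<in> S \<Longrightarrow> openin X {x \<in> topspace X. f x = w}"
  shows "continuous_map X (discrete_topology S) f"
proof -
  have "openin X {x \<in> topspace X. f x \<in> U}" if "U \<subseteq> S" for U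
  proof -
    have "{x \<in> topspace X. f x \<in> U} = (\<Union>w\<in>U. {x \<in> topspace X. f x = w})" by auto
    then show ?thesis using assms(2) that by (simp only:) (intro openin_Union, blast)
  qed
  then show ?thesis using assms(1) by (auto simp: continuous_map)
qed

lemma continuous_map_aut_topologyI:
  assumes "\<And>x. x \<in> topspace X \<Longrightarrow> f x \<in> automorphisms G"
    and "\<And>v w. v \<in> verts G \<Longrightarrow> w \<in> verts G \<Longrightarrow> openin X {x \<in> topspace X. f x v = w}"
  shows "continuous_map X (aut_topology G) f"
  unfolding aut_topology_def continuous_map_in_subtopology continuous_map_componentwise
proof (intro conjI ballI)
  show "f ` topspace X \<subseteq> extensional (verts G)"
    using assms(1) by (auto simp: automorphisms_def Bij_def)
  fix v assume v: "v \<in> verts G"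
  show "continuous_map X (discrete_topology (verts G)) (\<lambda>x. f x v)"
    by (rule continuous_map_discreteI) (use assms(2) v in \<open>auto intro: automorphism_mem assms(1)\<close>)
qed (use assms in auto)

lemma openin_aut_topology_eval:
  assumes "v \<in> verts G"
  shows "openin (aut_topology G) {\<phi> \<in> topspace (aut_topology G). P (\<phi> v)}"
proof -
  have "continuous_map (aut_topology G) (discrete_topology (verts G)) (\<lambda>\<phi>. \<phi> v)"
    unfolding aut_topology_def
    by (intro continuous_map_from_subtopology continuous_map_product_projection assms)
  then have "openin (aut_topology G) {\<phi> \<in> topspace (aut_topology G). \<phi> v \<in> {w\<in>verts G. P w}}"
    by (rule openin_continuous_map_preimage) auto
  also have "{\<phi> \<in> topspace (aut_topology G). \<phi> v \<in> {w\<in>verts G. P w}} =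
      {\<phi> \<in> topspace (aut_topology G). P (\<phi> v)}"
    using assms automorphism_mem by (auto simp: topspace_aut_topology)
  finally show ?thesis .
qed

lemma measurable_borel_of:
  assumes "continuous_map X Y f"
  shows "f \<in> measurable (borel_of X) (borel_of Y)"
proof (rule measurable_sigma_sets[OF sets_borel_of])
  show "{U. openin Y U} \<subseteq> Pow (topspace Y)" by (auto dest: openin_subset)
  show "f \<in> space (borel_of X) \<rightarrow> topspace Y"
    using assms by (auto simp: continuous_map)
  fix U assume "U \<in> {U. openin Y U}"
  then have "openin X {x \<in> topspace X. f x \<in> U}"
    using assms by (auto simp: continuous_map)
  moreover have "f -` U \<inter> space (borel_of X) = {x \<in> topspace X. f x \<in> U}" by auto
  ultimately show "f -` U \<inter> space (borel_of X) \<in> sets (borel_of X)"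
    by (simp add: sets_borel_of sigma_sets.Basic)
qed

text \<open>One continuous reduction defined on the whole space of structures serves every Borel
  class by restriction.\<close>

lemma borel_completeI:
  assumes "\<And>I ar. continuous_map (structures I ar) X (f I ar)"
    and "\<And>I ar S S'. S \<in> topspace (structures I ar) \<Longrightarrow> S' \<in> topspace (structures I ar) \<Longrightarrow>
      (S, S') \<in> structure_iso I ar \<longleftrightarrow> (f I ar S, f I ar S') \<in> E"
  shows "borel_complete (borel_of X) E"
  unfolding borel_complete_def borel_reducible_def
proof (intro allI impI)
  fix I ar C assume C: "borel_class I ar C"
  have "C \<subseteq> topspace (structures I ar)"
    using C sets.sets_into_space[of C "borel_of (structures I ar)"] by (auto simp: borel_class_def)
  moreover have "f I ar \<in> restrict_space (borel_of (structures I ar)) C \<rightarrow>\<^sub>M borel_of X"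
    by (intro measurable_restrict_space1 measurable_borel_of assms)
  ultimately show "\<exists>g\<in>restrict_space (borel_of (structures I ar)) C \<rightarrow>\<^sub>M borel_of X.
      \<forall>x\<in>space (restrict_space (borel_of (structures I ar)) C).
      \<forall>y\<in>space (restrict_space (borel_of (structures I ar)) C).
        (x, y) \<in> structure_iso I ar \<longleftrightarrow> (g x, g y) \<in> E"
    using assms(2)[of _ I ar] by (intro bexI[of _ "f I ar"]) (auto simp: space_restrict_space)
qed

lemma borel_complete_reducible:
  assumes "borel_complete M E" "f \<in> measurable M N"
    and "\<And>x y. x \<in> space M \<Longrightarrow> y \<in> space M \<Longrightarrow> (x, y) \<in> E \<longleftrightarrow> (f x, f y) \<in> F"
  shows "borel_complete N F"
  unfolding borel_complete_def
proof (intro allI impI)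
  fix I ar C assume C: "borel_class I ar C"
  let ?M = "restrict_space (borel_of (structures I ar)) C"
  obtain g where g: "g \<in> measurable ?M M"
    and iff: "\<forall>x\<in>space ?M. \<forall>y\<in>space ?M. (x, y) \<in> structure_iso I ar \<longleftrightarrow> (g x, g y) \<in> E"
    using assms(1) C unfolding borel_complete_def borel_reducible_def by blast
  show "borel_reducible ?M (structure_iso I ar) N F"
    unfolding borel_reducible_def
  proof (intro bexI[of _ "f \<circ> g"] ballI)
    show "f \<circ> g \<in> measurable ?M N" using g assms(2) by (rule measurable_comp)
    fix x y assume "x \<in> space ?M" "y \<in> space ?M"
    then show "(x, y) \<in> structure_iso I ar \<longleftrightarrow> ((f \<circ> g) x, (f \<circ> g) y) \<in> F"
      using iff assms(3)[of "g x" "g y"] measurable_space[OF g] by auto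
  qed
qed

text \<open>\<open>F\<close> acts like a functor: an intertwining \<delta> yields an intertwining
  \<open>F \<delta>\<close>, so conjugate automorphisms stay conjugate. \<open>cont\<close> lets
  each value of \<open>F \<phi>\<close> depend on a single value of \<phi>, which makes
  \<open>F\<close> continuous. In the applications to copies and blow-ups the substance is
  \<open>reflect\<close>.\<close>

lemma conjugacy_borel_complete_transfer:
  assumes "conjugacy_borel_complete G"
    and aut: "\<And>\<phi>. \<phi> \<in> automorphisms G \<Longrightarrow> F \<phi> \<in> automorphisms H"
    and cont: "\<And>v. v \<in> verts H \<Longrightarrow> \<exists>u\<in>verts G. \<exists>g. \<forall>\<phi>\<in>automorphisms G. F \<phi> v = g (\<phi> u)"
    and functorial: "\<And>\<phi> \<psi> \<delta> v. \<phi> \<in> automorphisms G \<Longrightarrow> \<psi> \<in> automorphisms G \<Longrightarrow> \<delta> \<in> automorphisms G \<Longrightarrow>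
      \<forall>u\<in>verts G. \<delta> (\<phi> u) = \<psi> (\<delta> u) \<Longrightarrow> v \<in> verts H \<Longrightarrow> F \<delta> (F \<phi> v) = F \<psi> (F \<delta> v)"
    and reflect: "\<And>\<phi> \<psi> \<delta>. \<phi> \<in> automorphisms G \<Longrightarrow> \<psi> \<in> automorphisms G \<Longrightarrow> \<delta> \<in> automorphisms H \<Longrightarrow>
      \<forall>v\<in>verts H. \<delta> (F \<phi> v) = F \<psi> (\<delta> v) \<Longrightarrow>
      \<exists>\<epsilon>\<in>automorphisms G. \<forall>v\<in>verts G. \<epsilon> (\<phi> v) = \<psi> (\<epsilon> v)"
  shows "conjugacy_borel_complete H"
proof -
  have cont_F: "continuous_map (aut_topology G) (aut_topology H) F"
  proof (rule continuous_map_aut_topologyI)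
    fix v w assume "v \<in> verts H" "w \<in> verts H"
    then obtain u g where u: "u \<in> verts G" and g: "\<forall>\<phi>\<in>automorphisms G. F \<phi> v = g (\<phi> u)"
      using cont by blast
    have "{\<phi> \<in> topspace (aut_topology G). F \<phi> v = w} = {\<phi> \<in> topspace (aut_topology G). g (\<phi> u) = w}"
      using g by (auto simp: topspace_aut_topology)
    then show "openin (aut_topology G) {\<phi> \<in> topspace (aut_topology G). F \<phi> v = w}"
      using openin_aut_topology_eval[OF u, of "\<lambda>x. g x = w"] by simp
  qed (use aut in \<open>simp add: topspace_aut_topology\<close>)
  show ?thesis
    unfolding conjugacy_borel_complete_def
  proof (rule borel_complete_reducible[OF assms(1)[unfolded conjugacy_borel_complete_def]
        measurable_borel_of[OF cont_F]])
    fix \<phi> \<psi> assume "\<phi> \<in> space (borel_of (aut_topology G))" "\<psi> \<in> space (borel_of (aut_topology G))"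
    then have a: "\<phi> \<in> automorphisms G" "\<psi> \<in> automorphisms G" by (simp_all add: topspace_aut_topology)
    show "(\<phi>, \<psi>) \<in> conjugacy (aut_group G) \<longleftrightarrow> (F \<phi>, F \<psi>) \<in> conjugacy (aut_group H)"
    proof
      assume "(\<phi>, \<psi>) \<in> conjugacy (aut_group G)"
      then obtain \<delta> where "\<delta> \<in> automorphisms G" "\<forall>v\<in>verts G. \<delta> (\<phi> v) = \<psi> (\<delta> v)"
        by (auto simp: conjugacy_aut_iff)
      then show "(F \<phi>, F \<psi>) \<in> conjugacy (aut_group H)"
        using functorial[OF a] aut a by (auto simp: conjugacy_aut_iff intro!: bexI[of _ "F \<delta>"])
    next
      assume "(F \<phi>, F \<psi>) \<in> conjugacy (aut_group H)"
      then show "(\<phi>, \<psi>) \<in> conjugacy (aut_group G)"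
        using reflect[OF a] a by (auto simp: conjugacy_aut_iff)
    qed
  qed
qed

section \<open>Isomorphic digraphs\<close>

definition digraph_iso :: "('a \<Rightarrow> 'b) \<Rightarrow> 'a digraph \<Rightarrow> 'b digraph \<Rightarrow> bool" where
  "digraph_iso h G H \<longleftrightarrow> bij_betw h (verts G) (verts H) \<and>
     (\<forall>u\<in>verts G. \<forall>v\<in>verts G. (h u, h v) \<in> edges H \<longleftrightarrow> (u, v) \<in> edges G)"

lemma conjugacy_borel_complete_iso:
  assumes "digraph_iso h G H" "conjugacy_borel_complete G"
  shows "conjugacy_borel_complete H"
proof -
  define k where "k = inv_into (verts G) h"
  have h: "bij_betw h (verts G) (verts H)" using assms(1) by (simp add: digraph_iso_def)
  have k: "bij_betw k (verts H) (verts G)" unfolding k_def by (rule bij_betw_inv_into[OF h])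
  have hk: "h (k v) = v" if "v \<in> verts H" for v
    using h that unfolding k_def by (rule bij_betw_inv_into_right)
  have kh: "k (h v) = v" if "v \<in> verts G" for v
    using h that unfolding k_def by (rule bij_betw_inv_into_left)
  have hm: "h v \<in> verts H" if "v \<in> verts G" for v using h that by (auto simp: bij_betw_def)
  have km: "k v \<in> verts G" if "v \<in> verts H" for v using k that by (auto simp: bij_betw_def)
  have he: "(h u, h v) \<in> edges H \<longleftrightarrow> (u, v) \<in> edges G" if "u \<in> verts G" "v \<in> verts G" for u v
    using assms(1) that by (auto simp: digraph_iso_def)
  have ke: "(k u, k v) \<in> edges G \<longleftrightarrow> (u, v) \<in> edges H" if "u \<in> verts H" "v \<in> verts H" for u v
    using he[of "k u" "k v"] that km hk by auto
  define F where "F \<phi> = restrict (h \<circ> \<phi> \<circ> k) (verts H)" for \<phi>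
  define F' where "F' \<phi> = restrict (k \<circ> \<phi> \<circ> h) (verts G)" for \<phi>
  have F: "F \<phi> \<in> automorphisms H" if "\<phi> \<in> automorphisms G" for \<phi>
    unfolding F_def
    by (rule restrict_automorphism, rule bij_betw_trans[OF k bij_betw_trans[OF automorphism_bij[OF that] h], unfolded o_assoc])
      (use that in \<open>auto simp: he ke km hm automorphism_mem automorphism_edge\<close>)
  have F': "F' \<phi> \<in> automorphisms G" if "\<phi> \<in> automorphisms H" for \<phi>
    unfolding F'_def
    by (rule restrict_automorphism, rule bij_betw_trans[OF h bij_betw_trans[OF automorphism_bij[OF that] k], unfolded o_assoc])
      (use that in \<open>auto simp: he ke km hm automorphism_mem automorphism_edge\<close>)
  show ?thesis
  proof (rule conjugacy_borel_complete_transfer[OF assms(2) F])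
    fix v assume "v \<in> verts H"
    then show "\<exists>u\<in>verts G. \<exists>g. \<forall>\<phi>\<in>automorphisms G. F \<phi> v = g (\<phi> u)"
      by (intro bexI[of _ "k v"] exI[of _ h]) (auto simp: F_def km)
  next
    show "F \<delta> (F \<phi> v) = F \<psi> (F \<delta> v)"
      if "\<phi> \<in> automorphisms G" "\<psi> \<in> automorphisms G" "\<delta> \<in> automorphisms G"
        "\<forall>u\<in>verts G. \<delta> (\<phi> u) = \<psi> (\<delta> u)" "v \<in> verts H" for \<phi> \<psi> \<delta> v
      using that by (simp add: F_def km hm kh automorphism_mem)
    fix \<phi> \<psi> \<delta> assume a: "\<phi> \<in> automorphisms G" "\<psi> \<in> automorphisms G"
      and d: "\<delta> \<in> automorphisms H" "\<forall>v\<in>verts H. \<delta> (F \<phi> v) = F \<psi> (\<delta> v)"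
    have "F' \<delta> (\<phi> v) = \<psi> (F' \<delta> v)" if v: "v \<in> verts G" for v
    proof -
      have "\<delta> (F \<phi> (h v)) = F \<psi> (\<delta> (h v))" using d(2) hm[OF v] by blast
      then show ?thesis
        using v a d(1) by (simp add: F_def F'_def hm kh km automorphism_mem)
    qed
    then show "\<exists>\<epsilon>\<in>automorphisms G. \<forall>v\<in>verts G. \<epsilon> (\<phi> v) = \<psi> (\<epsilon> v)" using F'[OF d(1)] by blast
  qed
qed

section \<open>Copies and blow-ups of a tournament\<close>

lemma tournament_edge_cases:
  assumes "tournament G" "u \<in> verts G" "v \<in> verts G"
  shows "u = v \<or> (u, v) \<in> edges G \<or> (v, u) \<in> edges G"
  using assms by (auto simp: tournament_def total_on_def)

lemma tournament_irrefl: "tournament G \<Longrightarrow> (u, u) \<notin> edges G"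
  by (auto simp: tournament_def is_digraph_def irrefl_def)

text \<open>\<open>F \<phi>\<close> acts in the same way on every copy. A conjugator \<delta> may
  move copy 0 to another copy \<open>j\<close>, but since \<open>F \<psi>\<close> does not look at
  the index, the second coordinate of \<delta> on copy 0 already intertwines \<phi> and
  \<psi>.\<close>

lemma conjugacy_borel_complete_copies:
  assumes "tournament G" "1 \<le> n" "conjugacy_borel_complete G"
  shows "conjugacy_borel_complete (copies n G)"
proof -
  let ?H = "copies n G"
  have n0: "enat 0 < n"
    using assms(2) by (metis i0_less ile0_eq not_one_le_zero zero_enat_def)
  have V: "(i, a) \<in> verts ?H \<longleftrightarrow> enat i < n \<and> a \<in> verts G" for i a
    by (auto simp: copies_def)
  have E: "((i, a), (j, b)) \<in> edges ?H \<longleftrightarrow> enat i < n \<and> i = j \<and> (a, b) \<in> edges G" for i j a b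
    by (auto simp: copies_def)
  define F where "F \<phi> = restrict (map_prod id \<phi>) (verts ?H)" for \<phi> :: "'a \<Rightarrow> 'a"
  have F: "F \<phi> \<in> automorphisms ?H" if "\<phi> \<in> automorphisms G" for \<phi>
    unfolding F_def
  proof (rule restrict_automorphism)
    show "bij_betw (map_prod id \<phi>) (verts ?H) (verts ?H)"
      unfolding copies_def using automorphism_bij[OF that]
      by (auto intro!: bij_betw_map_prod)
    fix u v assume "u \<in> verts ?H" "v \<in> verts ?H"
    then show "(map_prod id \<phi> u, map_prod id \<phi> v) \<in> edges ?H \<longleftrightarrow> (u, v) \<in> edges ?H"
      by (cases u; cases v) (auto simp: V E automorphism_edge[OF that])
  qed
  show ?thesis
  proof (rule conjugacy_borel_complete_transfer[OF assms(3) F])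
    fix v assume "v \<in> verts ?H"
    then show "\<exists>u\<in>verts G. \<exists>g. \<forall>\<phi>\<in>automorphisms G. F \<phi> v = g (\<phi> u)"
      by (intro bexI[of _ "snd v"] exI[of _ "Pair (fst v)"])
        (auto simp: F_def copies_def)
  next
    show "F \<delta> (F \<phi> v) = F \<psi> (F \<delta> v)"
      if "\<phi> \<in> automorphisms G" "\<psi> \<in> automorphisms G" "\<delta> \<in> automorphisms G"
        "\<forall>u\<in>verts G. \<delta> (\<phi> u) = \<psi> (\<delta> u)" "v \<in> verts ?H" for \<phi> \<psi> \<delta> v
      using that by (cases v) (simp add: F_def V automorphism_mem)
    fix \<phi> \<psi> \<delta> assume a: "\<phi> \<in> automorphisms G" "\<psi> \<in> automorphisms G"
      and d: "\<delta> \<in> automorphisms ?H" and dc: "\<forall>v\<in>verts ?H. \<delta> (F \<phi> v) = F \<psi> (\<delta> v)"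
    show "\<exists>\<epsilon>\<in>automorphisms G. \<forall>v\<in>verts G. \<epsilon> (\<phi> v) = \<psi> (\<epsilon> v)"
    \<comment> \<open>The index \<open>j\<close> of the image copy is read off at a vertex, so the
      empty digraph is set apart.\<close>
    proof (cases "verts G = {}")
      case True
      then show ?thesis using a by auto
    next
      case False
      then obtain a0 where a0: "a0 \<in> verts G" by auto
      define j where "j = fst (\<delta> (0, a0))"
      define \<delta>' where "\<delta>' a = snd (\<delta> (0, a))" for a
      have m: "\<delta> (i, a) \<in> verts ?H" if "enat i < n" "a \<in> verts G" for i a
        using automorphism_mem[OF d, of "(i, a)"] that by (auto simp: V)
      txt \<open>The copies of \<^term>\<open>G\<close> are the connected components, so \<^term>\<open>\<delta>\<close> permutes them.\<close>
      have same: "fst u = fst v \<longleftrightarrow> u = v \<or> (u, v) \<in> edges ?H \<or> (v, u) \<in> edges ?H"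
        if "u \<in> verts ?H" "v \<in> verts ?H" for u v
        using that tournament_edge_cases[OF assms(1), of "snd u" "snd v"]
        by (cases u; cases v) (auto simp: E V)
      have same_image: "fst (\<delta> u) = fst (\<delta> v) \<longleftrightarrow> fst u = fst v"
        if "u \<in> verts ?H" "v \<in> verts ?H" for u v
        using that by (simp add: same automorphism_mem[OF d] automorphism_edge[OF d] automorphism_inj[OF d])
      have d0: "\<delta> (0, a) = (j, \<delta>' a)" if "a \<in> verts G" for a
        using same_image[of "(0, a)" "(0, a0)"] that a0 n0 by (auto simp: V j_def \<delta>'_def prod_eq_iff)
      have j: "enat j < n" using m[OF n0 a0] d0[OF a0] by (simp add: V)
      have bij: "bij_betw \<delta>' (verts G) (verts G)"
        unfolding bij_betw_def
      proof
        show "inj_on \<delta>' (verts G)"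
        proof (rule inj_onI)
          fix x y assume "x \<in> verts G" "y \<in> verts G" "\<delta>' x = \<delta>' y"
          then show "x = y" using d0[of x] d0[of y] automorphism_inj[OF d, of "(0, x)" "(0, y)"] n0
            by (simp add: V)
        qed
        show "\<delta>' ` verts G = verts G"
        proof
          show "\<delta>' ` verts G \<subseteq> verts G" using m[OF n0] d0 by (auto simp: V)
          show "verts G \<subseteq> \<delta>' ` verts G"
          proof
            fix b assume "b \<in> verts G"
            then have "(j, b) \<in> verts ?H" using j by (simp add: V)
            then obtain v where v: "v \<in> verts ?H" "\<delta> v = (j, b)"
              using automorphism_bij[OF d] by (metis bij_betw_iff_bijections)
            then have "fst v = 0"
              using same_image[of v "(0, a0)"] a0 n0 d0[OF a0] by (auto simp: V)
            then have "b = \<delta>' (snd v)" "snd v \<in> verts G"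
              using v by (cases v, auto simp: \<delta>'_def V)+
            then show "b \<in> \<delta>' ` verts G" by blast
          qed
        qed
      qed
      have edge: "(\<delta>' u, \<delta>' v) \<in> edges G \<longleftrightarrow> (u, v) \<in> edges G" if "u \<in> verts G" "v \<in> verts G" for u v
        using automorphism_edge[OF d, of "(0, u)" "(0, v)"] that d0 n0 j by (simp add: V E)
      have "\<delta>' (\<phi> v) = \<psi> (\<delta>' v)" if v: "v \<in> verts G" for v
      proof -
        have "\<delta> (F \<phi> (0, v)) = F \<psi> (\<delta> (0, v))" using dc v n0 by (simp add: V)
        moreover have "\<delta>' v \<in> verts G" using bij v by (auto simp: bij_betw_def)
        ultimately show ?thesis
          using v a n0 j by (simp add: F_def V d0 automorphism_mem)
      qed
      then show ?thesis
        using restrict_automorphism[OF bij edge] a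
        by (intro bexI[of _ "restrict \<delta>' (verts G)"]) (auto simp: automorphism_mem)
    qed
  qed
qed

text \<open>Here a conjugator may also move points inside the blown-up vertices. The first
  coordinate forgets this, and \<open>F \<phi>\<close> and \<open>F \<psi>\<close> permute the
  blown-up vertices as \<phi> and \<psi> permute the vertices of \<open>G\<close>, so the induced
  permutation \<open>\<delta>'\<close> intertwines.\<close>

lemma conjugacy_borel_complete_blowup:
  assumes "tournament G" "1 \<le> n" "conjugacy_borel_complete G"
  shows "conjugacy_borel_complete (blowup G n)"
proof -
  let ?H = "blowup G n"
  have n0: "enat 0 < n"
    using assms(2) by (metis i0_less ile0_eq not_one_le_zero zero_enat_def)
  have V: "(a, i) \<in> verts ?H \<longleftrightarrow> enat i < n \<and> a \<in> verts G" for i a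
    by (auto simp: blowup_def)
  have E: "((a, i), (b, j)) \<in> edges ?H \<longleftrightarrow> enat i < n \<and> enat j < n \<and> (a, b) \<in> edges G" for i j a b
    by (auto simp: blowup_def)
  define F where "F \<phi> = restrict (map_prod \<phi> id) (verts ?H)" for \<phi> :: "'a \<Rightarrow> 'a"
  have F: "F \<phi> \<in> automorphisms ?H" if "\<phi> \<in> automorphisms G" for \<phi>
    unfolding F_def
  proof (rule restrict_automorphism)
    show "bij_betw (map_prod \<phi> id) (verts ?H) (verts ?H)"
      unfolding blowup_def using automorphism_bij[OF that]
      by (auto intro!: bij_betw_map_prod)
    fix u v assume "u \<in> verts ?H" "v \<in> verts ?H"
    then show "(map_prod \<phi> id u, map_prod \<phi> id v) \<in> edges ?H \<longleftrightarrow> (u, v) \<in> edges ?H"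
      by (cases u; cases v) (auto simp: V E automorphism_edge[OF that])
  qed
  show ?thesis
  proof (rule conjugacy_borel_complete_transfer[OF assms(3) F])
    fix v assume "v \<in> verts ?H"
    then show "\<exists>u\<in>verts G. \<exists>g. \<forall>\<phi>\<in>automorphisms G. F \<phi> v = g (\<phi> u)"
      by (intro bexI[of _ "fst v"] exI[of _ "\<lambda>x. (x, snd v)"])
        (auto simp: F_def blowup_def)
  next
    show "F \<delta> (F \<phi> v) = F \<psi> (F \<delta> v)"
      if "\<phi> \<in> automorphisms G" "\<psi> \<in> automorphisms G" "\<delta> \<in> automorphisms G"
        "\<forall>u\<in>verts G. \<delta> (\<phi> u) = \<psi> (\<delta> u)" "v \<in> verts ?H" for \<phi> \<psi> \<delta> v
      using that by (cases v) (simp add: F_def V automorphism_mem)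
    fix \<phi> \<psi> \<delta> assume a: "\<phi> \<in> automorphisms G" "\<psi> \<in> automorphisms G"
      and d: "\<delta> \<in> automorphisms ?H" and dc: "\<forall>v\<in>verts ?H. \<delta> (F \<phi> v) = F \<psi> (\<delta> v)"
    define \<delta>' where "\<delta>' a = fst (\<delta> (a, 0))" for a
    have m: "\<delta> (a, i) \<in> verts ?H" if "enat i < n" "a \<in> verts G" for i a
      using automorphism_mem[OF d, of "(a, i)"] that by (auto simp: V)
    txt \<open>The blown-up vertices are the classes of non-adjacency, so \<^term>\<open>\<delta>\<close> permutes them.\<close>
    have same: "fst u = fst v \<longleftrightarrow> \<not> ((u, v) \<in> edges ?H \<or> (v, u) \<in> edges ?H)"
      if "u \<in> verts ?H" "v \<in> verts ?H" for u v
      using that tournament_edge_cases[OF assms(1), of "fst u" "fst v"] tournament_irrefl[OF assms(1)]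
      by (cases u; cases v) (auto simp: E V)
    have same_image: "fst (\<delta> u) = fst (\<delta> v) \<longleftrightarrow> fst u = fst v"
      if "u \<in> verts ?H" "v \<in> verts ?H" for u v
      using that by (simp add: same automorphism_mem[OF d] automorphism_edge[OF d] automorphism_inj[OF d])
    have d0: "fst (\<delta> (a, i)) = \<delta>' a" if "a \<in> verts G" "enat i < n" for a i
      using same_image[of "(a, i)" "(a, 0)"] that n0 by (auto simp: V \<delta>'_def)
    have bij: "bij_betw \<delta>' (verts G) (verts G)"
      unfolding bij_betw_def
    proof
      show "inj_on \<delta>' (verts G)"
      proof (rule inj_onI)
        fix x y assume "x \<in> verts G" "y \<in> verts G" "\<delta>' x = \<delta>' y"
        then show "x = y" using same_image[of "(x, 0)" "(y, 0)"] n0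
          by (simp add: V \<delta>'_def)
      qed
      show "\<delta>' ` verts G = verts G"
      proof
        show "\<delta>' ` verts G \<subseteq> verts G"
        proof
          fix b assume "b \<in> \<delta>' ` verts G"
          then show "b \<in> verts G" using m[OF n0] by (auto simp: \<delta>'_def V blowup_def mem_Times_iff)
        qed
        show "verts G \<subseteq> \<delta>' ` verts G"
        proof
          fix b assume "b \<in> verts G"
          then have "(b, 0) \<in> verts ?H" using n0 by (simp add: V)
          then obtain v where v: "v \<in> verts ?H" "\<delta> v = (b, 0)"
            using automorphism_bij[OF d] by (metis bij_betw_iff_bijections)
          then have "b = \<delta>' (fst v)" "fst v \<in> verts G"
            using d0[of "fst v" "snd v"] by (cases v, auto simp: V)+
          then show "b \<in> \<delta>' ` verts G" by blast
        qed
      qed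
    qed
    have edge: "(\<delta>' u, \<delta>' v) \<in> edges G \<longleftrightarrow> (u, v) \<in> edges G" if "u \<in> verts G" "v \<in> verts G" for u v
      using automorphism_edge[OF d, of "(u, 0)" "(v, 0)"] that n0 m[OF n0, of u] m[OF n0, of v]
      by (cases "\<delta> (u, 0)"; cases "\<delta> (v, 0)") (simp add: V E \<delta>'_def)
    have "\<delta>' (\<phi> v) = \<psi> (\<delta>' v)" if v: "v \<in> verts G" for v
    proof -
      have "\<delta> (F \<phi> (v, 0)) = F \<psi> (\<delta> (v, 0))" using dc v n0 by (simp add: V)
      then have "fst (\<delta> (F \<phi> (v, 0))) = fst (F \<psi> (\<delta> (v, 0)))" by simp
      then show ?thesis
        using v a n0 m[OF n0 v] by (simp add: F_def V d0 automorphism_mem)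
    qed
    then show "\<exists>\<epsilon>\<in>automorphisms G. \<forall>v\<in>verts G. \<epsilon> (\<phi> v) = \<psi> (\<epsilon> v)"
      using restrict_automorphism[OF bij edge] a
      by (intro bexI[of _ "restrict \<delta>' (verts G)"]) (auto simp: automorphism_mem)
  qed
qed


section \<open>Back and forth\<close>

text \<open>A relation and not a partial function, so that the back step is the forth step for the
  converse.\<close>

definition partial_iso ::
  "('a \<Rightarrow> 'a \<Rightarrow> bool) \<Rightarrow> ('a \<Rightarrow> 'c) \<Rightarrow> ('b \<Rightarrow> 'b \<Rightarrow> bool) \<Rightarrow> ('b \<Rightarrow> 'c) \<Rightarrow> ('a \<times> 'b) set \<Rightarrow> bool" where
  "partial_iso E c E' c' r \<longleftrightarrow>
     (\<forall>a b x y. (a, b) \<in> r \<longrightarrow> (x, y) \<in> r \<longrightarrow>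
        c a = c' b \<and> (a = x \<longleftrightarrow> b = y) \<and> (E a x \<longleftrightarrow> E' b y))"

lemma partial_isoD:
  assumes "partial_iso E c E' c' r" "(a, b) \<in> r" "(x, y) \<in> r"
  shows "c a = c' b" "a = x \<longleftrightarrow> b = y" "E a x \<longleftrightarrow> E' b y"
  using assms unfolding partial_iso_def by blast+

text \<open>\<open>P\<close> is an arbitrary property of finite relations, because besides partial
  isomorphisms it is also used for the pairs of colours met along two corresponding nodes of a tree.
  \<open>P\<close> is not assumed to pass to subsets, so the conclusion places finite parts of the
  graph of \<open>h\<close> inside some relation with \<open>P\<close>.\<close>

lemma back_and_forth:
  assumes "countable A" "countable B" "P {}"
    and inj: "\<And>r a b x y. P r \<Longrightarrow> (a, b) \<in> r \<Longrightarrow> (x, y) \<in> r \<Longrightarrow> a = x \<longleftrightarrow> b = y"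
    and zig: "\<And>r a. finite r \<Longrightarrow> r \<subseteq> A \<times> B \<Longrightarrow> P r \<Longrightarrow> a \<in> A \<Longrightarrow> \<exists>b\<in>B. P (insert (a, b) r)"
    and zag: "\<And>r b. finite r \<Longrightarrow> r \<subseteq> A \<times> B \<Longrightarrow> P r \<Longrightarrow> b \<in> B \<Longrightarrow> \<exists>a\<in>A. P (insert (a, b) r)"
  shows "\<exists>h. bij_betw h A B \<and>
    (\<forall>F. finite F \<and> F \<subseteq> A \<longrightarrow> (\<exists>r. P r \<and> (\<lambda>x. (x, h x)) ` F \<subseteq> r))"
proof -
  define Q where "Q r \<longleftrightarrow> finite r \<and> r \<subseteq> A \<times> B \<and> P r" for r
  \<comment> \<open>Stage \<open>n\<close> takes care of the elements numbered \<open>n\<close> in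
    the enumerations of \<open>A\<close> and \<open>B\<close>.\<close>
  define R where "R n r r' \<longleftrightarrow> r \<subseteq> r' \<and> (\<forall>a\<in>A. to_nat_on A a = n \<longrightarrow> a \<in> fst ` r') \<and>
      (\<forall>b\<in>B. to_nat_on B b = n \<longrightarrow> b \<in> snd ` r')" for n r r'
  have "\<exists>r'. Q r' \<and> R n r r'" if "Q r" for n r
  proof -
    have "\<exists>r'. Q r' \<and> r \<subseteq> r' \<and> (\<forall>a\<in>A. to_nat_on A a = n \<longrightarrow> a \<in> fst ` r')"
    proof (cases "\<exists>a\<in>A. to_nat_on A a = n")
      case True
      then obtain a where a: "a \<in> A" "to_nat_on A a = n" by auto
      then obtain b where "b \<in> B" "P (insert (a, b) r)" using zig[of r a] \<open>Q r\<close> a unfolding Q_def by blast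
      then have "Q (insert (a, b) r)" using \<open>Q r\<close> a by (auto simp: Q_def)
      moreover have "a' = a" if "a' \<in> A" "to_nat_on A a' = n" for a'
        using that a assms(1) by (metis to_nat_on_inj)
      ultimately show ?thesis by (intro exI[of _ "insert (a, b) r"]) auto
    qed (use \<open>Q r\<close> in auto)
    then obtain r1 where r1: "Q r1" "r \<subseteq> r1" "\<forall>a\<in>A. to_nat_on A a = n \<longrightarrow> a \<in> fst ` r1" by blast
    have "\<exists>r'. Q r' \<and> r1 \<subseteq> r' \<and> (\<forall>b\<in>B. to_nat_on B b = n \<longrightarrow> b \<in> snd ` r')"
    proof (cases "\<exists>b\<in>B. to_nat_on B b = n")
      case True
      then obtain b where b: "b \<in> B" "to_nat_on B b = n" by auto
      then obtain a where "a \<in> A" "P (insert (a, b) r1)" using zag[of r1 b] r1(1) b unfolding Q_def by blast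
      then have "Q (insert (a, b) r1)" using r1 b by (auto simp: Q_def)
      moreover have "b' = b" if "b' \<in> B" "to_nat_on B b' = n" for b'
        using that b assms(2) by (metis to_nat_on_inj)
      ultimately show ?thesis by (intro exI[of _ "insert (a, b) r1"]) auto
    qed (use r1 in auto)
    then obtain r2 where "Q r2" "r1 \<subseteq> r2" "\<forall>b\<in>B. to_nat_on B b = n \<longrightarrow> b \<in> snd ` r2" by blast
    moreover have "fst ` r1 \<subseteq> fst ` r2" using calculation by (intro image_mono)
    ultimately show ?thesis using r1 unfolding R_def by (intro exI[of _ r2]) blast
  qed
  moreover have "Q {}" using assms(3) by (simp add: Q_def)
  ultimately obtain f where f: "\<And>n. Q (f n)" "\<And>n. R n (f n) (f (Suc n))"
    using dependent_nat_choice[of "\<lambda>_. Q" R] by metis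
  have mono: "f i \<subseteq> f j" if "i \<le> j" for i j
    using lift_Suc_mono_le[of f, OF _ that] f(2) by (auto simp: R_def)
  define r where "r = (\<Union>n. f n)"
  have fin: "\<exists>n. F \<subseteq> f n" if "finite F" "F \<subseteq> r" for F
    using that
  proof (induction F rule: finite_induct)
    case (insert x F)
    then obtain i j where "F \<subseteq> f i" "x \<in> f j" by (auto simp: r_def)
    then have "insert x F \<subseteq> f (max i j)" using mono[of i "max i j"] mono[of j "max i j"] by auto
    then show ?case by blast
  qed auto
  have inj_r: "a = x \<longleftrightarrow> b = y" if "(a, b) \<in> r" "(x, y) \<in> r" for a b x y
  proof -
    have "\<exists>n. {(a, b), (x, y)} \<subseteq> f n" using that by (intro fin) auto
    then obtain n where "{(a, b), (x, y)} \<subseteq> f n" by blast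
    then show ?thesis using inj[of "f n" a b x y] f(1)[of n] by (simp add: Q_def)
  qed
  have sub: "r \<subseteq> A \<times> B" using f(1) by (auto simp: r_def Q_def)
  have ex: "\<exists>b. (a, b) \<in> r" if "a \<in> A" for a
    using f(2)[of "to_nat_on A a"] that by (fastforce simp: R_def r_def)
  have ex': "\<exists>a. (a, b) \<in> r" if "b \<in> B" for b
    using f(2)[of "to_nat_on B b"] that by (fastforce simp: R_def r_def)
  define h where "h a = (SOME b. (a, b) \<in> r)" for a
  have h: "(a, h a) \<in> r" if "a \<in> A" for a
    unfolding h_def using ex[OF that] by (rule someI_ex)
  have "bij_betw h A B"
    unfolding bij_betw_def
  proof
    show "inj_on h A" by (rule inj_onI) (metis h inj_r)
    show "h ` A = B"
    proof
      show "h ` A \<subseteq> B" using h sub by auto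
      show "B \<subseteq> h ` A"
      proof
        fix b assume "b \<in> B"
        then obtain a where ab: "(a, b) \<in> r" using ex' by blast
        then have "a \<in> A" using sub by auto
        then have "h a = b" using h[of a] inj_r[OF ab, of a "h a"] by auto
        then show "b \<in> h ` A" using \<open>a \<in> A\<close> by auto
      qed
    qed
  qed
  moreover have "\<exists>r. P r \<and> (\<lambda>x. (x, h x)) ` F \<subseteq> r" if "finite F" "F \<subseteq> A" for F
    using fin[of "(\<lambda>x. (x, h x)) ` F"] that h f(1) by (force simp: Q_def)
  ultimately show ?thesis by blast
qed

text \<open>\<open>E\<close> on \<open>A\<close> may be any relation here: a strict order or the edge relation of a tournament.\<close>

definition extends_into ::
  "'a set \<Rightarrow> ('a \<Rightarrow> 'a \<Rightarrow> bool) \<Rightarrow> ('a \<Rightarrow> 'c) \<Rightarrow> 'b set \<Rightarrow> ('b \<Rightarrow> 'b \<Rightarrow> bool) \<Rightarrow> ('b \<Rightarrow> 'c) \<Rightarrow> bool" where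
  "extends_into A E c B E' c' \<longleftrightarrow>
     (\<forall>r a. finite r \<and> r \<subseteq> A \<times> B \<and> partial_iso E c E' c' r \<and> a \<in> A \<and> a \<notin> fst ` r \<longrightarrow>
        (\<exists>b\<in>B. b \<notin> snd ` r \<and> c' b = c a \<and> (\<forall>(x, y)\<in>r. (E x a \<longleftrightarrow> E' y b) \<and> (E a x \<longleftrightarrow> E' b y))))"

lemma extends_intoD:
  assumes "extends_into A E c B E' c'" "finite r" "r \<subseteq> A \<times> B" "partial_iso E c E' c' r" "a \<in> A"
    "a \<notin> fst ` r"
  shows "\<exists>b\<in>B. b \<notin> snd ` r \<and> c' b = c a \<and> (\<forall>(x, y)\<in>r. (E x a \<longleftrightarrow> E' y b) \<and> (E a x \<longleftrightarrow> E' b y))"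
  using assms unfolding extends_into_def by simp

lemma partial_iso_insert:
  assumes "partial_iso E c E' c' r" "a \<notin> fst ` r" "b \<notin> snd ` r" "c' b = c a"
    "\<forall>(x, y)\<in>r. (E x a \<longleftrightarrow> E' y b) \<and> (E a x \<longleftrightarrow> E' b y)" "\<not> E a a" "\<not> E' b b"
  shows "partial_iso E c E' c' (insert (a, b) r)"
  unfolding partial_iso_def
proof (intro allI impI)
  fix x y u v assume xy: "(x, y) \<in> insert (a, b) r" and uv: "(u, v) \<in> insert (a, b) r"
  have new: "x \<noteq> a" "y \<noteq> b" "E x a \<longleftrightarrow> E' y b" "E a x \<longleftrightarrow> E' b y" if "(x, y) \<in> r" for x y
    using that assms(2,3,5) by force+
  show "c x = c' y \<and> (x = u \<longleftrightarrow> y = v) \<and> (E x u \<longleftrightarrow> E' y v)"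
    using xy uv partial_isoD[OF assms(1), of x y u v] partial_isoD(1)[OF assms(1), of x y x y]
      new[of x y] new[of u v] assms(4,6,7)
    by (cases "(x, y) \<in> r"; cases "(u, v) \<in> r") auto
qed

lemma partial_iso_converse:
  "partial_iso E c E' c' r \<Longrightarrow> partial_iso E' c' E c (r\<inverse>)"
  unfolding partial_iso_def converse_iff by (intro allI impI) metis

lemma back_and_forth_iso:
  assumes "countable A" "countable B" "\<And>a. \<not> E a a" "\<And>b. \<not> E' b b"
    and "extends_into A E c B E' c'" "extends_into B E' c' A E c"
  shows "\<exists>h. bij_betw h A B \<and> (\<forall>x\<in>A. c' (h x) = c x) \<and> (\<forall>x\<in>A. \<forall>y\<in>A. E' (h x) (h y) \<longleftrightarrow> E x y)"
proof -
  have "\<exists>h. bij_betw h A B \<and>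
    (\<forall>F. finite F \<and> F \<subseteq> A \<longrightarrow> (\<exists>r. partial_iso E c E' c' r \<and> (\<lambda>x. (x, h x)) ` F \<subseteq> r))"
  proof (rule back_and_forth[OF assms(1,2)])
    fix r a assume r: "finite r" "r \<subseteq> A \<times> B" "partial_iso E c E' c' r" and a: "a \<in> A"
    show "\<exists>b\<in>B. partial_iso E c E' c' (insert (a, b) r)"
    proof (cases "a \<in> fst ` r")
      case True
      then obtain b where "(a, b) \<in> r" by auto
      then show ?thesis using r by (auto simp: insert_absorb intro!: bexI[of _ b])
    next
      case False
      then obtain b where "b\<in>B" "b \<notin> snd ` r" "c' b = c a"
          "\<forall>(x, y)\<in>r. (E x a \<longleftrightarrow> E' y b) \<and> (E a x \<longleftrightarrow> E' b y)"
        using extends_intoD[OF assms(5) r a False] by blast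
      then show ?thesis
        using partial_iso_insert[OF r(3) False] assms(3,4) by blast
    qed
  next
    fix r b assume r: "finite r" "r \<subseteq> A \<times> B" "partial_iso E c E' c' r" and b: "b \<in> B"
    show "\<exists>a\<in>A. partial_iso E c E' c' (insert (a, b) r)"
    proof (cases "b \<in> snd ` r")
      case True
      then obtain a where "(a, b) \<in> r" by auto
      then show ?thesis using r by (auto simp: insert_absorb intro!: bexI[of _ a])
    next
      case False
      have r': "finite (r\<inverse>)" "r\<inverse> \<subseteq> B \<times> A" "partial_iso E' c' E c (r\<inverse>)" "b \<notin> fst ` (r\<inverse>)"
        using r False by (auto simp: partial_iso_converse image_iff Bex_def)
      then obtain a where "a\<in>A" "a \<notin> snd ` (r\<inverse>)" "c a = c' b"
          "\<forall>(x, y)\<in>r\<inverse>. (E' x b \<longleftrightarrow> E y a) \<and> (E' b x \<longleftrightarrow> E a y)"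
        using extends_intoD[OF assms(6) r'(1-3) b r'(4)] by blast
      then have "partial_iso E' c' E c (insert (b, a) (r\<inverse>))"
        using partial_iso_insert[OF r'(3,4)] assms(3,4) by blast
      moreover have "insert (b, a) (r\<inverse>) = (insert (a, b) r)\<inverse>" by auto
      ultimately have "partial_iso E c E' c' (insert (a, b) r)" using partial_iso_converse by fastforce
      then show ?thesis using \<open>a \<in> A\<close> by blast
    qed
  qed (auto simp: partial_iso_def)
  then obtain h where h: "bij_betw h A B"
    and F: "\<forall>F. finite F \<and> F \<subseteq> A \<longrightarrow> (\<exists>r. partial_iso E c E' c' r \<and> (\<lambda>x. (x, h x)) ` F \<subseteq> r)"
    by (elim exE conjE)
  have "c' (h x) = c x \<and> (E' (h x) (h y) \<longleftrightarrow> E x y)" if "x \<in> A" "y \<in> A" for x y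
  proof -
    have "\<exists>r. partial_iso E c E' c' r \<and> (x, h x) \<in> r \<and> (y, h y) \<in> r"
      using F[rule_format, of "{x, y}"] that by auto
    then obtain r where r: "partial_iso E c E' c' r" "(x, h x) \<in> r" "(y, h y) \<in> r" by blast
    show ?thesis using partial_isoD[OF r] by simp
  qed
  then show ?thesis using h by blast
qed

section \<open>Countable dense orders without endpoints in which every colour is dense\<close>

locale dense_coloured =
  fixes A :: "'a set" and lt :: "'a \<Rightarrow> 'a \<Rightarrow> bool" and c :: "'a \<Rightarrow> 'c" and C :: "'c set"
  assumes countable: "countable A" and nonempty: "A \<noteq> {}"
    and colour: "x \<in> A \<Longrightarrow> c x \<in> C"
    and irrefl: "\<not> lt x x"
    and trans: "lt x y \<Longrightarrow> lt y z \<Longrightarrow> x \<in> A \<Longrightarrow> y \<in> A \<Longrightarrow> z \<in> A \<Longrightarrow> lt x z"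
    and total: "x \<in> A \<Longrightarrow> y \<in> A \<Longrightarrow> x = y \<or> lt x y \<or> lt y x"
    and above: "k \<in> C \<Longrightarrow> x \<in> A \<Longrightarrow> \<exists>y\<in>A. lt x y \<and> c y = k"
    and below: "k \<in> C \<Longrightarrow> x \<in> A \<Longrightarrow> \<exists>y\<in>A. lt y x \<and> c y = k"
    and mid: "k \<in> C \<Longrightarrow> x \<in> A \<Longrightarrow> y \<in> A \<Longrightarrow> lt x y \<Longrightarrow> \<exists>z\<in>A. lt x z \<and> lt z y \<and> c z = k"

text \<open>Only the largest element of \<open>L\<close> and the smallest of \<open>U\<close>
  matter; when one of the sets is empty, the absence of endpoints takes over.\<close>

lemma dense_coloured_between:
  assumes "dense_coloured A lt c C" "finite L" "finite U" "L \<subseteq> A" "U \<subseteq> A" "k \<in> C"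
    and "\<And>l u. l \<in> L \<Longrightarrow> u \<in> U \<Longrightarrow> lt l u"
  shows "\<exists>z\<in>A. c z = k \<and> (\<forall>l\<in>L. lt l z) \<and> (\<forall>u\<in>U. lt z u)"
proof -
  have trans: "lt x z" if "lt x y" "lt y z" "x\<in>A" "y\<in>A" "z\<in>A" for x y z
    using dense_coloured.trans[OF assms(1)] that by blast
  have total: "x = y \<or> lt x y \<or> lt y x" if "x\<in>A" "y\<in>A" for x y
    using dense_coloured.total[OF assms(1)] that by blast
  have max: "\<exists>l\<in>L. \<forall>x\<in>L. x = l \<or> lt x l" if "finite L" "L \<noteq> {}" "L \<subseteq> A" for L
    using that
  proof (induction L rule: finite_ne_induct)
    case (insert a L)
    then obtain l where l: "l \<in> L" "\<forall>x\<in>L. x = l \<or> lt x l" by auto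
    then show ?case using insert.prems total[of a l] trans by (metis insert_iff subsetD)
  qed auto
  have min: "\<exists>l\<in>L. \<forall>x\<in>L. x = l \<or> lt l x" if "finite L" "L \<noteq> {}" "L \<subseteq> A" for L
    using that
  proof (induction L rule: finite_ne_induct)
    case (insert a L)
    then obtain l where l: "l \<in> L" "\<forall>x\<in>L. x = l \<or> lt l x" by auto
    then show ?case using insert.prems total[of a l] trans by (metis insert_iff subsetD)
  qed auto
  have above: "\<exists>y\<in>A. lt x y \<and> c y = k" and below: "\<exists>y\<in>A. lt y x \<and> c y = k" if "x \<in> A" for x
    using dense_coloured.above[OF assms(1,6) that] dense_coloured.below[OF assms(1,6) that] .
  have mid: "\<exists>z\<in>A. lt x z \<and> lt z y \<and> c z = k" if "x \<in> A" "y \<in> A" "lt x y" for x y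
    using dense_coloured.mid[OF assms(1,6) that] .
  show ?thesis
  proof (cases "L = {}")
    case L: True
    show ?thesis
    proof (cases "U = {}")
      case True
      obtain x where "x \<in> A" using dense_coloured.nonempty[OF assms(1)] by blast
      then show ?thesis using above L True by blast
    next
      case False
      obtain u where u: "u \<in> U" "\<forall>x\<in>U. x = u \<or> lt u x" using min[OF assms(3) False assms(5)] by blast
      then obtain z where z: "z \<in> A" "lt z u" "c z = k" using below assms(5) by blast
      have "lt z x" if "x \<in> U" for x
        using u(2) that z trans[OF z(2), of x] subsetD[OF assms(5) u(1)] subsetD[OF assms(5) that] by auto
      then show ?thesis using z L by blast
    qed
  next
    case False
    obtain l where l: "l \<in> L" "\<forall>x\<in>L. x = l \<or> lt x l" using max[OF assms(2) False assms(4)] by blast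
    have lower: "lt x z" if "x \<in> L" "z \<in> A" "lt l z" for x z
      using l(2) that trans[OF _ that(3), of x] subsetD[OF assms(4) l(1)] subsetD[OF assms(4) that(1)] by auto
    show ?thesis
    proof (cases "U = {}")
      case True
      obtain z where "z \<in> A" "lt l z" "c z = k" using above l(1) assms(4) by blast
      then show ?thesis using True lower by blast
    next
      case False
      obtain u where u: "u \<in> U" "\<forall>x\<in>U. x = u \<or> lt u x" using min[OF assms(3) False assms(5)] by blast
      have "l \<in> A" "u \<in> A" using l(1) u(1) assms(4,5) by auto
      then obtain z where z: "z \<in> A" "lt l z" "lt z u" "c z = k"
        using mid[of l u] assms(7)[OF l(1) u(1)] by blast
      have "lt z x" if "x \<in> U" for x
        using u(2) that z trans[OF z(3), of x] subsetD[OF assms(5) u(1)] subsetD[OF assms(5) that] by auto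
      then show ?thesis using z lower by blast
    qed
  qed
qed

text \<open>The partners of the points below \<open>a\<close> lie below the partners of the points
  above \<open>a\<close>, and any point of the right colour in this gap will do.\<close>

lemma dense_coloured_extends:
  assumes "dense_coloured A lt c C" "dense_coloured B lt' c' C"
  shows "extends_into A lt c B lt' c'"
  unfolding extends_into_def
proof (intro allI impI, elim conjE)
  fix r a assume r: "finite r" "r \<subseteq> A \<times> B" "partial_iso lt c lt' c' r" "a \<in> A" "a \<notin> fst ` r"
  define L where "L = snd ` {p\<in>r. lt (fst p) a}"
  define U where "U = snd ` {p\<in>r. lt a (fst p)}"
  have asym: "\<not> (lt x y \<and> lt y x)" if "x\<in>A" "y\<in>A" for x y
    using dense_coloured.irrefl[OF assms(1)] dense_coloured.trans[OF assms(1)] that by blast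
  have asym': "\<not> (lt' x y \<and> lt' y x)" if "x\<in>B" "y\<in>B" for x y
    using dense_coloured.irrefl[OF assms(2)] dense_coloured.trans[OF assms(2)] that by blast
  have irr: "\<not> lt' x x" for x
    using dense_coloured.irrefl[OF assms(2)] .
  have "\<exists>z\<in>B. c' z = c a \<and> (\<forall>l\<in>L. lt' l z) \<and> (\<forall>u\<in>U. lt' z u)"
  proof (rule dense_coloured_between[OF assms(2)])
    show "finite L" "finite U" using r by (auto simp: L_def U_def)
    show "L \<subseteq> B" "U \<subseteq> B" using r by (auto simp: L_def U_def)
    show "c a \<in> C" using dense_coloured.colour[OF assms(1) r(4)] .
    fix l u assume "l \<in> L" "u \<in> U"
    then obtain x y where xy: "(x, l) \<in> r" "(y, u) \<in> r" "lt x a" "lt a y" by (auto simp: L_def U_def)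
    then have "lt x y" using dense_coloured.trans[OF assms(1), of x a y] r(2,4) by auto
    then show "lt' l u" using partial_isoD(3)[OF r(3) xy(1,2)] by blast
  qed
  then obtain z where z: "z \<in> B" "c' z = c a" "\<forall>l\<in>L. lt' l z" "\<forall>u\<in>U. lt' z u" by blast
  have *: "(lt x a \<and> lt' y z) \<or> (lt a x \<and> lt' z y)" if "(x, y) \<in> r" for x y
  proof -
    have "x \<noteq> a" "x \<in> A" using that r by force+
    then have "lt x a \<or> lt a x" using dense_coloured.total[OF assms(1)] r(4) by blast
    then show ?thesis using z that by (force simp: L_def U_def)
  qed
  have "z \<notin> snd ` r" using * irr by force
  moreover have "(lt x a \<longleftrightarrow> lt' y z) \<and> (lt a x \<longleftrightarrow> lt' z y)" if "(x, y) \<in> r" for x y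
    using *[OF that] asym[of x a] asym'[of y z] r z(1) that by blast
  ultimately show "\<exists>b\<in>B. b \<notin> snd ` r \<and> c' b = c a \<and>
      (\<forall>(x, y)\<in>r. (lt x a \<longleftrightarrow> lt' y b) \<and> (lt a x \<longleftrightarrow> lt' b y))"
    using z by blast
qed

text \<open>The coloured form of Cantor's theorem on countable dense orders. It identifies the
  coding order with the concrete ones and also lifts isomorphisms of structures.\<close>

lemma dense_coloured_iso:
  assumes "dense_coloured A lt c C" "dense_coloured B lt' c' C"
  shows "\<exists>h. bij_betw h A B \<and> (\<forall>x\<in>A. c' (h x) = c x) \<and> (\<forall>x\<in>A. \<forall>y\<in>A. lt' (h x) (h y) \<longleftrightarrow> lt x y)"
  using dense_coloured_extends[OF assms] dense_coloured_extends[OF assms(2,1)] assms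
  by (intro back_and_forth_iso) (simp_all add: dense_coloured.countable dense_coloured.irrefl)

text \<open>The 2-adic valuation of the denominator.\<close>

definition dyadic :: "rat \<Rightarrow> nat" where
  "dyadic q = (LEAST k. \<exists>d::nat. odd d \<and> 2 ^ k * of_nat d * q \<in> \<int>)"

lemma dyadic_add_1 [simp]: "dyadic (q + 1) = dyadic q"
proof -
  have "2 ^ k * of_nat d * (q + 1) \<in> \<int> \<longleftrightarrow> 2 ^ k * of_nat d * q \<in> \<int>" for k d
  proof -
    have "2 ^ k * of_nat d * (q + 1) = 2 ^ k * of_nat d * q + of_nat (2 ^ k * d)"
      by (simp add: algebra_simps)
    then show ?thesis by (metis Ints_add Ints_diff Ints_of_nat add_diff_cancel_right')
  qed
  then show ?thesis by (simp add: dyadic_def)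
qed

text \<open>The odd number \<open>d\<close> absorbs the factor 3.\<close>

lemma dyadic_times_3 [simp]: "dyadic (3 * q) = dyadic q"
proof -
  have "(\<exists>d::nat. odd d \<and> 2 ^ k * of_nat d * (3 * q) \<in> \<int>) \<longleftrightarrow>
      (\<exists>d::nat. odd d \<and> 2 ^ k * of_nat d * q \<in> \<int>)" for k
  proof safe
    fix d :: nat assume d: "odd d" "2 ^ k * of_nat d * (3 * q) \<in> \<int>"
    have "2 ^ k * of_nat (3 * d) * q = 2 ^ k * of_nat d * (3 * q)" by simp
    then show "\<exists>d::nat. odd d \<and> 2 ^ k * of_nat d * q \<in> \<int>"
      using d by (intro exI[of _ "3 * d"]) (simp only: even_mult_iff, simp)
  next
    fix d :: nat assume d: "odd d" "2 ^ k * of_nat d * q \<in> \<int>"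
    have "2 ^ k * of_nat d * (3 * q) = 3 * (2 ^ k * of_nat d * q)" by simp
    then show "\<exists>d::nat. odd d \<and> 2 ^ k * of_nat d * (3 * q) \<in> \<int>"
      using d by (intro exI[of _ d]) (simp only: Ints_mult Ints_numeral, simp)
  qed
  then show ?thesis by (simp add: dyadic_def)
qed

lemma dyadic_0 [simp]: "dyadic 0 = 0"
  by (auto simp: dyadic_def intro!: Least_equality exI[of _ 1])

text \<open>The powers of 3 refine the grid without changing the 2-adic valuation; the fractions
  with odd numerator over \<open>2 ^ k\<close> alone would be discrete.\<close>

lemma dyadic_fraction: "dyadic (of_int (2 * j + 1) / (2 ^ k * 3 ^ n)) = k"
  unfolding dyadic_def
proof (rule Least_equality)
  show "\<exists>d::nat. odd d \<and> 2 ^ k * of_nat d * (of_int (2 * j + 1) / (2 ^ k * 3 ^ n)) \<in> (\<int>::rat set)"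
    by (intro exI[of _ "3 ^ n"]) simp
  fix l assume "\<exists>d::nat. odd d \<and> 2 ^ l * of_nat d * (of_int (2 * j + 1) / (2 ^ k * 3 ^ n)) \<in> (\<int>::rat set)"
  then obtain d :: nat and z where d: "odd d"
    and z: "2 ^ l * of_nat d * (of_int (2 * j + 1) / (2 ^ k * 3 ^ n)) = (of_int z :: rat)"
    by (auto elim: Ints_cases)
  then have "(of_int (2 ^ l * int d * (2 * j + 1)) :: rat) = of_int (z * 2 ^ k * 3 ^ n)"
    by (simp add: field_simps)
  then have eq: "2 ^ l * int d * (2 * j + 1) = z * 2 ^ k * 3 ^ n" by (simp only: of_int_eq_iff)
  show "k \<le> l"
  proof (rule ccontr)
    assume "\<not> k \<le> l"
    then have k: "(2::int) ^ k = 2 ^ l * (2 * 2 ^ (k - l - 1))"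
      by (simp flip: power_Suc power_add)
    have "2 ^ l * (int d * (2 * j + 1)) = 2 ^ l * (z * (2 * 2 ^ (k - l - 1)) * 3 ^ n)"
      using eq by (simp only: k mult_ac)
    then have "int d * (2 * j + 1) = z * (2 * 2 ^ (k - l - 1)) * 3 ^ n" by simp
    then have "even (int d * (2 * j + 1))" by simp
    then show False using d by simp
  qed
qed

lemma dyadic_dense:
  assumes "a < b" shows "\<exists>q. a < q \<and> q < b \<and> dyadic q = k"
proof -
  \<comment> \<open>\<open>c / 3 ^ n\<close> is the gap between consecutive fractions with odd
    numerator over \<open>2 ^ k * 3 ^ n\<close>.\<close>
  define c :: rat where "c = 2 / 2 ^ k"
  obtain n :: nat where n: "2 * c / (b - a) < 3 ^ n"
    using real_arch_pow[of 3 "of_rat (2 * c / (b - a))"]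
    by (metis (no_types, lifting) of_rat_less of_rat_numeral_eq of_rat_power one_less_numeral_iff semiring_norm(77))
  define e :: rat where "e = c / 3 ^ n"
  have e: "e > 0" "2 * e < b - a" using n assms by (auto simp: e_def c_def field_simps)
  \<comment> \<open>\<open>j * e\<close> is the first multiple of \<open>e\<close> beyond
    \<open>a\<close>, and adding \<open>e / 2\<close> makes the numerator odd.\<close>
  define j where "j = \<lfloor>a / e\<rfloor> + 1"
  have "of_int \<lfloor>a / e\<rfloor> * e \<le> a" using e(1) by (simp flip: pos_le_divide_eq)
  then have "of_int j * e > a" "of_int j * e \<le> a + e"
    using e floor_correct[of "a / e"] by (auto simp: j_def field_simps pos_le_divide_eq)
  then have "of_int (2 * j + 1) / (2 ^ k * 3 ^ n) = of_int j * e + e / 2" "a < of_int j * e + e / 2"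
    "of_int j * e + e / 2 < b"
    using e by (auto simp: e_def c_def field_simps)
  then show ?thesis using dyadic_fraction[of j k n] by (intro exI[of _ "of_int j * e + e / 2"]) auto
qed

lemma ex_dyadic: "(\<exists>q>a. dyadic q = k)" "(\<exists>q<a. dyadic q = k)"
  using dyadic_dense[of a "a + 1" k] dyadic_dense[of "a - 1" a k] by auto


section \<open>Coding structures by linear orders\<close>

lemma less_append_singleton: "s < s @ [x :: 'a :: linorder]"
  by (induction s) auto

text \<open>Below \<open>t\<close> there is room for infinitely many children of \<open>s\<close>:
  if \<open>s\<close> is a prefix of \<open>t\<close>, those with labels smaller than the next entry
  of \<open>t\<close>, and otherwise all. This separates the blocks of different nodes.\<close>

lemma between_append_singleton:
  fixes s t :: "rat list"
  assumes "s < t" shows "\<exists>y. \<forall>x<y. s @ [x] < t"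
  using assms
proof (induction s arbitrary: t)
  case Nil
  then show ?case by (cases t) auto
next
  case (Cons a s)
  then obtain b t' where t: "t = b # t'" by (cases t) auto
  show ?case
  proof (cases "a < b")
    case False
    then have "a = b" "s < t'" using Cons.prems t by auto
    then show ?thesis using Cons.IH[of t'] t by auto
  qed (use t in auto)
qed

text \<open>Prefixes are not part of the order, but by this equivalence the parent of
  \<open>t\<close> is the greatest node of its depth that lies before \<open>t\<close>.\<close>

lemma less_iff_le_butlast:
  fixes u t :: "'a :: linorder list"
  assumes "length t = Suc (length u)" shows "u < t \<longleftrightarrow> u \<le> butlast t"
  using assms
proof (induction u arbitrary: t)
  case Nil
  then show ?case by (cases t) auto
next
  case (Cons a u)
  then obtain b t' where "t = b # t'" "length t' = Suc (length u)" by (cases t) auto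
  then show ?case using Cons.IH[of t'] by auto
qed

text \<open>A node \<open>s\<close> of the tree of finite sequences of rationals stands for the tuple \<open>map dyadic s\<close>.
  Its label is one bit: the truth value at this tuple of the formula with code \<open>length s\<close>, which is
  \<open>x\<^sub>a = x\<^sub>b\<close> or \<open>R\<^sub>i(x\<^sub>j, \<dots>)\<close>. The first component of the code is a dummy, so that every
  formula is treated at arbitrarily long nodes.\<close>

definition node_bit ::
  "nat set \<Rightarrow> (nat \<Rightarrow> nat) \<Rightarrow> (nat \<times> nat list \<Rightarrow> bool) \<Rightarrow> rat list \<Rightarrow> bool" where
  "node_bit I ar S s = (case from_nat (length s) :: nat \<times> nat \<times> nat list of (_, i, js) \<Rightarrow>
     (\<forall>j\<in>set js. j < length s) \<and>
     (case i of
        0 \<Rightarrow> (\<exists>a b. js = [a, b] \<and> dyadic (s ! a) = dyadic (s ! b))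
      | Suc i \<Rightarrow> (i, js) \<in> atoms I ar \<and> S (i, map (\<lambda>j. dyadic (s ! j)) js)))"

text \<open>The parity of the weight is the bit and its half, rounded down, is the depth.\<close>

definition weight ::
  "nat set \<Rightarrow> (nat \<Rightarrow> nat) \<Rightarrow> (nat \<times> nat list \<Rightarrow> bool) \<Rightarrow> rat list \<Rightarrow> nat" where
  "weight I ar S s = 2 * length s + of_bool (node_bit I ar S s)"

type_synonym point = "rat list \<times> nat \<times> rat"

definition pless :: "point \<Rightarrow> point \<Rightarrow> bool" where
  "pless = (\<lambda>(s, n, q) (t, m, r). s < t \<or> s = t \<and> (n < m \<or> n = m \<and> q < r))"

text \<open>Tripling fixes exactly 0 and translation by 1 fixes nothing, so the node
  \<open>s\<close> keeps \<open>weight + 1\<close> fixed points, one in each copy with index up to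
  the weight; the remaining copies of the rationals contribute none.\<close>

definition phi :: "nat set \<Rightarrow> (nat \<Rightarrow> nat) \<Rightarrow> (nat \<times> nat list \<Rightarrow> bool) \<Rightarrow> point \<Rightarrow> point" where
  "phi I ar S = (\<lambda>(s, n, q). (s, n, if n \<le> weight I ar S s then 3 * q else q + 1))"

definition fixed :: "nat set \<Rightarrow> (nat \<Rightarrow> nat) \<Rightarrow> (nat \<times> nat list \<Rightarrow> bool) \<Rightarrow> point set" where
  "fixed I ar S = {x. phi I ar S x = x}"

lemma fixed_iff: "(s, n, q) \<in> fixed I ar S \<longleftrightarrow> n \<le> weight I ar S s \<and> q = 0"
  by (auto simp: fixed_def phi_def)

lemma atoms_map: "(i, map f xs) \<in> atoms I ar \<longleftrightarrow> (i, xs) \<in> atoms I ar"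
  by (simp add: atoms_def)

text \<open>For a fixed node everything but the truth value of one atom is decided in advance; this
  makes the coding continuous.\<close>

lemma node_bit_cases:
  "(\<exists>b. \<forall>S. node_bit I ar S s = b) \<or> (\<exists>a\<in>atoms I ar. \<forall>S. node_bit I ar S s = S a)"
proof -
  obtain p i js where c: "from_nat (length s) = (p :: nat, i :: nat, js :: nat list)" by (metis prod_cases3)
  show ?thesis
  proof (cases i)
    case 0
    then show ?thesis by (intro disjI1 exI[of _ "node_bit I ar (\<lambda>_. True) s"]) (simp add: node_bit_def c)
  next
    case (Suc i')
    show ?thesis
    proof (cases "(i', js) \<in> atoms I ar \<and> (\<forall>j\<in>set js. j < length s)")
      case True
      then show ?thesis
        by (intro disjI2 bexI[of _ "(i', map (\<lambda>j. dyadic (s ! j)) js)"])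
          (simp_all add: node_bit_def c Suc atoms_map)
    next
      case False
      then show ?thesis by (intro disjI1 exI[of _ False]) (auto simp: node_bit_def c Suc)
    qed
  qed
qed

lemma openin_node_bit: "openin (structures I ar) {S \<in> topspace (structures I ar). Q (node_bit I ar S s)}"
  using node_bit_cases[of I ar s]
proof
  assume "\<exists>b. \<forall>S. node_bit I ar S s = b"
  then obtain b where "\<forall>S. node_bit I ar S s = b" by blast
  then show ?thesis by (cases "Q b") auto
next
  assume "\<exists>a\<in>atoms I ar. \<forall>S. node_bit I ar S s = S a"
  then obtain a where a: "a \<in> atoms I ar" "\<And>S. node_bit I ar S s = S a" by blast
  have "continuous_map (structures I ar) (discrete_topology UNIV) (\<lambda>S. S a)"
    unfolding structures_def by (rule continuous_map_product_projection[OF a(1)])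
  then have "openin (structures I ar) {S \<in> topspace (structures I ar). S a \<in> {x. Q x}}"
    by (rule openin_continuous_map_preimage) auto
  then show ?thesis by (simp add: a(2))
qed

lemma openin_phi: "openin (structures I ar) {S \<in> topspace (structures I ar). P (phi I ar S y)}"
proof -
  obtain s n q where y: "y = (s, n, q)" by (metis prod_cases3)
  show ?thesis
    using openin_node_bit[of I ar "\<lambda>b. P (s, n, if n \<le> 2 * length s + of_bool b then 3 * q else q + 1)" s]
    by (simp add: y phi_def weight_def)
qed

section \<open>Isomorphisms of structures and of their labelled trees\<close>

lemma structure_iso_lift:
  assumes "(S, S') \<in> structure_iso I ar"
  obtains \<alpha> where "bij \<alpha>" "\<And>x y. \<alpha> x < \<alpha> y \<longleftrightarrow> x < y"
    "\<And>s. weight I ar S' (map \<alpha> s) = weight I ar S s"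
proof -
  obtain p where p: "bij p" and S: "\<And>i xs. (i, xs) \<in> atoms I ar \<Longrightarrow> S (i, xs) \<longleftrightarrow> S' (i, map p xs)"
    using assms by (auto simp: structure_iso_def)
  have pp: "p (inv_into UNIV p k) = k" for k using p by (simp add: bij_is_surj surj_f_inv_f)
  have pk: "p a = k \<longleftrightarrow> a = inv_into UNIV p k" for a k using p pp by (metis bij_inv_eq_iff)
  have d: "dense_coloured UNIV (<) (dyadic :: rat \<Rightarrow> nat) UNIV"
    by unfold_locales (use ex_dyadic dyadic_dense in \<open>auto simp: countableI_type\<close>)
  \<comment> \<open>Composing the colours with \<open>p\<close> turns a map that permutes colours by
    \<open>p\<close> into one that preserves them.\<close>
  have d': "dense_coloured UNIV (<) (\<lambda>q::rat. p (dyadic q)) UNIV"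
    by unfold_locales (use ex_dyadic dyadic_dense in \<open>auto simp: countableI_type pk\<close>)
  obtain \<alpha> :: "rat \<Rightarrow> rat" where a: "bij \<alpha>" "\<And>x. dyadic (\<alpha> x) = p (dyadic x)" "\<And>x y. \<alpha> x < \<alpha> y \<longleftrightarrow> x < y"
    using dense_coloured_iso[OF d' d] by blast
  have pinj: "p x = p y \<longleftrightarrow> x = y" for x y using p by (metis bij_def injD)
  \<comment> \<open>Applied entrywise, \<alpha> carries the tuple of \<open>s\<close> to its image
    under \<open>p\<close>; equalities are kept as \<open>p\<close> is injective, and relations as
    it is an isomorphism.\<close>
  have "node_bit I ar S' (map \<alpha> s) = node_bit I ar S s" for s
  proof -
    obtain pad i js where c: "from_nat (length s) = (pad :: nat, i :: nat, js :: nat list)" by (metis prod_cases3)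
    show ?thesis
    proof (cases "\<forall>j\<in>set js. j < length s")
      case True
      then have m: "map (\<lambda>j. dyadic (map \<alpha> s ! j)) js = map p (map (\<lambda>j. dyadic (s ! j)) js)"
        by (auto simp: a(2))
      show ?thesis
      proof (cases i)
        case 0
        then show ?thesis using True by (auto simp: node_bit_def c a(2) pinj)
      next
        case (Suc i')
        then show ?thesis using True S[of i' "map (\<lambda>j. dyadic (s ! j)) js"]
          by (auto simp: node_bit_def c m atoms_map simp del: map_map)
      qed
    qed (auto simp: node_bit_def c)
  qed
  then show ?thesis using that[OF a(1,3)] by (simp add: weight_def)
qed

text \<open>Varying the dummy component gives unboundedly many codes of the same formula, so every
  node has an extension whose label decides the formula with the given indices.\<close>

lemma ex_code:
  "\<exists>t :: rat list. \<exists>pad. from_nat (length (s @ t)) = (pad :: nat, i :: nat, js :: nat list) \<and>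
    (\<forall>j\<in>set js. j < length (s @ t))"
proof -
  have "infinite (range (\<lambda>pad :: nat. to_nat (pad, i, js)))"
    by (rule range_inj_infinite) (auto intro!: injI)
  then obtain k where k: "k \<in> range (\<lambda>pad :: nat. to_nat (pad, i, js))"
    "Max (insert (length s) (set js)) < k"
    unfolding infinite_nat_iff_unbounded by blast
  then obtain pad where "from_nat k = (pad :: nat, i, js)" by auto
  moreover have "length s < k" "\<forall>j\<in>set js. j < k" using k(2) by auto
  ultimately show ?thesis
    by (intro exI[of _ "replicate (k - length s) 0"] exI[of _ pad]) auto
qed

text \<open>Back and forth along the tree: the position is a node \<open>s\<close> together with
  \<open>h s\<close>, and each move passes to a child whose last colour is the wanted element. The
  labels keep this consistent: those for equations make the pairs of colours an injective function,
  those for relations make it preserve atomic formulas.\<close>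

lemma structure_iso_of_tree_iso:
  assumes S: "S \<in> topspace (structures I ar)" "S' \<in> topspace (structures I ar)"
    and "bij h" and len: "\<And>s. length (h s) = length s"
    and ext: "\<And>s q. \<exists>q'. h (s @ [q]) = h s @ [q']"
    and nb: "\<And>s. node_bit I ar S' (h s) = node_bit I ar S s"
  shows "(S, S') \<in> structure_iso I ar"
proof -
  define P where "P r \<longleftrightarrow> (\<exists>s. r = set (zip (map dyadic s) (map dyadic (h s))))" for r
  have ext': "\<exists>u'. h (s @ u) = h s @ u'" for s u
  proof (induction u rule: rev_induct)
    case (snoc q u)
    then obtain u' where "h (s @ u) = h s @ u'" by blast
    then show ?case using ext[of "s @ u" q] by auto
  qed auto
  \<comment> \<open>Entries once paired stay paired in all extensions, so a formula about them may
    be read off at a longer node.\<close>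
  have inh: "h s ! j = h (s @ t) ! j" if "j < length s" for s t j
    using ext'[of s t] that by (auto simp: nth_append len)
  have ins: "P (insert (dyadic q, dyadic q') (set (zip (map dyadic s) (map dyadic (h s)))))"
    if "h (s @ [q]) = h s @ [q']" for s q q'
    unfolding P_def using that by (intro exI[of _ "s @ [q]"]) (auto simp: len)
  have "\<exists>p. bij_betw p UNIV UNIV \<and>
    (\<forall>F. finite F \<and> F \<subseteq> UNIV \<longrightarrow> (\<exists>r. P r \<and> (\<lambda>x. (x, p x)) ` F \<subseteq> r))"
  proof (rule back_and_forth)
    have "h [] = []" using len[of "[]"] by simp
    then show "P {}" unfolding P_def by (intro exI[of _ "[]"]) simp
  next
    fix r a b x y assume "P r" and ab: "(a, b) \<in> r" and xy: "(x, y) \<in> r"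
    then obtain s where r: "r = set (zip (map dyadic s) (map dyadic (h s)))" by (auto simp: P_def)
    obtain i where i: "i < length s" "a = dyadic (s ! i)" "b = dyadic (h s ! i)"
      using ab r by (auto simp: set_zip len)
    obtain j where j: "j < length s" "x = dyadic (s ! j)" "y = dyadic (h s ! j)"
      using xy r by (auto simp: set_zip len)
    \<comment> \<open>Prolong \<open>s\<close> to a node labelled by the truth value of the equation
      between entries \<open>i\<close> and \<open>j\<close>.\<close>
    obtain t pad where t: "from_nat (length (s @ t)) = (pad :: nat, 0 :: nat, [i, j])"
      using ex_code[of s 0 "[i, j]"] by blast
    have "node_bit I ar S (s @ t) \<longleftrightarrow> a = x"
      using t i j by (simp add: node_bit_def nth_append)
    moreover have "node_bit I ar S' (h (s @ t)) \<longleftrightarrow> b = y"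
      using t i j inh[of i s t] inh[of j s t] by (simp add: node_bit_def len)
    ultimately show "a = x \<longleftrightarrow> b = y" using nb by simp
  next
    fix r and a :: nat assume "P r"
    then obtain s where r: "r = set (zip (map dyadic s) (map dyadic (h s)))" by (auto simp: P_def)
    obtain q where "dyadic q = a" using ex_dyadic by blast
    moreover obtain q' where "h (s @ [q]) = h s @ [q']" using ext by blast
    ultimately show "\<exists>b\<in>UNIV. P (insert (a, b) r)" using ins r by auto
  next
    fix r and b :: nat assume "P r"
    then obtain s where r: "r = set (zip (map dyadic s) (map dyadic (h s)))" by (auto simp: P_def)
    obtain q' where q': "dyadic q' = b" using ex_dyadic by blast
    \<comment> \<open>A preimage of the wanted child of \<open>h s\<close> is a child of
      \<open>s\<close>, because its parent is sent to \<open>h s\<close> and \<open>h\<close> is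
      injective.\<close>
    obtain t where t: "h t = h s @ [q']" using \<open>bij h\<close> by (metis bij_pointE)
    then have "t \<noteq> []" using len[of t] by auto
    then obtain u q where u: "t = u @ [q]" by (metis rev_exhaust)
    then have "h u = h s" using ext[of u q] t by auto
    then have "u = s" using \<open>bij h\<close> by (metis bij_def injD)
    then show "\<exists>a\<in>UNIV. P (insert (a, b) r)" using ins[of s q q'] t u r q' by auto
  qed auto
  then obtain p where p: "bij p" and F: "\<forall>F. finite F \<longrightarrow> (\<exists>r. P r \<and> (\<lambda>x. (x, p x)) ` F \<subseteq> r)"
    by auto
  have "S (i, xs) \<longleftrightarrow> S' (i, map p xs)" if "(i, xs) \<in> atoms I ar" for i xs
  proof -
    have "\<exists>r. P r \<and> (\<lambda>x. (x, p x)) ` set xs \<subseteq> r" using F[rule_format, of "set xs"] by simp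
    then obtain r where "P r" and sub: "(\<lambda>x. (x, p x)) ` set xs \<subseteq> r" by blast
    then obtain s where r: "r = set (zip (map dyadic s) (map dyadic (h s)))" by (auto simp: P_def)
    have "\<exists>j<length s. x = dyadic (s ! j) \<and> p x = dyadic (h s ! j)" if "x \<in> set xs" for x
    proof -
      have "(x, p x) \<in> r" using sub that by auto
      then show ?thesis using r by (auto simp: set_zip len)
    qed
    then obtain f where f: "\<And>x. x \<in> set xs \<Longrightarrow> f x < length s \<and> x = dyadic (s ! f x) \<and> p x = dyadic (h s ! f x)"
      by metis
    obtain t pad where t: "from_nat (length (s @ t)) = (pad :: nat, Suc i, map f xs)"
      using ex_code[of s "Suc i" "map f xs"] by blast
    have ft: "f x < length (s @ t)" if "x \<in> set xs" for x using f[OF that] by simp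
    have "map (\<lambda>j. dyadic ((s @ t) ! j)) (map f xs) = xs"
      using f by (auto simp: nth_append intro!: map_idI)
    then have "node_bit I ar S (s @ t) \<longleftrightarrow> S (i, xs)"
      using t ft that by (auto simp: node_bit_def atoms_map simp del: map_map length_append)
    moreover have "map (\<lambda>j. dyadic (h (s @ t) ! j)) (map f xs) = map p xs"
      using f inh[of _ s t] by auto
    then have "node_bit I ar S' (h (s @ t)) \<longleftrightarrow> S' (i, map p xs)"
      using t ft that by (auto simp: node_bit_def atoms_map len simp del: map_map length_append)
    ultimately show ?thesis using nb by simp
  qed
  then show ?thesis using S p by (auto simp: structure_iso_def)
qed

section \<open>Recovering the labelled tree from the order of the fixed points\<close>

definition points_between :: "point set \<Rightarrow> point \<Rightarrow> point \<Rightarrow> point set" where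
  "points_between F x y = {z\<in>F. pless x z \<and> pless z y \<or> pless y z \<and> pless z x}"

text \<open>Blocks are the classes of fixed points at finite distance: a block is finite, and
  between two nodes there are infinitely many further nodes, each of which has the fixed point with
  index 0.\<close>

lemma finite_between_fixed:
  assumes "x \<in> fixed I ar S" "y \<in> fixed I ar S"
  shows "finite (points_between (fixed I ar S) x y) \<longleftrightarrow> fst x = fst y"
proof
  assume "fst x = fst y"
  then have "points_between (fixed I ar S) x y \<subseteq> {fst x} \<times> {..weight I ar S (fst x)} \<times> {0}"
    by (auto simp: points_between_def pless_def fixed_iff)
  then show "finite (points_between (fixed I ar S) x y)" by (rule finite_subset) auto
next
  have inf: "infinite (points_between (fixed I ar S) x y)" if less: "fst x < fst y" for x y
  proof -
    obtain b where b: "\<And>q. q < b \<Longrightarrow> fst x @ [q] < fst y"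
      using between_append_singleton[OF less] by blast
    have "(\<lambda>q. (fst x @ [q], 0, 0)) ` {..<b} \<subseteq> points_between (fixed I ar S) x y"
      using b by (cases x; cases y) (auto simp: points_between_def fixed_iff pless_def less_append_singleton)
    moreover have "infinite ((\<lambda>q. (fst x @ [q], 0 :: nat, 0 :: rat)) ` {..<b})"
      by (subst finite_image_iff) (auto simp: inj_on_def infinite_Iio)
    ultimately show ?thesis using finite_subset by blast
  qed
  have "points_between F x y = points_between F y x" for F by (auto simp: points_between_def)
  then show "fst x = fst y" if "finite (points_between (fixed I ar S) x y)"
    using inf[of x y] inf[of y x] that by (metis linorder_neqE)
qed

text \<open>Finite distance is preserved, so \<open>g\<close> maps blocks onto blocks and induces a
  map \<open>h\<close> of nodes. The sizes of the blocks give depth and label, and the order then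
  gives the parents.\<close>

lemma structure_iso_of_fixed_iso:
  assumes S: "S \<in> topspace (structures I ar)" "S' \<in> topspace (structures I ar)"
    and g: "bij_betw g (fixed I ar S) (fixed I ar S')"
    and mono: "\<And>x y. x \<in> fixed I ar S \<Longrightarrow> y \<in> fixed I ar S \<Longrightarrow> pless (g x) (g y) \<longleftrightarrow> pless x y"
  shows "(S, S') \<in> structure_iso I ar"
proof -
  let ?F = "fixed I ar S" and ?F' = "fixed I ar S'"
  have gF: "g x \<in> ?F'" if "x \<in> ?F" for x using g that by (auto simp: bij_betw_def)
  have surj: "\<exists>x\<in>?F. g x = y" if "y \<in> ?F'" for y
  proof -
    have "y \<in> g ` ?F" using g that by (simp add: bij_betw_def)
    then show ?thesis by blast
  qed
  have ginj: "inj_on g ?F" using g by (simp add: bij_betw_def)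
  have fst_eq: "fst (g x) = fst (g y) \<longleftrightarrow> fst x = fst y" if "x \<in> ?F" "y \<in> ?F" for x y
  proof -
    have "points_between ?F' (g x) (g y) = g ` points_between ?F x y"
    proof
      show "points_between ?F' (g x) (g y) \<subseteq> g ` points_between ?F x y"
      proof
        fix w assume w: "w \<in> points_between ?F' (g x) (g y)"
        then have "w \<in> ?F'" by (simp add: points_between_def)
        then obtain z where z: "z \<in> ?F" "w = g z" using surj by blast
        then have "z \<in> points_between ?F x y" using w mono that by (auto simp: points_between_def)
        then show "w \<in> g ` points_between ?F x y" using z by blast
      qed
      show "g ` points_between ?F x y \<subseteq> points_between ?F' (g x) (g y)"
      proof (rule image_subsetI)
        fix z assume z: "z \<in> points_between ?F x y"
        then have "z \<in> ?F" by (simp add: points_between_def)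
        then show "g z \<in> points_between ?F' (g x) (g y)"
          using z mono that gF by (simp add: points_between_def)
      qed
    qed
    moreover have "inj_on g (points_between ?F x y)"
      using ginj by (rule inj_on_subset) (auto simp: points_between_def)
    ultimately have "finite (points_between ?F' (g x) (g y)) \<longleftrightarrow> finite (points_between ?F x y)"
      by (simp add: finite_image_iff)
    then show ?thesis using finite_between_fixed that gF by metis
  qed
  define h where "h s = fst (g (s, 0, 0))" for s
  \<comment> \<open>Index 0 never exceeds the weight, so every node is represented, in either
    structure.\<close>
  have base: "(s, 0, 0) \<in> fixed I ar S''" for s S'' by (simp add: fixed_iff)
  have h: "fst (g x) = h (fst x)" if "x \<in> ?F" for x
    unfolding h_def using fst_eq[OF that base] by simp
  have hinj: "h s = h t \<longleftrightarrow> s = t" for s t using fst_eq[OF base base] by (simp add: h_def)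
  have hsurj: "\<exists>s. h s = t" for t
    using surj[OF base, of t] h by (metis fst_conv)
  have "bij h" using hinj hsurj by (metis bijI injI surjI)
  have less: "h s < h t" if "s < t" for s t
  proof -
    have "pless (g (s, 0, 0)) (g (t, 0, 0))" using mono[OF base base] that by (simp add: pless_def)
    then have "h s \<le> h t" by (auto simp: pless_def h_def split: prod.splits)
    then show ?thesis using hinj[of s t] that by auto
  qed
  have less_iff: "h s < h t \<longleftrightarrow> s < t" for s t
    using less[of s t] less[of t s] by (metis less_imp_not_less linorder_neqE)
  have card: "card {x\<in>fixed I ar T. fst x = s} = Suc (weight I ar T s)" for T s
  proof -
    have "{x\<in>fixed I ar T. fst x = s} = (\<lambda>n. (s, n, 0)) ` {..weight I ar T s}"
      by (auto simp: fixed_iff)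
    then show ?thesis by (simp add: card_image inj_on_def)
  qed
  have weight: "weight I ar S' (h s) = weight I ar S s" for s
  proof -
    have "{x\<in>?F'. fst x = h s} = g ` {x\<in>?F. fst x = s}"
    proof
      show "{x\<in>?F'. fst x = h s} \<subseteq> g ` {x\<in>?F. fst x = s}"
      proof
        fix y assume y: "y \<in> {x\<in>?F'. fst x = h s}"
        then obtain x where x: "x \<in> ?F" "g x = y" using surj[of y] by blast
        then have "h (fst x) = h s" using h[OF x(1)] y by simp
        then show "y \<in> g ` {x\<in>?F. fst x = s}" using hinj x by auto
      qed
      show "g ` {x\<in>?F. fst x = s} \<subseteq> {x\<in>?F'. fst x = h s}" using gF h by auto
    qed
    moreover have "inj_on g {x\<in>?F. fst x = s}" using ginj by (rule inj_on_subset) auto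
    ultimately show ?thesis using card[of S s] card[of S' "h s"] by (simp add: card_image)
  qed
  have len: "length (h s) = length s" and nb: "node_bit I ar S' (h s) = node_bit I ar S s" for s
    using weight[of s] by (auto simp: weight_def of_bool_def split: if_splits; presburger)+
  have ext: "\<exists>q'. h (s @ [q]) = h s @ [q']" for s q
  proof -
    let ?t = "s @ [q]"
    \<comment> \<open>\<open>w\<close> is the node sent to the parent of \<open>h ?t\<close>. It
      lies before \<open>?t\<close> at the depth of \<open>s\<close>, so \<open>w \<le> s\<close>;
      and \<open>h s\<close> lies before \<open>h ?t\<close> at the depth of \<open>h w\<close>, so
      \<open>s \<le> w\<close>.\<close>
    obtain w where w: "h w = butlast (h ?t)" using hsurj by blast
    have lw: "length w = length s" using len[of w] w len[of ?t] by simp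
    have "h w < h ?t" using less_iff_le_butlast[of "h ?t" "h w"] lw w by (simp add: len)
    then have "w < ?t" by (simp add: less_iff)
    then have "w \<le> s" using less_iff_le_butlast[of ?t w] lw by simp
    moreover have "h s < h ?t" by (simp add: less_iff less_append_singleton)
    then have "h s \<le> h w" using less_iff_le_butlast[of "h ?t" "h s"] w by (simp add: len)
    then have "s \<le> w" using less[of w s] by force
    ultimately have "w = s" by simp
    then have "h s = butlast (h ?t)" using w by simp
    moreover have "h ?t \<noteq> []" using len[of ?t] by auto
    ultimately show ?thesis by (metis append_butlast_last_id)
  qed
  show ?thesis by (rule structure_iso_of_tree_iso[OF S \<open>bij h\<close> len ext nb])
qed


section \<open>The rational order and the local order\<close>

lemma automorphisms_UNIV:
  "verts G = UNIV \<Longrightarrow> f \<in> automorphisms G \<longleftrightarrow> bij f \<and> (\<forall>x y. (f x, f y) \<in> edges G \<longleftrightarrow> (x, y) \<in> edges G)"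
  by (auto simp: automorphisms_def Bij_def)

definition pmap :: "(rat \<Rightarrow> rat) \<Rightarrow> point \<Rightarrow> point" where
  "pmap \<alpha> = (\<lambda>(s, n, q). (map \<alpha> s, n, q))"

abbreviation height :: "point \<Rightarrow> rat" where
  "height x \<equiv> snd (snd x)"

lemma bij_pmap: "bij \<alpha> \<Longrightarrow> bij (pmap \<alpha>)"
proof -
  assume "bij \<alpha>"
  then have "bij (map \<alpha>)"
    by (metis bij_def inj_mapI lists_UNIV lists_image surj_def image_iff UNIV_I)
  moreover have "pmap \<alpha> = map_prod (map \<alpha>) id" by (auto simp: pmap_def)
  ultimately show ?thesis by (metis UNIV_Times_UNIV bij_betw_map_prod bij_id)
qed

lemma height_pmap [simp]: "height (pmap \<alpha> x) = height x"
  by (simp add: pmap_def split: prod.splits)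

lemma pless_pmap:
  assumes "\<And>x y. \<alpha> x < \<alpha> y \<longleftrightarrow> x < y"
  shows "pless (pmap \<alpha> x) (pmap \<alpha> y) \<longleftrightarrow> pless x y"
proof -
  have eq: "\<alpha> x = \<alpha> y \<longleftrightarrow> x = y" for x y using assms by (metis less_irrefl linorder_neqE)
  have "map \<alpha> s < map \<alpha> t \<longleftrightarrow> s < t" for s t
  proof (induction s arbitrary: t)
    case Nil
    then show ?case by (cases t) auto
  next
    case (Cons a s)
    then show ?case by (cases t) (auto simp: assms eq)
  qed
  moreover have "map \<alpha> s = map \<alpha> t \<longleftrightarrow> s = t" for s t
    using eq by (auto simp: inj_on_def dest: map_injective)
  ultimately show ?thesis by (auto simp: pless_def pmap_def split: prod.splits)
qed

lemma pmap_phi: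
  assumes "\<And>s. weight I ar S' (map \<alpha> s) = weight I ar S s"
  shows "pmap \<alpha> (phi I ar S x) = phi I ar S' (pmap \<alpha> x)"
  using assms by (auto simp: pmap_def phi_def split: prod.splits)

lemma bij_phi: "bij (phi I ar S)"
proof (rule o_bij)
  let ?\<psi> = "\<lambda>(s, n, q). (s, n, if n \<le> weight I ar S s then q / 3 else q - 1)"
  show "?\<psi> \<circ> phi I ar S = id" "phi I ar S \<circ> ?\<psi> = id"
    by (auto simp: phi_def fun_eq_iff)
qed

lemma pless_phi: "pless (phi I ar S x) (phi I ar S y) \<longleftrightarrow> pless x y"
  by (auto simp: pless_def phi_def split: prod.splits)

lemma dyadic_height_phi [simp]: "dyadic (height (phi I ar S x)) = dyadic (height x)"
  by (auto simp: phi_def split: prod.splits)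

text \<open>Every colour is already dense and unbounded in a single copy of the rationals. Between
  points of different copies, one moves up inside the lower copy.\<close>

lemma dense_coloured_points: "dense_coloured UNIV pless (\<lambda>x. dyadic (height x)) UNIV"
proof
  fix k :: nat and x :: point
  obtain s n q where x: "x = (s, n, q)" by (metis prod_cases3)
  obtain q' where q': "q < q'" "dyadic q' = k" using ex_dyadic by blast
  then show "\<exists>y\<in>UNIV. pless x y \<and> dyadic (height y) = k"
    by (intro bexI[of _ "(s, n, q')"]) (auto simp: x pless_def)
  obtain q'' where q'': "q'' < q" "dyadic q'' = k" using ex_dyadic by blast
  then show "\<exists>y\<in>UNIV. pless y x \<and> dyadic (height y) = k"
    by (intro bexI[of _ "(s, n, q'')"]) (auto simp: x pless_def)
  fix y assume less: "pless x y"
  obtain t m r where y: "y = (t, m, r)" by (metis prod_cases3)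
  show "\<exists>z\<in>UNIV. pless x z \<and> pless z y \<and> dyadic (height z) = k"
  proof (cases "s = t \<and> n = m")
    case True
    then have "q < r" using less by (auto simp: x y pless_def)
    then obtain q''' where "q < q'''" "q''' < r" "dyadic q''' = k" using dyadic_dense by blast
    then show ?thesis using True by (intro bexI[of _ "(s, n, q''')"]) (auto simp: x y pless_def)
  next
    case False
    then show ?thesis using q' less by (intro bexI[of _ "(s, n, q')"]) (auto simp: x y pless_def)
  qed
qed (auto simp: pless_def countableI_type split: prod.splits)

lemma dense_coloured_rat: "dense_coloured UNIV (<) dyadic UNIV"
  by unfold_locales (use ex_dyadic dyadic_dense in \<open>auto simp: countableI_type\<close>)

text \<open>Merging colours is how one coloured order yields both the uncoloured rationals and the
  two-coloured local order.\<close>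

lemma dense_coloured_coarsen:
  assumes "dense_coloured A lt c C"
  shows "dense_coloured A lt (\<lambda>x. f (c x)) (f ` C)"
proof -
  interpret dense_coloured A lt c C by fact
  show ?thesis
  proof
    show "countable A" "A \<noteq> {}" by (rule countable, rule nonempty)
    show "\<not> lt x x" for x by (rule irrefl)
    show "lt x z" if "lt x y" "lt y z" "x \<in> A" "y \<in> A" "z \<in> A" for x y z using that by (rule trans)
    show "x = y \<or> lt x y \<or> lt y x" if "x \<in> A" "y \<in> A" for x y using that by (rule total)
    show "f (c x) \<in> f ` C" if "x \<in> A" for x using colour[OF that] by (rule imageI)
    fix k x assume "k \<in> f ` C" and x: "x \<in> A"
    then obtain l where l: "l \<in> C" "k = f l" by blast
    show "\<exists>y\<in>A. lt x y \<and> f (c y) = k" using above[OF l(1) x] l(2) by auto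
    show "\<exists>y\<in>A. lt y x \<and> f (c y) = k" using below[OF l(1) x] l(2) by auto
    show "\<exists>z\<in>A. lt x z \<and> lt z y \<and> f (c z) = k" if "y \<in> A" "lt x y" for y
      using mid[OF l(1) x that] l(2) by auto
  qed
qed

text \<open>The common part of the three codings. \<open>lift\<close> turns an order automorphism of
  the labels into a conjugator, and \<open>recover\<close> extracts from a conjugator an order
  isomorphism of the fixed points of \<open>phi\<close>, from which the structure can be
  rebuilt.\<close>

lemma conjugacy_borel_complete_model:
  fixes f :: "nat set \<Rightarrow> (nat \<Rightarrow> nat) \<Rightarrow> (nat \<times> nat list \<Rightarrow> bool) \<Rightarrow> 'a \<Rightarrow> 'a"
  assumes aut: "\<And>I ar S. f I ar S \<in> automorphisms G"
    and cont: "\<And>I ar v w. v \<in> verts G \<Longrightarrow>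
      openin (structures I ar) {S \<in> topspace (structures I ar). f I ar S v = w}"
    and lift: "\<And>I ar S S' \<alpha>. bij \<alpha> \<Longrightarrow> (\<And>x y. \<alpha> x < \<alpha> y \<longleftrightarrow> x < y) \<Longrightarrow>
      (\<And>s. weight I ar S' (map \<alpha> s) = weight I ar S s) \<Longrightarrow>
      \<exists>\<delta>\<in>automorphisms G. \<forall>v\<in>verts G. \<delta> (f I ar S v) = f I ar S' (\<delta> v)"
    and recover: "\<And>I ar S S' \<delta>. \<delta> \<in> automorphisms G \<Longrightarrow>
      (\<And>v. v \<in> verts G \<Longrightarrow> \<delta> (f I ar S v) = f I ar S' (\<delta> v)) \<Longrightarrow>
      \<exists>g. bij_betw g (fixed I ar S) (fixed I ar S') \<and>
        (\<forall>x\<in>fixed I ar S. \<forall>y\<in>fixed I ar S. pless (g x) (g y) \<longleftrightarrow> pless x y)"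
  shows "conjugacy_borel_complete G"
  unfolding conjugacy_borel_complete_def
proof (rule borel_completeI)
  fix I ar
  show "continuous_map (structures I ar) (aut_topology G) (f I ar)"
    by (rule continuous_map_aut_topologyI) (use aut cont in auto)
  fix S S' assume S: "S \<in> topspace (structures I ar)" "S' \<in> topspace (structures I ar)"
  show "(S, S') \<in> structure_iso I ar \<longleftrightarrow> (f I ar S, f I ar S') \<in> conjugacy (aut_group G)"
  proof
    assume "(S, S') \<in> structure_iso I ar"
    then show "(f I ar S, f I ar S') \<in> conjugacy (aut_group G)"
    proof (rule structure_iso_lift)
      fix \<alpha> assume "bij \<alpha>" "\<And>x y. \<alpha> x < \<alpha> y \<longleftrightarrow> x < y" "\<And>s. weight I ar S' (map \<alpha> s) = weight I ar S s"
      from lift[OF this] show ?thesis using aut by (simp add: conjugacy_aut_iff)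
    qed
  next
    assume "(f I ar S, f I ar S') \<in> conjugacy (aut_group G)"
    then obtain \<delta> where \<delta>: "\<delta> \<in> automorphisms G" "\<And>v. v \<in> verts G \<Longrightarrow> \<delta> (f I ar S v) = f I ar S' (\<delta> v)"
      unfolding conjugacy_aut_iff by blast
    from recover[OF this] obtain g where "bij_betw g (fixed I ar S) (fixed I ar S')"
      "\<forall>x\<in>fixed I ar S. \<forall>y\<in>fixed I ar S. pless (g x) (g y) \<longleftrightarrow> pless x y"
      by blast
    then show "(S, S') \<in> structure_iso I ar" using structure_iso_of_fixed_iso[OF S] by blast
  qed
qed

lemma bij_betw_fixed_points:
  assumes "bij \<delta>" "\<And>v. \<delta> (f v) = g (\<delta> v)"
  shows "bij_betw \<delta> {v. f v = v} {v. g v = v}"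
proof -
  have inj: "inj \<delta>" using assms(1) by (rule bij_is_inj)
  have "\<delta> ` {v. f v = v} = {v. g v = v}"
  proof (intro equalityI subsetI)
    fix w assume "w \<in> \<delta> ` {v. f v = v}"
    then show "w \<in> {v. g v = v}" by (auto simp flip: assms(2))
  next
    fix w assume w: "w \<in> {v. g v = v}"
    obtain u where u: "w = \<delta> u" using bij_is_surj[OF assms(1)] by (rule surjE)
    then have "\<delta> (f u) = \<delta> u" using w assms(2) by simp
    then show "w \<in> \<delta> ` {v. f v = v}" using u inj by (auto dest: injD)
  qed
  then show ?thesis unfolding bij_betw_def using inj_on_subset[OF inj] by blast
qed

lemma bij_betw_inj_image:
  assumes "inj C" "bij_betw \<delta> (C ` A) (C ` B)"
  obtains g where "bij_betw g A B" "\<And>y. y \<in> A \<Longrightarrow> \<delta> (C y) = C (g y)"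
proof -
  let ?g = "inv_into B C \<circ> (\<delta> \<circ> C)"
  have inj: "inj_on C X" for X using assms(1) by (rule inj_on_subset) simp
  have "bij_betw ?g A B"
    by (intro bij_betw_trans[OF bij_betw_trans[OF _ assms(2)]] bij_betw_inv_into inj_on_imp_bij_betw inj)
  moreover have "\<delta> (C y) = C (?g y)" if "y \<in> A" for y
  proof -
    have "\<delta> (C y) \<in> C ` B" using assms(2) that by (auto simp: bij_betw_def)
    then show ?thesis by (simp add: f_inv_into_f)
  qed
  ultimately show ?thesis by (rule that)
qed

definition point_order :: "point digraph" where
  "point_order = \<lparr>verts = UNIV, edges = {(x, y). pless x y}\<rparr>"

lemma edge_point_order [simp]: "(x, y) \<in> edges point_order \<longleftrightarrow> pless x y"
  by (simp add: point_order_def)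

text \<open>A conjugator carries fixed points onto fixed points and is an order automorphism, so it
  restricts to the required isomorphism.\<close>

lemma point_order_borel_complete: "conjugacy_borel_complete point_order"
proof (rule conjugacy_borel_complete_model[of phi])
  have UNIV: "verts point_order = UNIV" by (simp add: point_order_def)
  fix I ar S
  show "phi I ar S \<in> automorphisms point_order"
    by (simp add: automorphisms_UNIV UNIV bij_phi pless_phi)
  show "openin (structures I ar) {S \<in> topspace (structures I ar). phi I ar S v = w}" for v w
    by (rule openin_phi)
  fix S'
  show "\<exists>\<delta>\<in>automorphisms point_order. \<forall>v\<in>verts point_order. \<delta> (phi I ar S v) = phi I ar S' (\<delta> v)"
    if "bij \<alpha>" "\<And>x y. \<alpha> x < \<alpha> y \<longleftrightarrow> x < y" "\<And>s. weight I ar S' (map \<alpha> s) = weight I ar S s" for \<alpha>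
    using that pmap_phi[OF that(3)]
    by (intro bexI[of _ "pmap \<alpha>"])
      (simp_all add: automorphisms_UNIV UNIV bij_pmap pless_pmap)
  show "\<exists>g. bij_betw g (fixed I ar S) (fixed I ar S') \<and>
        (\<forall>x\<in>fixed I ar S. \<forall>y\<in>fixed I ar S. pless (g x) (g y) \<longleftrightarrow> pless x y)"
    if "\<delta> \<in> automorphisms point_order"
      "\<And>v. v \<in> verts point_order \<Longrightarrow> \<delta> (phi I ar S v) = phi I ar S' (\<delta> v)" for \<delta>
  proof (intro exI[of _ \<delta>] conjI ballI)
    have \<delta>: "bij \<delta>" "\<And>x y. pless (\<delta> x) (\<delta> y) \<longleftrightarrow> pless x y"
      using that(1) automorphisms_UNIV[OF UNIV, of \<delta>] by (simp_all del: split_paired_All)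
    then show "bij_betw \<delta> (fixed I ar S) (fixed I ar S')"
      unfolding fixed_def using that(2) by (intro bij_betw_fixed_points) (auto simp: UNIV)
    show "pless (\<delta> x) (\<delta> y) \<longleftrightarrow> pless x y" for x y by (rule \<delta>)
  qed
qed

text \<open>All points get the same colour, and Cantor's theorem identifies
  \<open>point_order\<close> with the rationals.\<close>

lemma rat_order_borel_complete: "conjugacy_borel_complete rat_order"
proof -
  have points: "dense_coloured UNIV pless (\<lambda>_. True) {True}"
    using dense_coloured_coarsen[OF dense_coloured_points, of "\<lambda>_. True"] by simp
  have rats: "dense_coloured UNIV (<) (\<lambda>_::rat. True) {True}"
    using dense_coloured_coarsen[OF dense_coloured_rat, of "\<lambda>_. True"] by simp
  have "\<exists>h :: point \<Rightarrow> rat. bij h \<and> (\<forall>x y. h x < h y \<longleftrightarrow> pless x y)"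
    using dense_coloured_iso[OF points rats] by simp
  then obtain h :: "point \<Rightarrow> rat" where "bij h" "\<And>x y. h x < h y \<longleftrightarrow> pless x y"
    by blast
  then have "digraph_iso h point_order rat_order"
    by (auto simp: digraph_iso_def point_order_def rat_order_def)
  then show ?thesis using point_order_borel_complete by (rule conjugacy_borel_complete_iso)
qed

lemma rat_order_tournament: "tournament rat_order"
  by (auto simp: rat_order_def tournament_def is_digraph_def irrefl_def antisym_def total_on_def)

text \<open>Cutting the circle of \<open>S(2)\<close> at one of its points \<open>None\<close> and reflecting one of the two halves
  at the origin turns \<open>S(2)\<close> into a dense linear order with two dense colour classes, the halves.\<close>

fun cut_edge :: "('a \<Rightarrow> 'a \<Rightarrow> bool) \<Rightarrow> ('a \<Rightarrow> bool) \<Rightarrow> 'a option \<Rightarrow> 'a option \<Rightarrow> bool" where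
  "cut_edge lt c None None = False"
| "cut_edge lt c None (Some y) = c y"
| "cut_edge lt c (Some x) None = (\<not> c x)"
| "cut_edge lt c (Some x) (Some y) = (lt x y = (c x = c y))"

text \<open>Colour 0 against all other colours. The fixed points of \<open>phi\<close> have height 0
  and hence colour 0, so they lie in one half, where the tournament agrees with the linear
  order.\<close>

abbreviation positive :: "point \<Rightarrow> bool" where
  "positive x \<equiv> dyadic (height x) = 0"

definition point_circle :: "point option digraph" where
  "point_circle = \<lparr>verts = UNIV, edges = {(x, y). cut_edge pless positive x y}\<rparr>"

lemma fixed_positive: "x \<in> fixed I ar S \<Longrightarrow> positive x"
  by (cases x) (auto simp: fixed_iff)

lemma bij_map_option: "bij f \<Longrightarrow> bij (map_option f)"
  by (rule o_bij[of "map_option (inv_into UNIV f)"])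
    (auto simp: fun_eq_iff option.map_comp o_def bij_is_inj bij_is_surj surj_f_inv_f option.map_ident)

lemma cut_edge_map:
  assumes "\<And>x y. pless (f x) (f y) \<longleftrightarrow> pless x y" "\<And>x. positive (f x) \<longleftrightarrow> positive x"
  shows "cut_edge pless positive (map_option f x) (map_option f y) \<longleftrightarrow> cut_edge pless positive x y"
  using assms by (cases x; cases y) auto

lemma edge_point_circle [simp]: "(x, y) \<in> edges point_circle \<longleftrightarrow> cut_edge pless positive x y"
  by (simp add: point_circle_def)

text \<open>A conjugator may a priori move the cut point \<open>None\<close>, so the cut point has
  to be recognised from the fixed points alone.\<close>

lemma point_circle_borel_complete: "conjugacy_borel_complete point_circle"
proof (rule conjugacy_borel_complete_model[of "\<lambda>I ar S. map_option (phi I ar S)"])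
  have UNIV: "verts point_circle = UNIV" by (simp add: point_circle_def)
  have aut: "map_option f \<in> automorphisms point_circle"
    if "bij f" "\<And>x y. pless (f x) (f y) \<longleftrightarrow> pless x y" "\<And>x. positive (f x) \<longleftrightarrow> positive x" for f
    using cut_edge_map[of f] that by (simp add: automorphisms_UNIV UNIV bij_map_option)
  fix I ar S
  show "map_option (phi I ar S) \<in> automorphisms point_circle"
    by (rule aut) (simp_all add: bij_phi pless_phi)
  show "openin (structures I ar) {S \<in> topspace (structures I ar). map_option (phi I ar S) v = w}" for v w
    by (cases v; cases w) (use openin_phi[where P = "\<lambda>x. Some x = w"] in simp_all)
  fix S'
  show "\<exists>\<delta>\<in>automorphisms point_circle. \<forall>v\<in>verts point_circle.
      \<delta> (map_option (phi I ar S) v) = map_option (phi I ar S') (\<delta> v)"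
    if "bij \<alpha>" "\<And>x y. \<alpha> x < \<alpha> y \<longleftrightarrow> x < y" "\<And>s. weight I ar S' (map \<alpha> s) = weight I ar S s" for \<alpha>
  proof (intro bexI ballI)
    show "map_option (pmap \<alpha>) \<in> automorphisms point_circle"
      by (rule aut) (use that in \<open>simp_all add: bij_pmap pless_pmap\<close>)
    show "map_option (pmap \<alpha>) (map_option (phi I ar S) v) =
        map_option (phi I ar S') (map_option (pmap \<alpha>) v)" for v
      using pmap_phi[OF that(3)] by (cases v) auto
  qed
  show "\<exists>g. bij_betw g (fixed I ar S) (fixed I ar S') \<and>
        (\<forall>x\<in>fixed I ar S. \<forall>y\<in>fixed I ar S. pless (g x) (g y) \<longleftrightarrow> pless x y)"
    if "\<delta> \<in> automorphisms point_circle"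
      "\<And>v. v \<in> verts point_circle \<Longrightarrow> \<delta> (map_option (phi I ar S) v) = map_option (phi I ar S') (\<delta> v)" for \<delta>
  proof -
    have \<delta>: "bij \<delta>" "\<And>x y. cut_edge pless positive (\<delta> x) (\<delta> y) \<longleftrightarrow> cut_edge pless positive x y"
      using that(1) automorphisms_UNIV[OF UNIV, of \<delta>] by (simp_all del: split_paired_All)
    have fixpoints: "{v. map_option (phi I ar T) v = v} = insert None (Some ` fixed I ar T)" for T
    proof -
      have "map_option (phi I ar T) v = v \<longleftrightarrow> v \<in> insert None (Some ` fixed I ar T)" for v
        by (cases v) (auto simp: fixed_def)
      then show ?thesis by blast
    qed
    have bij: "bij_betw \<delta> (insert None (Some ` fixed I ar S)) (insert None (Some ` fixed I ar S'))"
      using bij_betw_fixed_points[OF \<delta>(1), of "map_option (phi I ar S)" "map_option (phi I ar S')"] that(2)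
      by (simp add: fixpoints UNIV)
    txt \<open>\<^term>\<open>None\<close> is the only source in the digraph of fixed points.\<close>
    have "\<delta> None = None"
    proof (rule ccontr)
      assume "\<delta> None \<noteq> None"
      moreover have "\<delta> None \<in> insert None (Some ` fixed I ar S')" using bij by (auto simp: bij_betw_def)
      ultimately obtain z where z: "\<delta> None = Some z" "z \<in> fixed I ar S'" by auto
      have "None \<in> \<delta> ` insert None (Some ` fixed I ar S)"
        using bij by (simp only: bij_betw_def insertI1)
      then obtain w where w: "w \<in> insert None (Some ` fixed I ar S)" "\<delta> w = None" by force
      then obtain y where y: "w = Some y" "y \<in> fixed I ar S" using z by auto
      \<comment> \<open>The edge from \<open>None\<close> to \<open>w\<close> is sent to an edge
        from \<open>Some z\<close> to \<open>None\<close>, which needs \<open>z\<close> to be of the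
        other colour.\<close>
      have "cut_edge pless positive (\<delta> None) (\<delta> w)"
        using fixed_positive[OF y(2)] by (simp add: \<delta> y)
      then show False using z w fixed_positive[OF z(2)] by simp
    qed
    then have "bij_betw \<delta> {None} {None}" by simp
    from bij_betw_DiffI[OF bij this]
    have "bij_betw \<delta> (Some ` fixed I ar S) (Some ` fixed I ar S')" by (simp add: image_iff)
    then obtain g where "bij_betw g (fixed I ar S) (fixed I ar S')"
      and g: "\<And>y. y \<in> fixed I ar S \<Longrightarrow> \<delta> (Some y) = Some (g y)"
      by (rule bij_betw_inj_image[rotated]) auto
    moreover have "pless (g x) (g y) \<longleftrightarrow> pless x y" if xy: "x \<in> fixed I ar S" "y \<in> fixed I ar S" for x y
    proof -
      have "positive (g x)" "positive (g y)"
        using \<delta>(2)[of None "Some x"] \<delta>(2)[of None "Some y"] fixed_positive xy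
        by (simp_all add: \<open>\<delta> None = None\<close> g)
      then show ?thesis using \<delta>(2)[of "Some x" "Some y"] fixed_positive xy by (simp add: g)
    qed
    ultimately show ?thesis by blast
  qed
qed

lemma local_order_edge:
  assumes "x \<in> D" "y \<in> D"
  shows "(x, y) \<in> edges (local_order D) \<longleftrightarrow> 0 < Im (x / y)"
  using assms by (auto simp: local_order_def Arg_lt_pi)

text \<open>A real quotient would have argument 0 or \<open>pi\<close>, both rational multiples of
  \<open>pi\<close>.\<close>

lemma local_order_Im_neq_0:
  assumes "local_order_points D" "x \<in> D" "y \<in> D" "x \<noteq> y"
  shows "Im (x / y) \<noteq> 0"
proof
  assume "Im (x / y) = 0"
  then have "Arg (x / y) = 0 \<or> Arg (x / y) = pi" by (simp add: Arg_eq_0_pi complex_is_Real_iff)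
  then have "\<exists>q\<in>\<rat>. Arg (x / y) = q * pi" by (metis Rats_0 Rats_1 mult_1 mult_zero_left)
  then show False using assms unfolding local_order_points_def by blast
qed

lemma local_order_cis:
  assumes "local_order_points D" "x \<in> D" "y \<in> D"
  shows "x / y = cis (Arg (x / y))"
proof -
  have "norm x = 1" "norm y = 1" using assms by (auto simp: local_order_points_def)
  then have "norm (x / y) = 1" by (simp add: norm_divide)
  then show ?thesis by (metis complex_norm_eq_1_exp_eq cis_conv_exp)
qed

lemma local_order_tournament:
  assumes "local_order_points D"
  shows "tournament (local_order D)"
proof -
  have irr: "(x, x) \<notin> edges (local_order D)" for x
  proof
    assume "(x, x) \<in> edges (local_order D)"
    then have "x \<in> D" "0 < Im (x / x)" using local_order_edge[of x D x] by (auto simp: local_order_def)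
    then show False by (cases "x = 0") auto
  qed
  have swap: "Im (x / y) = - Im (y / x)" if "x \<in> D" "y \<in> D" for x y
  proof -
    have "y / x = inverse (x / y)" by simp
    also have "\<dots> = cis (- Arg (x / y))" by (subst local_order_cis[OF assms that]) simp
    finally have "Im (y / x) = - sin (Arg (x / y))" by simp
    moreover have "Im (x / y) = sin (Arg (x / y))"
      by (subst local_order_cis[OF assms that]) simp
    ultimately show ?thesis by simp
  qed
  have "antisym (edges (local_order D))"
  proof (rule antisymI)
    fix x y assume e: "(x, y) \<in> edges (local_order D)" "(y, x) \<in> edges (local_order D)"
    then have "x \<in> D" "y \<in> D" by (auto simp: local_order_def)
    then show "x = y" using e swap[of x y] by (simp add: local_order_edge)
  qed
  moreover have "total_on (verts (local_order D)) (edges (local_order D))"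
  proof (rule total_onI)
    fix x y assume "x \<in> verts (local_order D)" "y \<in> verts (local_order D)" and ne: "x \<noteq> y"
    then have "x \<in> D" "y \<in> D" by (auto simp: local_order_def)
    then show "(x, y) \<in> edges (local_order D) \<or> (y, x) \<in> edges (local_order D)"
      using local_order_Im_neq_0[OF assms _ _ ne] swap[of x y] by (auto simp: local_order_edge)
  qed
  ultimately show ?thesis
    using irr by (auto simp: tournament_def is_digraph_def irrefl_def local_order_def)
qed

text \<open>Angles are measured from a point \<open>x0\<close> of \<open>D\<close>, and an edge from
  \<open>y\<close> to \<open>z\<close> means \<open>sin (\<theta> z - \<theta> y) > 0\<close>. The
  half with negative angles is shifted by \<open>pi\<close>, which brings all angles into the
  interval from 0 to \<open>pi\<close>, where the sine of a difference has the sign of the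
  difference; the shift reverses the sign for pairs from different halves, whence
  \<open>cut_edge\<close>.\<close>

lemma local_order_borel_complete:
  assumes D: "local_order_points D"
  shows "conjugacy_borel_complete (local_order D)"
proof -
  have cl: "sphere 0 1 \<subseteq> closure D" and sph: "D \<subseteq> sphere 0 1" and count: "countable D"
    using D by (auto simp: local_order_points_def)
  obtain x0 where x0: "x0 \<in> D"
  proof -
    have "(1::complex) \<in> closure D" using cl by (auto simp: subset_iff)
    then show ?thesis using that closure_empty by (metis all_not_in_conv)
  qed
  then have x0n: "norm x0 = 1" using sph by auto
  define \<theta> where "\<theta> y = Arg (x0 / y)" for y
  define c where "c y \<longleftrightarrow> 0 < \<theta> y" for y
  define t where "t y = (if c y then \<theta> y else \<theta> y + pi)" for y
  define A where "A = D - {x0}"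
  have edge: "(y, z) \<in> edges (local_order D) \<longleftrightarrow> 0 < sin (\<theta> z - \<theta> y)" if "y \<in> D" "z \<in> D" for y z
  proof -
    have "y / z = (x0 / z) / (x0 / y)" using x0n by auto
    also have "\<dots> = cis (\<theta> z - \<theta> y)"
      using local_order_cis[OF D x0 that(1)] local_order_cis[OF D x0 that(2)]
      by (metis \<theta>_def cis_divide)
    finally show ?thesis using that by (simp add: local_order_edge)
  qed
  have \<theta>: "\<theta> y \<noteq> 0" "\<theta> y \<noteq> pi" "- pi < \<theta> y" "\<theta> y \<le> pi" if "y \<in> A" for y
    using local_order_Im_neq_0[OF D x0, of y] that Arg_bounded[of "x0 / y"]
    by (auto simp: A_def \<theta>_def Arg_eq_0_pi complex_is_Real_iff dest: Arg_eq_0[THEN iffD1] Arg_eq_pi[THEN iffD1])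
  have t: "0 < t y" "t y < pi" if "y \<in> A" for y
    using \<theta>[OF that] by (auto simp: t_def c_def)
  have edge_t: "(y, z) \<in> edges (local_order D) \<longleftrightarrow> (t y < t z) = (c y = c z)"
    if "y \<in> A" "z \<in> A" "y \<noteq> z" for y z
  proof -
    have neq: "sin (\<theta> z - \<theta> y) \<noteq> 0"
    proof -
      have "y \<in> D" "z \<in> D" using that by (auto simp: A_def)
      then have "(y, z) \<in> edges (local_order D) \<longleftrightarrow> (z, y) \<notin> edges (local_order D)"
        using local_order_tournament[OF D] that(3)
        unfolding tournament_def is_digraph_def total_on_def antisym_def by (auto simp: local_order_def)
      moreover have "sin (\<theta> y - \<theta> z) = - sin (\<theta> z - \<theta> y)" by (metis minus_diff_eq sin_minus)
      ultimately show ?thesis using edge \<open>y \<in> D\<close> \<open>z \<in> D\<close> by auto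
    qed
    have s: "sin (\<theta> z - \<theta> y) = (if c y = c z then sin (t z - t y) else - sin (t z - t y))"
      by (auto simp: t_def sin_diff sin_add cos_add algebra_simps)
    have "0 < sin (t z - t y)" if "t y < t z"
      using t[OF \<open>y \<in> A\<close>] t[OF \<open>z \<in> A\<close>] that by (intro sin_gt_zero) auto
    moreover have "sin (t z - t y) \<le> 0" if "t z \<le> t y"
    proof -
      have "0 \<le> sin (t y - t z)"
        using t[OF \<open>y \<in> A\<close>] t[OF \<open>z \<in> A\<close>] that by (intro sin_ge_zero) auto
      then show ?thesis by (metis minus_diff_eq neg_0_le_iff_le sin_minus)
    qed
    ultimately have "0 < sin (\<theta> z - \<theta> y) \<longleftrightarrow> (t y < t z) = (c y = c z)"
      using neq s by (cases "t y < t z") (auto split: if_splits)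
    then show ?thesis using edge that by (simp add: A_def)
  qed
  have tinj: "y = z" if "y \<in> A" "z \<in> A" "t y = t z" for y z
  proof (rule ccontr)
    assume ne: "y \<noteq> z"
    have "(y, z) \<in> edges (local_order D) \<longleftrightarrow> (z, y) \<in> edges (local_order D)"
      using edge_t[OF that(1,2) ne] edge_t[OF that(2,1)] ne that(3) by auto
    then show False
      using local_order_tournament[OF D] that(1,2) ne
      unfolding tournament_def is_digraph_def total_on_def antisym_def
      by (auto simp: local_order_def A_def)
  qed
  have ex: "\<exists>y\<in>A. a < t y \<and> t y < b \<and> c y = k" if ab: "0 \<le> a" "a < b" "b \<le> pi" for a b k
  proof -
    \<comment> \<open>The interval that \<theta> has to meet: on the half where \<open>c\<close>
      fails, \<open>t\<close> is \<open>\<theta> + pi\<close>.\<close>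
    define a' where "a' = (if k then a else a - pi)"
    define b' where "b' = (if k then b else b - pi)"
    \<comment> \<open>The midpoint stays away from the branch cut of \<open>Arg\<close>, so \<theta>
      is continuous at the point \<open>z\<close> with angle \<open>m\<close>, and a point of
      \<open>D\<close> near \<open>z\<close> has an angle between \<open>a'\<close> and
      \<open>b'\<close>.\<close>
    define m where "m = (a' + b') / 2"
    have m: "a' < m" "m < b'" using ab by (auto simp: m_def a'_def b'_def)
    then have m': "- pi < m" "m < pi" "m \<noteq> 0" using ab by (auto simp: a'_def b'_def split: if_splits)
    define z where "z = x0 * cis (- m)"
    have zn: "norm z = 1" by (simp add: z_def norm_mult x0n)
    have "x0 = cis m * z" by (simp add: z_def cis_mult mult.left_commute)
    moreover have "z \<noteq> 0" using zn by auto
    ultimately have xz: "x0 / z = cis m" by simp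
    have Argm: "\<theta> z = m" using m' by (simp add: \<theta>_def xz Arg_cis)
    have "x0 / z \<notin> \<real>\<^sub>\<le>\<^sub>0"
    proof
      assume "x0 / z \<in> \<real>\<^sub>\<le>\<^sub>0"
      then have "sin m = 0" by (auto simp: xz complex_nonpos_Reals_iff)
      then show False using m' by (metis sin_eq_0_pi)
    qed
    moreover have "isCont (\<lambda>y. x0 / y) z" using \<open>z \<noteq> 0\<close> by (intro continuous_intros)
    ultimately have "isCont \<theta> z"
      unfolding \<theta>_def by (intro isCont_o2[OF _ continuous_at_Arg])
    then have "(\<theta> \<longlongrightarrow> \<theta> z) (nhds z)" by (simp only: isCont_def tendsto_at_iff_tendsto_nhds)
    then have "\<forall>\<^sub>F y in nhds z. a' < \<theta> y \<and> \<theta> y < b'"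
      using m Argm order_tendstoD[of \<theta> "\<theta> z" "nhds z"] by (simp add: eventually_conj)
    then obtain U where U: "open U" "z \<in> U" "\<And>y. y \<in> U \<Longrightarrow> a' < \<theta> y \<and> \<theta> y < b'"
      unfolding eventually_nhds by blast
    have "z \<in> closure D" using cl zn by (auto simp: subset_iff)
    then have "U \<inter> D \<noteq> {}" using U by (metis IntI disjoint_iff_not_equal open_Int_closure_eq_empty)
    then obtain y where y: "y \<in> D" "y \<in> U" by blast
    then have \<theta>y: "a' < \<theta> y" "\<theta> y < b'" using U by auto
    have "\<theta> x0 = 0" using x0n by (auto simp: \<theta>_def)
    then have "y \<noteq> x0" using \<theta>y ab by (auto simp: a'_def b'_def split: if_splits)
    then have "y \<in> A" using y by (simp add: A_def)
    moreover have "c y = k" using \<theta>y ab by (auto simp: c_def a'_def b'_def split: if_splits)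
    moreover have "a < t y" "t y < b" using \<theta>y \<open>c y = k\<close> by (auto simp: t_def a'_def b'_def)
    ultimately show ?thesis by blast
  qed
  have dense: "dense_coloured A (\<lambda>y z. t y < t z) c (range (\<lambda>k::nat. k = 0))"
  proof
    show "countable A" using count by (auto simp: A_def)
    show "A \<noteq> {}" using ex[of 0 pi] by auto
    show "x = y \<or> t x < t y \<or> t y < t x" if "x \<in> A" "y \<in> A" for x y
      using tinj[OF that] by (metis linorder_neqE_linordered_idom)
    show "c x \<in> range (\<lambda>k::nat. k = 0)" for x by (cases "c x") (auto intro: exI[of _ 0] exI[of _ 1])
    fix k x assume x: "x \<in> A"
    show "\<exists>y\<in>A. t x < t y \<and> c y = k" using ex[of "t x" pi k] t[OF x] by auto
    show "\<exists>y\<in>A. t y < t x \<and> c y = k" using ex[of 0 "t x" k] t[OF x] by auto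
    fix y assume y: "y \<in> A" "t x < t y"
    show "\<exists>z\<in>A. t x < t z \<and> t z < t y \<and> c z = k" using ex[of "t x" "t y" k] t[OF x] t[OF y(1)] y by auto
  qed auto
  obtain h where h: "bij_betw h UNIV A" "\<And>x. c (h x) = positive x"
      "\<And>x y. t (h x) < t (h y) \<longleftrightarrow> pless x y"
    using dense_coloured_iso[OF dense_coloured_coarsen[OF dense_coloured_points, of "\<lambda>k. k = 0"] dense] by auto
  have hA: "h x \<in> A" for x using h(1) by (auto simp: bij_betw_def)
  have hinj: "h x = h y \<longleftrightarrow> x = y" for x y using h(1) by (auto simp: bij_betw_def inj_eq)
  define H where "H = case_option x0 h"
  have "bij_betw H UNIV D"
    unfolding bij_betw_def
  proof
    have "h x \<noteq> x0" for x using hA[of x] by (auto simp: A_def)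
    then have "H u = H v \<Longrightarrow> u = v" for u v
      by (cases u; cases v) (auto simp: H_def hinj)
    then show "inj H" by (auto intro: injI)
    have "range H = insert x0 (range h)" by (auto simp: H_def UNIV_option_conv image_image)
    also have "\<dots> = D" using h(1) x0 by (auto simp: bij_betw_def A_def)
    finally show "range H = D" .
  qed
  moreover have "(H u, H v) \<in> edges (local_order D) \<longleftrightarrow> cut_edge pless positive u v" for u v
  proof -
    have x0x0: "(x0, x0) \<notin> edges (local_order D)" "(h x, h x) \<notin> edges (local_order D)" for x
      using tournament_irrefl[OF local_order_tournament[OF D]] by auto
    have hD: "h x \<in> D" for x using hA by (auto simp: A_def)
    have "\<theta> x0 = 0" using x0n by (auto simp: \<theta>_def)
    have pos: "0 < sin (\<theta> (h x)) \<longleftrightarrow> positive x" and neg: "sin (\<theta> (h x)) < 0 \<longleftrightarrow> \<not> positive x" for x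
    proof -
      show "0 < sin (\<theta> (h x)) \<longleftrightarrow> positive x" "sin (\<theta> (h x)) < 0 \<longleftrightarrow> \<not> positive x"
        using \<theta>[OF hA[of x]] h(2)[of x] sin_gt_zero[of "\<theta> (h x)"] sin_lt_zero[of "\<theta> (h x) + 2 * pi"]
        by (auto simp: c_def)
    qed
    show ?thesis
    proof (cases u)
      case None
      then show ?thesis
        by (cases v) (auto simp: H_def x0x0 edge x0 hD \<open>\<theta> x0 = 0\<close> pos)
    next
      case (Some x)
      show ?thesis
      proof (cases v)
        case None
        then show ?thesis using Some neg[of x] by (auto simp: H_def edge x0 hD \<open>\<theta> x0 = 0\<close>)
      next
        case v: (Some y)
        have "\<not> pless x x" using h(3)[of x x] by simp
        then show ?thesis using Some v edge_t[OF hA hA, of x y] h(2,3) hinj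
          by (cases "x = y") (auto simp: H_def x0x0)
      qed
    qed
  qed
  ultimately have "digraph_iso H point_circle (local_order D)"
    by (simp add: digraph_iso_def point_circle_def) (simp add: local_order_def)
  then show ?thesis using point_circle_borel_complete by (rule conjugacy_borel_complete_iso)
qed


section \<open>The generic tournament\<close>

text \<open>The Fraisse limit over a tournament \<open>lt\<close> on the type of base points, built from finite lists of
  earlier vertices. The construction is functorial; the integer labels, which the relation \<open>varc\<close>
  uses only as the last key of a lexicographic comparison, can be shifted in order to move every new
  vertex.\<close>

datatype 'a vertex = Base 'a | Stub nat int | Link "'a vertex" "'a vertex" int

text \<open>\<open>Stub n i\<close> is an empty list that starts at a level above \<open>n\<close>,
  so a list can be raised above any given finite set of vertices. The level of a list grows with its
  length, not with the levels of its elements.\<close>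

primrec level :: "'a vertex \<Rightarrow> nat" where
  "level (Base y) = 0"
| "level (Stub n i) = Suc n"
| "level (Link a b i) = Suc (level b)"

primrec elems :: "'a vertex \<Rightarrow> 'a vertex set" where
  "elems (Base y) = {}"
| "elems (Stub n i) = {}"
| "elems (Link a b i) = insert a (elems b)"

fun vless :: "('a \<Rightarrow> 'a \<Rightarrow> bool) \<Rightarrow> 'a vertex \<Rightarrow> 'a vertex \<Rightarrow> bool" where
  "vless lt (Base x) (Base y) = lt x y"
| "vless lt (Base x) _ = True"
| "vless lt _ (Base y) = False"
| "vless lt (Stub n i) (Stub m j) = (n < m \<or> n = m \<and> i < j)"
| "vless lt (Stub n i) (Link a b j) = True"
| "vless lt (Link a b j) (Stub n i) = False"
| "vless lt (Link a b i) (Link c d j) = (vless lt a c \<or> a = c \<and> (vless lt b d \<or> b = d \<and> i < j))"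

text \<open>The list of a vertex selects its in-neighbours among the vertices of lower level;
  \<open>vless\<close> only decides between vertices of equal level.\<close>

definition varc :: "('a \<Rightarrow> 'a \<Rightarrow> bool) \<Rightarrow> 'a vertex \<Rightarrow> 'a vertex \<Rightarrow> bool" where
  "varc lt x y \<longleftrightarrow>
     (if level x < level y then x \<in> elems y else if level y < level x then y \<notin> elems x else vless lt x y)"

primrec vmap :: "('a \<Rightarrow> 'a) \<Rightarrow> int \<Rightarrow> 'a vertex \<Rightarrow> 'a vertex" where
  "vmap f k (Base y) = Base (f y)"
| "vmap f k (Stub n i) = Stub n (i + k)"
| "vmap f k (Link a b i) = Link (vmap f k a) (vmap f k b) (i + k)"

lemma vmap_vmap: "vmap f k (vmap g l x) = vmap (f \<circ> g) (k + l) x"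
  by (induction x) auto

lemma vmap_id: "vmap id 0 x = x"
  by (induction x) auto

lemma bij_vmap:
  assumes "bij f" shows "bij (vmap f k)"
proof (rule o_bij)
  have inverse: "inv_into UNIV f \<circ> f = id" "f \<circ> inv_into UNIV f = id"
    using assms by (auto simp: bij_def fun_eq_iff surj_f_inv_f)
  show "vmap (inv_into UNIV f) (- k) \<circ> vmap f k = id" "vmap f k \<circ> vmap (inv_into UNIV f) (- k) = id"
    by (rule ext, simp add: vmap_vmap inverse vmap_id)+
qed

lemma level_vmap [simp]: "level (vmap f k x) = level x"
  by (induction x) auto

lemma elems_vmap: "elems (vmap f k x) = vmap f k ` elems x"
  by (induction x) auto

text \<open>Levels, lists and comparisons are built from \<open>lt\<close> and from comparisons of
  labels, so any automorphism of \<open>lt\<close> together with any uniform shift of the labels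
  carries them along.\<close>

lemma varc_vmap:
  assumes "bij f" "\<And>x y. lt (f x) (f y) \<longleftrightarrow> lt x y"
  shows "varc lt (vmap f k x) (vmap f k y) \<longleftrightarrow> varc lt x y"
proof -
  have inj: "inj (vmap f k)" using bij_vmap[OF assms(1)] by (rule bij_is_inj)
  have eq: "vmap f k x = vmap f k y \<longleftrightarrow> x = y" for x y using inj by (rule inj_eq)
  have "vless lt (vmap f k x) (vmap f k y) \<longleftrightarrow> vless lt x y" for x y
  proof (induction x arbitrary: y)
    case (Link a b i)
    then show ?case by (cases y) (auto simp: eq)
  next
    case (Base x)
    then show ?case by (cases y) (auto simp: assms(2))
  next
    case (Stub n i)
    then show ?case by (cases y) auto
  qed
  then show ?thesis by (simp add: varc_def elems_vmap inj_image_mem_iff[OF inj])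
qed

text \<open>The shift by 1 changes the outermost label of every vertex that is not a base
  point.\<close>

lemma vmap_eq_iff: "vmap f 1 x = x \<longleftrightarrow> x \<in> Base ` {y. f y = y}"
  by (cases x) auto

section \<open>The extension property and uniqueness of the generic tournament\<close>

locale countable_tournament =
  fixes V :: "'a set" and E :: "'a \<Rightarrow> 'a \<Rightarrow> bool"
  assumes countable: "countable V"
    and irrefl: "\<not> E x x"
    and asym: "E x y \<Longrightarrow> \<not> E y x"
    and total: "x \<in> V \<Longrightarrow> y \<in> V \<Longrightarrow> x \<noteq> y \<Longrightarrow> E x y \<or> E y x"

locale generic_countable_tournament = countable_tournament +
  assumes ext: "finite U \<Longrightarrow> finite W \<Longrightarrow> U \<subseteq> V \<Longrightarrow> W \<subseteq> V \<Longrightarrow> U \<inter> W = {} \<Longrightarrow>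
    \<exists>z\<in>V. z \<notin> U \<union> W \<and> (\<forall>u\<in>U. E u z) \<and> (\<forall>w\<in>W. E z w)"

text \<open>The wanted partner of \<open>a\<close> has prescribed in-neighbours \<open>U\<close> and
  out-neighbours \<open>W\<close>, so the extension property supplies it.\<close>

lemma generic_tournament_extends:
  assumes "countable_tournament A E" "generic_countable_tournament B E'"
  shows "extends_into A E (\<lambda>_. True) B E' (\<lambda>_. True)"
  unfolding extends_into_def
proof (intro allI impI, elim conjE)
  interpret A: countable_tournament A E by fact
  interpret B: generic_countable_tournament B E' by fact
  fix r a assume r: "finite r" "r \<subseteq> A \<times> B" "partial_iso E (\<lambda>_. True) E' (\<lambda>_. True) r" "a \<in> A" "a \<notin> fst ` r"
  define U where "U = snd ` {p\<in>r. E (fst p) a}"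
  define W where "W = snd ` {p\<in>r. E a (fst p)}"
  have "U \<inter> W = {}"
  proof (rule ccontr)
    assume "U \<inter> W \<noteq> {}"
    then obtain x x' y where xy: "(x, y) \<in> r" "E x a" "(x', y) \<in> r" "E a x'" by (auto simp: U_def W_def)
    then have "x = x'" using partial_isoD(2)[OF r(3) xy(1,3)] by simp
    then show False using xy A.asym by blast
  qed
  moreover have "finite U" "finite W" "U \<subseteq> B" "W \<subseteq> B" using r by (auto simp: U_def W_def)
  ultimately have "\<exists>z\<in>B. z \<notin> U \<union> W \<and> (\<forall>u\<in>U. E' u z) \<and> (\<forall>w\<in>W. E' z w)"
    by (intro B.ext)
  then obtain z where z: "z \<in> B" "z \<notin> U \<union> W" "\<forall>u\<in>U. E' u z" "\<forall>w\<in>W. E' z w" by auto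
  have cases: "(E x a \<and> E' y z \<and> y \<in> U) \<or> (E a x \<and> E' z y \<and> y \<in> W)" if xy: "(x, y) \<in> r" for x y
  proof -
    have "x \<noteq> a" "x \<in> A" using xy r by force+
    then have "E x a \<or> E a x" using A.total r(4) by blast
    then have "(E x a \<and> y \<in> U) \<or> (E a x \<and> y \<in> W)" using xy by (force simp: U_def W_def)
    then show ?thesis using z(3,4) by blast
  qed
  have "z \<notin> snd ` r" using cases z(2) by force
  moreover have "(E x a \<longleftrightarrow> E' y z) \<and> (E a x \<longleftrightarrow> E' z y)" if "(x, y) \<in> r" for x y
    using cases[OF that] A.asym[of x a] A.asym[of a x] B.asym[of y z] B.asym[of z y] by argo
  ultimately show "\<exists>b\<in>B. b \<notin> snd ` r \<and> True = True \<and>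
      (\<forall>(x, y)\<in>r. (E x a \<longleftrightarrow> E' y b) \<and> (E a x \<longleftrightarrow> E' b y))"
    using z(1) by (intro bexI[of _ z] conjI) auto
qed

lemma generic_countable_tournament_iso:
  assumes "generic_countable_tournament A E" "generic_countable_tournament B E'"
  shows "\<exists>h. bij_betw h A B \<and> (\<forall>x\<in>A. \<forall>y\<in>A. E' (h x) (h y) \<longleftrightarrow> E x y)"
proof -
  interpret A: generic_countable_tournament A E by fact
  interpret B: generic_countable_tournament B E' by fact
  show ?thesis
    using back_and_forth_iso[OF A.countable B.countable A.irrefl B.irrefl
        generic_tournament_extends[OF A.countable_tournament_axioms assms(2)]
        generic_tournament_extends[OF B.countable_tournament_axioms assms(1)]] by simp
qed

instance vertex :: (countable) countable
  by countable_datatype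

lemma generic_varc:
  fixes lt :: "'a :: countable \<Rightarrow> 'a \<Rightarrow> bool"
  assumes "countable_tournament UNIV lt"
  shows "generic_countable_tournament UNIV (varc lt)"
proof -
  interpret lt: countable_tournament UNIV lt by fact
  have vless_irrefl: "\<not> vless lt x x" for x
    by (induction x) (auto simp: lt.irrefl)
  have vless_total: "vless lt x y \<longleftrightarrow> \<not> vless lt y x" if "x \<noteq> y" for x y
    using that
  proof (induction x arbitrary: y)
    case (Link a b i)
    show ?case
    proof (cases y)
      case y: (Link c d j)
      show ?thesis
        using Link.IH(1)[of c] Link.IH(2)[of d] Link.prems y vless_irrefl[of a] vless_irrefl[of b]
        by (cases "a = c"; cases "b = d") auto
    qed simp_all
  next
    case (Base x)
    then show ?case using lt.total lt.asym by (cases y) auto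
  next
    case (Stub n i)
    then show ?case by (cases y) auto
  qed
  have varc_total: "varc lt x y \<longleftrightarrow> \<not> varc lt y x" if "x \<noteq> y" for x y
    using vless_total[OF that] by (auto simp: varc_def)
  have varc_irrefl: "\<not> varc lt x x" for x by (simp add: varc_def vless_irrefl)
  show ?thesis
  proof
    show "countable (UNIV :: 'a vertex set)" by (rule countableI_type)
    show "\<not> varc lt x x" for x by (rule varc_irrefl)
    show "\<not> varc lt y x" if "varc lt x y" for x y
      using that varc_total[of x y] varc_irrefl by (cases "x = y") auto
    show "varc lt x y \<or> varc lt y x" if "x \<noteq> y" for x y using varc_total[OF that] by blast
    fix U W :: "'a vertex set" assume fin: "finite U" "finite W" and disj: "U \<inter> W = {}"
    obtain us where us: "set us = U" using finite_list[OF fin(1)] by blast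
    \<comment> \<open>\<open>n\<close> bounds the levels, so that \<open>z\<close>, the list of
      \<open>U\<close> built on \<open>Stub n 0\<close>, lies above all of \<open>U\<close> and
      \<open>W\<close>; then \<open>U\<close> are in-neighbours by membership and \<open>W\<close>
      out-neighbours by non-membership.\<close>
    define n where "n = Max (insert 0 (level ` (U \<union> W)))"
    have n: "level x \<le> n" if "x \<in> U \<union> W" for x
      unfolding n_def using fin that by (intro Max_ge) auto
    define z where "z = foldr (\<lambda>u w. Link u w 0) us (Stub n 0)"
    have "elems (foldr (\<lambda>u w. Link u w 0) us (Stub n 0)) = set us" for us :: "'a vertex list"
      by (induction us) auto
    then have elems: "elems z = U" by (simp add: z_def us)
    have "n < level (foldr (\<lambda>u w. Link u w 0) us (Stub n 0))" for us :: "'a vertex list"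
      by (induction us) auto
    then have level: "level x < level z" if "x \<in> U \<union> W" for x using n[OF that] by (simp add: z_def le_less_trans)
    have "z \<notin> U \<union> W" using level by blast
    moreover have "\<forall>u\<in>U. varc lt u z" using level by (simp add: varc_def elems)
    moreover have "\<forall>w\<in>W. varc lt z w"
    proof
      fix w assume "w \<in> W"
      then have "level w < level z" "w \<notin> U" using level disj by auto
      then show "varc lt z w" by (simp add: varc_def elems)
    qed
    ultimately show "\<exists>z\<in>UNIV. z \<notin> U \<union> W \<and> (\<forall>u\<in>U. varc lt u z) \<and> (\<forall>w\<in>W. varc lt z w)" by blast
  qed
qed

text \<open>Universality gives a copy of the finite tournament on \<open>U\<close>, \<open>W\<close>
  and one new vertex; homogeneity moves the old vertices of this copy to where they belong, and the
  image of the new vertex is the extension.\<close>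

lemma generic_tournament_extension:
  assumes T: "generic_tournament T" and fin: "finite U" "finite W" and sub: "U \<subseteq> verts T" "W \<subseteq> verts T"
    and disj: "U \<inter> W = {}"
  shows "\<exists>z\<in>verts T. z \<notin> U \<union> W \<and> (\<forall>u\<in>U. (u, z) \<in> edges T) \<and> (\<forall>w\<in>W. (z, w) \<in> edges T)"
proof -
  have tour: "tournament T" and hom: "homogeneous T"
    and univ: "\<And>H :: nat digraph. finite (verts H) \<Longrightarrow> tournament H \<Longrightarrow> \<exists>f. embedding f H T"
    using T by (auto simp: generic_tournament_def)
  have irr: "(x, x) \<notin> edges T" for x by (rule tournament_irrefl[OF tour])
  have asym: "(x, y) \<in> edges T \<Longrightarrow> (y, x) \<notin> edges T" for x y
    using tour irr[of x] by (auto simp: tournament_def is_digraph_def dest: antisymD)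
  obtain e n where e: "bij_betw e {..<n::nat} (U \<union> W)"
    using ex_bij_betw_nat_finite[of "U \<union> W"] fin by (auto simp: atLeast0LessThan)
  have eV: "e i \<in> U \<union> W" if "i < n" for i using e that by (auto simp: bij_betw_def)
  have einj: "e i = e j \<longleftrightarrow> i = j" if "i < n" "j < n" for i j
    using e that by (auto simp: bij_betw_def inj_on_def)
  \<comment> \<open>The numbers below \<open>n\<close> stand for the elements of \<open>U\<close>
    and \<open>W\<close> via \<open>e\<close>, and \<open>n\<close> stands for the new
    vertex.\<close>
  define H where "H = \<lparr>verts = {..n}, edges = {(i, j). i < n \<and> j < n \<and> (e i, e j) \<in> edges T}
      \<union> {(i, n) |i. i < n \<and> e i \<in> U} \<union> {(n, i) |i. i < n \<and> e i \<in> W}\<rparr>"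
  have He: "(i, j) \<in> edges H \<longleftrightarrow> i < n \<and> j < n \<and> (e i, e j) \<in> edges T \<or>
      j = n \<and> i < n \<and> e i \<in> U \<or> i = n \<and> j < n \<and> e j \<in> W" for i j
    by (auto simp: H_def)
  have "tournament H"
    unfolding tournament_def is_digraph_def
  proof (intro conjI)
    show "edges H \<subseteq> verts H \<times> verts H" by (auto simp: H_def)
    show "irrefl (edges H)" by (auto simp: irrefl_def He irr)
    show "antisym (edges H)" using disj asym by (intro antisymI) (auto simp: He)
    show "total_on (verts H) (edges H)"
    proof (rule total_onI)
      fix i j assume ij: "i \<in> verts H" "j \<in> verts H" "i \<noteq> j"
      show "(i, j) \<in> edges H \<or> (j, i) \<in> edges H"
      proof (cases "i < n \<and> j < n")
        case True
        then have "e i \<in> verts T" "e j \<in> verts T" "e i \<noteq> e j"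
          using eV[of i] eV[of j] sub einj[of i j] ij by blast+
        then show ?thesis using tournament_edge_cases[OF tour] True unfolding He by blast
      next
        case False
        then have "i < n \<and> j = n \<or> i = n \<and> j < n" using ij by (auto simp: H_def)
        then show ?thesis using eV unfolding He by blast
      qed
    qed
  qed
  then obtain f where f: "embedding f H T" using univ[of H] by (auto simp: H_def)
  have fV: "f i \<in> verts T" if "i \<le> n" for i
    using f that by (auto simp: embedding_def H_def)
  have finj: "f i = f j \<longleftrightarrow> i = j" if "i \<le> n" "j \<le> n" for i j
    using f that by (auto simp: embedding_def H_def inj_on_def)
  have fe: "(f i, f j) \<in> edges T \<longleftrightarrow> (i, j) \<in> edges H" if "i \<le> n" "j \<le> n" for i j
    using f that by (auto simp: embedding_def H_def)
  define A where "A = f ` {..<n}"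
  \<comment> \<open>\<open>k\<close> takes the copies of the old vertices back to the originals; it
    is the finite isomorphism that homogeneity extends.\<close>
  define k where "k = e \<circ> inv_into {..<n} f"
  have k: "k (f i) = e i" if "i < n" for i
    using that finj by (auto simp: k_def inj_on_def intro!: arg_cong[of _ _ e] inv_into_f_f)
  have "embedding k (induced T A) T"
    unfolding embedding_def
  proof (intro conjI ballI)
    show "k \<in> verts (induced T A) \<rightarrow> verts T"
      using eV subsetD[OF Un_least[OF sub]] by (auto simp: induced_def A_def k)
    show "inj_on k (verts (induced T A))"
      using einj by (auto simp: induced_def A_def k inj_on_def)
    fix x y assume "x \<in> verts (induced T A)" "y \<in> verts (induced T A)"
    then obtain i j where ij: "i < n" "j < n" "x = f i" "y = f j" by (auto simp: induced_def A_def)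
    then have "(f i, f j) \<in> edges T \<longleftrightarrow> (e i, e j) \<in> edges T" using fe[of i j] by (auto simp: He)
    then show "(x, y) \<in> edges (induced T A) \<longleftrightarrow> (k x, k y) \<in> edges T"
      using ij by (auto simp: k induced_def A_def)
  qed
  moreover have "finite A" "A \<subseteq> verts T" using fV by (auto simp: A_def)
  ultimately obtain g where g: "g \<in> automorphisms T" "\<forall>x\<in>A. g x = k x"
    using hom unfolding homogeneous_def by blast
  have gf: "g (f i) = e i" if "i < n" for i using g(2) that by (auto simp: A_def k)
  have edge: "(g (f i), g (f j)) \<in> edges T \<longleftrightarrow> (i, j) \<in> edges H" if "i \<le> n" "j \<le> n" for i j
    using automorphism_edge[OF g(1) fV fV] fe that by simp
  have all: "\<exists>i<n. x = e i" if "x \<in> U \<union> W" for x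
    using e that by (force simp: bij_betw_def)
  show ?thesis
  proof (intro bexI[of _ "g (f n)"] conjI ballI)
    show "g (f n) \<in> verts T" using automorphism_mem[OF g(1) fV[of n]] by simp
    show "g (f n) \<notin> U \<union> W"
    proof
      assume "g (f n) \<in> U \<union> W"
      then obtain i where "i < n" "g (f n) = g (f i)" using all gf by metis
      then show False using automorphism_inj[OF g(1) fV fV, of n i] finj[of n i] by simp
    qed
    show "(u, g (f n)) \<in> edges T" if u: "u \<in> U" for u
    proof -
      obtain i where "i < n" "u = e i" using all u by blast
      then show ?thesis using edge[of i n] gf[of i] u by (simp add: He)
    qed
    show "(g (f n), w) \<in> edges T" if w: "w \<in> W" for w
    proof -
      obtain i where "i < n" "w = e i" using all w by blast
      then show ?thesis using edge[of n i] gf[of i] w by (simp add: He)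
    qed
  qed
qed

lemma generic_tournament_tournament: "generic_tournament T \<Longrightarrow> tournament T"
  by (simp add: generic_tournament_def)

lemma generic_tournament_locale:
  assumes T: "generic_tournament T"
  shows "generic_countable_tournament (verts T) (\<lambda>x y. (x, y) \<in> edges T)"
proof
  have tour: "tournament T" using T by (simp add: generic_tournament_def)
  show "countable (verts T)" using T by (simp add: generic_tournament_def)
  show irr: "(x, x) \<notin> edges T" for x by (rule tournament_irrefl[OF tour])
  show "(y, x) \<notin> edges T" if "(x, y) \<in> edges T" for x y
    using tour irr[of x] that by (auto simp: tournament_def is_digraph_def dest: antisymD)
  show "(x, y) \<in> edges T \<or> (y, x) \<in> edges T" if "x \<in> verts T" "y \<in> verts T" "x \<noteq> y" for x y
    using tournament_edge_cases[OF tour] that by blast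
qed (rule generic_tournament_extension[OF T])

section \<open>The code in the generic tournament\<close>

definition point_tournament :: "point vertex digraph" where
  "point_tournament = \<lparr>verts = UNIV, edges = {(x, y). varc pless x y}\<rparr>"

lemma edge_point_tournament [simp]: "(x, y) \<in> edges point_tournament \<longleftrightarrow> varc pless x y"
  by (simp add: point_tournament_def)

text \<open>A vertex contains finitely many base points, so its image depends on finitely many
  values of \<open>phi\<close>.\<close>

lemma openin_vmap_phi:
  "openin (structures I ar) {S \<in> topspace (structures I ar). vmap (phi I ar S) k v = w}"
proof (induction v arbitrary: w)
  case (Base x)
  then show ?case using openin_phi[where P = "\<lambda>x. Base x = w"] by simp
next
  case (Stub n i)
  then show ?case by (cases "Stub n (i + k) = w") auto
next
  case (Link a b i)
  show ?case
  proof (cases "\<exists>c d. w = Link c d (i + k)")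
    case True
    then obtain c d where w: "w = Link c d (i + k)" by blast
    have "{S \<in> topspace (structures I ar). vmap (phi I ar S) k (Link a b i) = w} =
        {S \<in> topspace (structures I ar). vmap (phi I ar S) k a = c} \<inter>
        {S \<in> topspace (structures I ar). vmap (phi I ar S) k b = d}"
      by (auto simp: w)
    then show ?thesis using Link by (simp add: openin_Int)
  next
    case False
    then have "{S \<in> topspace (structures I ar). vmap (phi I ar S) k (Link a b i) = w} = {}" by auto
    then show ?thesis by (simp only: openin_empty)
  qed
qed

text \<open>The shift by 1 leaves no fixed points besides the fixed base points, so a conjugator
  maps these onto each other, and on base points \<open>varc\<close> is the order
  \<open>pless\<close>.\<close>

lemma point_tournament_borel_complete: "conjugacy_borel_complete point_tournament"
proof (rule conjugacy_borel_complete_model[of "\<lambda>I ar S. vmap (phi I ar S) 1"])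
  have UNIV: "verts point_tournament = UNIV" by (simp add: point_tournament_def)
  have aut: "vmap f k \<in> automorphisms point_tournament"
    if "bij f" "\<And>x y. pless (f x) (f y) \<longleftrightarrow> pless x y" for f k
    using varc_vmap[of f pless] bij_vmap that by (simp add: automorphisms_UNIV UNIV)
  fix I ar S
  show "vmap (phi I ar S) 1 \<in> automorphisms point_tournament"
    by (rule aut) (simp_all add: bij_phi pless_phi)
  show "openin (structures I ar) {S \<in> topspace (structures I ar). vmap (phi I ar S) 1 v = w}" for v w
    by (rule openin_vmap_phi)
  fix S'
  show "\<exists>\<delta>\<in>automorphisms point_tournament. \<forall>v\<in>verts point_tournament.
      \<delta> (vmap (phi I ar S) 1 v) = vmap (phi I ar S') 1 (\<delta> v)"
    if "bij \<alpha>" "\<And>x y. \<alpha> x < \<alpha> y \<longleftrightarrow> x < y" "\<And>s. weight I ar S' (map \<alpha> s) = weight I ar S s" for \<alpha>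
  proof (intro bexI ballI)
    \<comment> \<open>The conjugator leaves the labels alone, as they are shifted by 1 on both
      sides.\<close>
    show "vmap (pmap \<alpha>) 0 \<in> automorphisms point_tournament"
      by (rule aut) (use that in \<open>simp_all add: bij_pmap pless_pmap\<close>)
    have "pmap \<alpha> \<circ> phi I ar S = phi I ar S' \<circ> pmap \<alpha>" using pmap_phi[OF that(3)] by auto
    then show "vmap (pmap \<alpha>) 0 (vmap (phi I ar S) 1 v) = vmap (phi I ar S') 1 (vmap (pmap \<alpha>) 0 v)" for v
      by (simp add: vmap_vmap)
  qed
  show "\<exists>g. bij_betw g (fixed I ar S) (fixed I ar S') \<and>
        (\<forall>x\<in>fixed I ar S. \<forall>y\<in>fixed I ar S. pless (g x) (g y) \<longleftrightarrow> pless x y)"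
    if "\<delta> \<in> automorphisms point_tournament"
      "\<And>v. v \<in> verts point_tournament \<Longrightarrow> \<delta> (vmap (phi I ar S) 1 v) = vmap (phi I ar S') 1 (\<delta> v)" for \<delta>
  proof -
    have \<delta>: "bij \<delta>" "\<And>x y. varc pless (\<delta> x) (\<delta> y) \<longleftrightarrow> varc pless x y"
      using that(1) automorphisms_UNIV[OF UNIV, of \<delta>] by simp_all
    have bij: "bij_betw \<delta> (Base ` fixed I ar S) (Base ` fixed I ar S')"
      using bij_betw_fixed_points[OF \<delta>(1), of "vmap (phi I ar S) 1" "vmap (phi I ar S') 1"] that(2)
      by (simp add: UNIV vmap_eq_iff fixed_def)
    then obtain g where "bij_betw g (fixed I ar S) (fixed I ar S')"
      and g: "\<And>y. y \<in> fixed I ar S \<Longrightarrow> \<delta> (Base y) = Base (g y)"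
      by (rule bij_betw_inj_image[rotated]) (auto intro: injI)
    moreover have "pless (g x) (g y) \<longleftrightarrow> pless x y" if "x \<in> fixed I ar S" "y \<in> fixed I ar S" for x y
      using \<delta>(2)[of "Base x" "Base y"] that by (simp add: g varc_def)
    ultimately show ?thesis by blast
  qed
qed

lemma generic_tournament_borel_complete:
  assumes "generic_tournament T"
  shows "conjugacy_borel_complete T"
proof -
  interpret p: dense_coloured UNIV pless "\<lambda>x. dyadic (height x)" UNIV by (rule dense_coloured_points)
  have "countable_tournament UNIV pless"
  proof
    show "\<not> pless y x" if "pless x y" for x y
      using that p.trans[of x y x] p.irrefl by blast
    show "pless x y \<or> pless y x" if "x \<noteq> y" for x y
      using p.total[of x y] that by blast
  qed (rule p.countable, rule p.irrefl)
  from generic_countable_tournament_iso[OF generic_varc[OF this] generic_tournament_locale[OF assms]]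
  obtain h where "bij_betw h UNIV (verts T)" "\<And>x y. (h x, h y) \<in> edges T \<longleftrightarrow> varc pless x y" by blast
  then have "digraph_iso h point_tournament T"
    by (simp add: digraph_iso_def) (simp add: point_tournament_def)
  then show ?thesis using point_tournament_borel_complete by (rule conjugacy_borel_complete_iso)
qed


section \<open>Smooth relations and labelled actions\<close>

lemma standard_borel_real: "standard_borel (borel :: real measure)"
  unfolding standard_borel_def
proof (intro exI[of _ euclidean] conjI)
  show "completely_metrizable_space (euclidean :: real topology)"
    by (rule completely_metrizable_space_euclidean)
  obtain B :: "real set set" where B: "countable B" "topological_basis B"
    using ex_countable_basis[where 'a = real] by (elim exE conjE)
  have "\<exists>W\<in>B. x \<in> W \<and> W \<subseteq> U" if "open U" "x \<in> U" for U x
    by (rule topological_basisE[OF B(2) that]) blast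
  then show "second_countable (euclidean :: real topology)"
    unfolding second_countable_def using B topological_basis_open[OF B(2)]
    by (intro exI[of _ B]) simp
  show "sets (borel :: real measure) = sets (borel_of euclidean)"
    by (simp add: sets_borel_of borel_def)
qed auto

text \<open>A bit sequence as a real number with ternary digits 0 and 1. In base 2 different
  sequences could give the same number.\<close>

definition ternary :: "(nat \<Rightarrow> bool) \<Rightarrow> real" where
  "ternary P = (\<Sum>n. of_bool (P n) * (1 / 3) ^ Suc n)"

lemma summable_ternary: "summable (\<lambda>n. of_bool (P n) * (1 / 3 :: real) ^ Suc n)"
  by (rule summable_comparison_test'[where g = "\<lambda>n. (1 / 3) ^ n"]) (auto simp: summable_geometric)

lemma ternary_Suc: "ternary P = of_bool (P 0) / 3 + ternary (\<lambda>n. P (Suc n)) / 3"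
proof -
  have "ternary P = of_bool (P 0) / 3 + (\<Sum>n. of_bool (P (Suc n)) * (1 / 3) ^ Suc (Suc n))"
    unfolding ternary_def using suminf_split_head[OF summable_ternary[of P]] by simp
  also have "(\<Sum>n. of_bool (P (Suc n)) * (1 / 3) ^ Suc (Suc n)) = (ternary (\<lambda>n. P (Suc n)) / 3)"
    unfolding ternary_def
    using suminf_mult[OF summable_ternary[of "\<lambda>n. P (Suc n)"], of "1 / 3"] by (simp add: mult_ac)
  finally show ?thesis .
qed

lemma ternary_bounds: "0 \<le> ternary P" "ternary P \<le> 1 / 2"
proof -
  show "0 \<le> ternary P" unfolding ternary_def by (rule suminf_nonneg[OF summable_ternary]) simp
  have "(\<lambda>n. (1 / 3 :: real) * (1 / 3) ^ n) sums (1 / 3 * (1 / (1 - 1 / 3)))"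
    by (intro sums_mult geometric_sums) simp
  then have s: "(\<lambda>n. (1 / 3 :: real) ^ Suc n) sums (1 / 2)" by simp
  then have "ternary P \<le> (\<Sum>n. (1 / 3 :: real) ^ Suc n)"
    unfolding ternary_def
    by (intro suminf_le summable_ternary) (auto simp: sums_iff)
  then show "ternary P \<le> 1 / 2" using s by (simp add: sums_iff)
qed

text \<open>The digits after the first contribute at most 1/6, so the first digit is determined, and
  then the next ones.\<close>

lemma ternary_inject:
  assumes "ternary P = ternary Q" shows "P n = Q n"
  using assms
proof (induction n arbitrary: P Q)
  case 0
  then show ?case
    using ternary_Suc[of P] ternary_Suc[of Q] ternary_bounds[of "\<lambda>n. P (Suc n)"]
      ternary_bounds[of "\<lambda>n. Q (Suc n)"]
    by (cases "P 0"; cases "Q 0") auto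
next
  case (Suc n)
  have "ternary (\<lambda>n. P (Suc n)) = ternary (\<lambda>n. Q (Suc n))"
    using Suc.prems ternary_Suc[of P] ternary_Suc[of Q] ternary_bounds[of "\<lambda>n. P (Suc n)"]
      ternary_bounds[of "\<lambda>n. Q (Suc n)"]
    by (cases "P 0"; cases "Q 0") auto
  then show ?case by (rule Suc.IH)
qed

text \<open>Countably many Borel yes-no invariants are packed into one real number.\<close>

lemma smooth_countable:
  assumes "\<And>n::nat. Measurable.pred M (P n)"
    and "\<And>x y. x \<in> space M \<Longrightarrow> y \<in> space M \<Longrightarrow> (x, y) \<in> E \<longleftrightarrow> (\<forall>n. P n x = P n y)"
  shows "smooth M E"
  unfolding smooth_def
proof (intro exI conjI ballI)
  show "standard_borel (borel :: real measure)" by (rule standard_borel_real)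
  note assms(1)[measurable]
  show "(\<lambda>x. ternary (\<lambda>n. P n x)) \<in> borel_measurable M"
    unfolding ternary_def by measurable
  fix x y assume "x \<in> space M" "y \<in> space M"
  moreover have "ternary (\<lambda>n. P n x) = ternary (\<lambda>n. P n y) \<longleftrightarrow> (\<forall>n. P n x = P n y)"
    using ternary_inject by (auto intro: arg_cong[of _ _ ternary])
  ultimately show "(x, y) \<in> E \<longleftrightarrow> ternary (\<lambda>n. P n x) = ternary (\<lambda>n. P n y)"
    using assms(2) by simp
qed

text \<open>A point is classified by the unordered finite set of the sequences \<open>b s\<close>; finite sets of
  sequences are distinguished by the finite words that are initial segments of a member.\<close>

lemma smooth_finite_ambiguity:
  fixes b :: "'s \<Rightarrow> nat \<Rightarrow> 'a \<Rightarrow> bool"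
  assumes "finite S" "s0 \<in> S"
    and meas: "\<And>s n. s \<in> S \<Longrightarrow> Measurable.pred M (b s n)"
    and sym: "\<And>x y. (x, y) \<in> E \<Longrightarrow> (y, x) \<in> E"
    and fwd: "\<And>x y s. (x, y) \<in> E \<Longrightarrow> x \<in> space M \<Longrightarrow> y \<in> space M \<Longrightarrow> s \<in> S \<Longrightarrow>
      \<exists>t\<in>S. \<forall>n. b s n x = b t n y"
    and bwd: "\<And>x y t. x \<in> space M \<Longrightarrow> y \<in> space M \<Longrightarrow> t \<in> S \<Longrightarrow> \<forall>n. b s0 n x = b t n y \<Longrightarrow> (x, y) \<in> E"
  shows "smooth M E"
proof (rule smooth_countable)
  define P where "P n x \<longleftrightarrow> (\<exists>s\<in>S. \<forall>i<length (from_nat n :: bool list). b s i x = (from_nat n :: bool list) ! i)"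
    for n x
  note meas[measurable]
  show "Measurable.pred M (P n)" for n
    unfolding P_def using assms(1) by measurable
  have imp: "P n y" if xy: "(x, y) \<in> E" "x \<in> space M" "y \<in> space M" and "P n x" for x y n
  proof -
    obtain s where s: "s \<in> S" "\<forall>i<length (from_nat n :: bool list). b s i x = (from_nat n :: bool list) ! i"
      using \<open>P n x\<close> by (auto simp: P_def)
    obtain t where "t \<in> S" "\<forall>n. b s n x = b t n y" using fwd[OF xy s(1)] by blast
    then show ?thesis using s(2) unfolding P_def by (intro bexI[of _ t]) auto
  qed
  fix x y assume x: "x \<in> space M" and y: "y \<in> space M"
  show "(x, y) \<in> E \<longleftrightarrow> (\<forall>n. P n x = P n y)"
  proof
    assume "(x, y) \<in> E"
    then show "\<forall>n. P n x = P n y" using imp[of x y] imp[of y x] sym x y by blast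
  next
    assume eq: "\<forall>n. P n x = P n y"
    \<comment> \<open>For every length \<open>k\<close> some \<open>t\<close> matches the first
      \<open>k\<close> bits; \<open>S\<close> is finite, so one \<open>t\<close> matches for
      infinitely many \<open>k\<close> and hence for all.\<close>
    have "\<exists>t\<in>S. \<forall>i<k. b t i y = b s0 i x" for k
    proof -
      let ?w = "map (\<lambda>i. b s0 i x) [0..<k]"
      have "P (to_nat ?w) x" using assms(2) by (auto simp: P_def)
      then have "P (to_nat ?w) y" using eq by simp
      then show ?thesis by (auto simp: P_def)
    qed
    then obtain t where t: "\<And>k. t k \<in> S" "\<And>k i. i < k \<Longrightarrow> b (t k) i y = b s0 i x" by metis
    have "\<not> finite (UNIV :: nat set)" by simp
    then obtain s where s: "s \<in> S" "infinite {k. t k = s}"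
      using pigeonhole_infinite[of UNIV t] finite_subset[OF _ assms(1), of "range t"] t(1)
      by (metis (mono_tags, lifting) Collect_cong UNIV_I image_subset_iff)
    have "b s0 i x = b s i y" for i
    proof -
      obtain k where "i < k" "t k = s" using s(2) by (auto simp: infinite_nat_iff_unbounded)
      then show ?thesis using t(2) by auto
    qed
    then show "(x, y) \<in> E" using bwd[OF x y s(1)] by blast
  qed
qed

section \<open>Labelled actions of abelian groups and their orbit counts\<close>

locale labelled_action =
  fixes V :: "'a set" and act :: "'g :: ab_group_add \<Rightarrow> 'a \<Rightarrow> 'a" and c :: "'a \<Rightarrow> 'x"
    and F :: "'g \<Rightarrow> 'x \<Rightarrow> 'x"
  assumes countable: "countable V"
    and closed: "v \<in> V \<Longrightarrow> act g v \<in> V"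
    and act_0: "v \<in> V \<Longrightarrow> act 0 v = v"
    and act_add: "v \<in> V \<Longrightarrow> act (g + h) v = act g (act h v)"
    and label: "v \<in> V \<Longrightarrow> c (act g v) = F g (c v)"

definition stab :: "('g \<Rightarrow> 'a \<Rightarrow> 'a) \<Rightarrow> 'a \<Rightarrow> 'g set" where
  "stab act v = {g. act g v = v}"

text \<open>The orbits are counted through lists of representatives, so that only quantifiers over
  vertices and group elements occur and the condition is Borel when these are countable.\<close>

definition many_orbits ::
  "'a set \<Rightarrow> ('g \<Rightarrow> 'a \<Rightarrow> 'a) \<Rightarrow> ('a \<Rightarrow> 'x) \<Rightarrow> 'g set \<Rightarrow> 'x \<Rightarrow> nat \<Rightarrow> bool" where
  "many_orbits V act c H x m \<longleftrightarrow>
     (\<exists>vs. length vs = m \<and> set vs \<subseteq> V \<and> (\<forall>v\<in>set vs. stab act v = H \<and> c v = x) \<and>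
        (\<forall>i<m. \<forall>j<m. i \<noteq> j \<longrightarrow> (\<forall>g. act g (vs ! i) \<noteq> vs ! j)))"

context labelled_action
begin

definition orbit :: "'a \<Rightarrow> 'a set" where
  "orbit v = range (\<lambda>g. act g v)"

lemma orbit_refl: "v \<in> V \<Longrightarrow> v \<in> orbit v"
  using act_0[of v] by (auto simp: orbit_def image_iff intro: exI[of _ 0])

lemma orbit_subset: "v \<in> V \<Longrightarrow> orbit v \<subseteq> V"
  using closed by (auto simp: orbit_def)

lemma orbit_eq:
  assumes "v \<in> V" "u \<in> orbit v" shows "orbit u = orbit v"
proof -
  obtain g where g: "u = act g v" using assms(2) by (auto simp: orbit_def)
  have "act h u = act (h + g) v" for h using act_add[OF assms(1)] g by simp
  then have "orbit u \<subseteq> orbit v" by (auto simp: orbit_def)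
  moreover have "act h v = act (h - g) u" for h using act_add[OF assms(1), of "h - g" g] g by simp
  then have "act h v \<in> orbit u" for h unfolding orbit_def by (metis rangeI)
  then have "orbit v \<subseteq> orbit u" by (auto simp: orbit_def[of v])
  ultimately show ?thesis by simp
qed

text \<open>The group is abelian, so conjugate stabilizers coincide.\<close>

lemma stab_orbit:
  assumes "v \<in> V" "u \<in> orbit v" shows "stab act u = stab act v"
proof -
  obtain g where g: "u = act g v" using assms(2) by (auto simp: orbit_def)
  have "act h u = u \<longleftrightarrow> act h v = v" for h
  proof
    assume "act h v = v"
    then show "act h u = u"
      using act_add[OF assms(1), of h g] act_add[OF assms(1), of g h] g by (simp add: add.commute)
  next
    assume "act h u = u"
    then have "act (- g) (act h u) = act (- g) u" by simp
    moreover have "act (- g) (act h u) = act h v"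
      using act_add[OF assms(1), of "- g + h" g] act_add[of u "- g" h] closed[OF assms(1), of g] g by simp
    moreover have "act (- g) u = v" using act_add[OF assms(1), of "- g" g] act_0[OF assms(1)] g by simp
    ultimately show "act h v = v" by simp
  qed
  then show ?thesis by (simp add: stab_def)
qed

lemma labels_orbit:
  assumes "v \<in> V" "u \<in> orbit v" shows "c ` orbit v = range (\<lambda>g. F g (c u))"
proof -
  have "u \<in> V" using orbit_subset assms by blast
  then have "c ` orbit u = range (\<lambda>g. F g (c u))" using label by (simp add: orbit_def image_image)
  then show ?thesis using orbit_eq[OF assms] by simp
qed

lemma act_eq_iff:
  assumes "v \<in> V" shows "act g v = act h v \<longleftrightarrow> g - h \<in> stab act v"
proof -
  have "act g v = act h v \<longleftrightarrow> act (- h) (act g v) = act (- h) (act h v)"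
  proof
    assume "act (- h) (act g v) = act (- h) (act h v)"
    then have "act h (act (- h) (act g v)) = act h (act (- h) (act h v))" by simp
    then show "act g v = act h v"
      using act_add[of "act g v" h "- h"] act_add[of "act h v" h "- h"] closed[OF assms] act_0 by simp
  qed simp
  also have "\<dots> \<longleftrightarrow> act (g - h) v = v"
    using act_add[OF assms, of "- h" g] act_add[OF assms, of "- h" h] act_0[OF assms] by simp
  finally show ?thesis by (simp add: stab_def)
qed

text \<open>The isomorphism type of a single orbit. By \<open>labels_orbit\<close> its set of labels
  is determined by any one of them.\<close>

definition key :: "'a \<Rightarrow> 'g set \<times> 'x set" where
  "key v = (stab act v, c ` orbit v)"

lemma key_orbit: "v \<in> V \<Longrightarrow> u \<in> orbit v \<Longrightarrow> key u = key v"
  using stab_orbit[of v u] orbit_eq[of v u] by (simp add: key_def)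

definition fibre :: "'g set \<times> 'x set \<Rightarrow> 'a set set" where
  "fibre k = {orbit v |v. v \<in> V \<and> key v = k}"

lemma countable_fibre: "countable (fibre k)"
proof -
  have "fibre k \<subseteq> orbit ` V" by (auto simp: fibre_def)
  then show ?thesis using countable by (meson countable_image countable_subset)
qed

text \<open>An orbit with label set \<open>X\<close> contains a point labelled \<open>x\<close>, and
  conversely one such point fixes the label set; so counting representatives labelled
  \<open>x\<close> is counting orbits of the given type.\<close>

lemma many_orbits_fibre:
  assumes "X = range (\<lambda>g. F g x)" "x \<in> X"
  shows "many_orbits V act c H x m \<longleftrightarrow> (\<exists>O'\<subseteq>fibre (H, X). finite O' \<and> card O' = m)"
proof
  assume "many_orbits V act c H x m"
  then obtain vs where vs: "length vs = m" "set vs \<subseteq> V" "\<forall>v\<in>set vs. stab act v = H \<and> c v = x"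
    "\<forall>i<m. \<forall>j<m. i \<noteq> j \<longrightarrow> (\<forall>g. act g (vs ! i) \<noteq> vs ! j)"
    unfolding many_orbits_def by blast
  have "key v = (H, X)" if "v \<in> set vs" for v
  proof -
    have "v \<in> V" using that vs by blast
    then show ?thesis
      using labels_orbit[of v v] orbit_refl[of v] vs(3) that assms(1) by (auto simp: key_def)
  qed
  then have "orbit ` set vs \<subseteq> fibre (H, X)" using vs(2) by (auto simp: fibre_def)
  moreover have "distinct (map orbit vs)"
    unfolding distinct_conv_nth
  proof (intro allI impI)
    fix i j assume ij: "i < length (map orbit vs)" "j < length (map orbit vs)" "i \<noteq> j"
    show "map orbit vs ! i \<noteq> map orbit vs ! j"
    proof
      assume "map orbit vs ! i = map orbit vs ! j"
      moreover have "vs ! j \<in> V" using ij vs(2) by auto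
      ultimately have "vs ! j \<in> orbit (vs ! i)" using ij orbit_refl by simp
      then obtain g where "act g (vs ! i) = vs ! j" by (auto simp: orbit_def)
      moreover have "act g (vs ! i) \<noteq> vs ! j" using vs(1,4) ij by simp
      ultimately show False by contradiction
    qed
  qed
  then have "card (orbit ` set vs) = m" using distinct_card vs(1) by fastforce
  ultimately show "\<exists>O'\<subseteq>fibre (H, X). finite O' \<and> card O' = m" by blast
next
  assume "\<exists>O'\<subseteq>fibre (H, X). finite O' \<and> card O' = m"
  then obtain O' where O': "O' \<subseteq> fibre (H, X)" "finite O'" "card O' = m" by blast
  have "\<exists>v. v \<in> V \<and> orbit v = o' \<and> stab act v = H \<and> c v = x" if mem: "o' \<in> O'" for o'
  proof -
    obtain u where u: "u \<in> V" "o' = orbit u" "key u = (H, X)" using subsetD[OF O'(1) mem] by (auto simp: fibre_def)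
    then have "x \<in> c ` orbit u" using assms(2) by (simp add: key_def)
    then obtain v where v: "v \<in> orbit u" "c v = x" by blast
    then show ?thesis
      using u orbit_eq[OF u(1) v(1)] stab_orbit[OF u(1) v(1)] orbit_subset[OF u(1)]
      by (auto simp: key_def)
  qed
  then obtain f where f: "\<And>o'. o' \<in> O' \<Longrightarrow> f o' \<in> V \<and> orbit (f o') = o' \<and> stab act (f o') = H \<and> c (f o') = x"
    by metis
  obtain os where os: "distinct os" "set os = O'" using finite_distinct_list[OF O'(2)] by blast
  have len: "length os = m" using os O'(3) distinct_card by metis
  show "many_orbits V act c H x m"
    unfolding many_orbits_def
  proof (intro exI[of _ "map f os"] conjI allI impI)
    show "length (map f os) = m" using len by simp
    show "set (map f os) \<subseteq> V" "\<forall>v\<in>set (map f os). stab act v = H \<and> c v = x" using f os by auto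
    fix i j g assume ij: "i < m" "j < m" "i \<noteq> j"
    have mem: "os ! i \<in> O'" "os ! j \<in> O'" using ij os len by auto
    show "act g (map f os ! i) \<noteq> map f os ! j"
    proof
      assume "act g (map f os ! i) = map f os ! j"
      then have "f (os ! j) = act g (f (os ! i))" using ij len by simp
      then have "f (os ! j) \<in> orbit (f (os ! i))" by (simp add: orbit_def)
      then have "orbit (f (os ! j)) = orbit (f (os ! i))" using orbit_eq f mem by blast
      then have "os ! j = os ! i" using f mem by metis
      then show False using ij os len by (simp add: nth_eq_iff_index_eq)
    qed
  qed
qed

end

lemma ex_subset_card_iff:
  "(\<exists>X\<subseteq>A. finite X \<and> card X = m) \<longleftrightarrow> (finite A \<longrightarrow> m \<le> card A)"
proof (cases "finite A")
  case True
  then show ?thesis by (metis card_mono obtain_subset_with_card_n)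
next
  case False
  then show ?thesis using infinite_arbitrarily_large[OF False, of m] by auto
qed

text \<open>Infinite countable sets are equipotent, and finite ones are told apart by the sizes of
  their subsets.\<close>

lemma countable_equipotent:
  assumes "countable A" "countable B"
    and "\<And>m. (\<exists>X\<subseteq>A. finite X \<and> card X = m) \<longleftrightarrow> (\<exists>Y\<subseteq>B. finite Y \<and> card Y = m)"
  shows "\<exists>f. bij_betw f A B"
proof -
  have eq: "(finite A \<longrightarrow> m \<le> card A) \<longleftrightarrow> (finite B \<longrightarrow> m \<le> card B)" for m
    using assms(3)[of m] by (simp only: ex_subset_card_iff)
  show ?thesis
  proof (cases "finite A")
    case True
    then have "finite B" using eq[of "Suc (card A)"] by auto
    moreover have "card A = card B"
      using eq[of "card A"] eq[of "card B"] True \<open>finite B\<close> by auto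
    ultimately show ?thesis using True by (simp add: finite_same_card_bij)
  next
    case False
    then have "infinite B" using eq[of "Suc (card B)"] by auto
    then obtain f :: "'a \<Rightarrow> nat" and g :: "'b \<Rightarrow> nat" where "bij_betw f A UNIV" "bij_betw g B UNIV"
      using assms(1,2) False countableE_infinite by metis
    then show ?thesis using bij_betw_trans bij_betw_inv_into by blast
  qed
qed

text \<open>Equal counts give bijections between the orbits of each type. In each orbit a base point
  \<open>r\<close> is chosen, and in its partner a point \<open>r'\<close> with the same label;
  moving both by the same group element is well defined because the stabilizers agree, and respects
  labels because \<open>F\<close> is the same on both sides.\<close>

lemma labelled_action_iso:
  fixes act act' :: "'g :: ab_group_add \<Rightarrow> 'a \<Rightarrow> 'a"
  assumes "labelled_action V act c F" "labelled_action V act' c' F"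
    and counts: "\<And>H x m. H \<in> stab act ` V \<union> stab act' ` V \<Longrightarrow> x \<in> c ` V \<union> c' ` V \<Longrightarrow>
      many_orbits V act c H x m \<longleftrightarrow> many_orbits V act' c' H x m"
  shows "\<exists>\<delta>. bij_betw \<delta> V V \<and> (\<forall>v\<in>V. c' (\<delta> v) = c v \<and> (\<forall>g. \<delta> (act g v) = act' g (\<delta> v)))"
proof -
  interpret A: labelled_action V act c F by fact
  interpret B: labelled_action V act' c' F by fact
  have "\<exists>f. bij_betw f (A.fibre k) (B.fibre k)" for k
  \<comment> \<open>Counts are assumed only for stabilizers and labels that occur, so a type without
    orbits on either side is treated apart.\<close>
  proof (cases "A.fibre k = {} \<and> B.fibre k = {}")
    case False
    obtain H X where k: "k = (H, X)" by force
    have "\<exists>x\<in>c ` V \<union> c' ` V. H \<in> stab act ` V \<union> stab act' ` V \<and> X = range (\<lambda>g. F g x) \<and> x \<in> X"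
    proof (cases "A.fibre k = {}")
      case False
      then obtain v where v: "v \<in> V" "A.key v = (H, X)" by (auto simp: A.fibre_def k)
      then show ?thesis using A.labels_orbit[OF v(1) A.orbit_refl[OF v(1)]] A.orbit_refl[OF v(1)]
        by (intro bexI[of _ "c v"]) (auto simp: A.key_def)
    next
      case True
      then obtain v where v: "v \<in> V" "B.key v = (H, X)" using False by (auto simp: B.fibre_def k)
      then show ?thesis using B.labels_orbit[OF v(1) B.orbit_refl[OF v(1)]] B.orbit_refl[OF v(1)]
        by (intro bexI[of _ "c' v"]) (auto simp: B.key_def)
    qed
    then obtain x where x: "x \<in> c ` V \<union> c' ` V" "H \<in> stab act ` V \<union> stab act' ` V"
      "X = range (\<lambda>g. F g x)" "x \<in> X" by blast
    show ?thesis
      using counts[OF x(2,1)] A.many_orbits_fibre[OF x(3,4)] B.many_orbits_fibre[OF x(3,4)]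
      by (intro countable_equipotent A.countable_fibre B.countable_fibre) (simp add: k)
  qed (simp add: bij_betw_def)
  then obtain f where f: "\<And>k. bij_betw (f k) (A.fibre k) (B.fibre k)" by metis
  define r where "r o' = (SOME v. v \<in> o')" for o' :: "'a set"
  have r: "r (A.orbit v) \<in> A.orbit v" if "v \<in> V" for v
    unfolding r_def using A.orbit_refl[OF that] by (rule someI)
  have rV: "r (A.orbit v) \<in> V" if "v \<in> V" for v using r[OF that] A.orbit_subset[OF that] by blast
  define \<beta> where "\<beta> v = f (A.key v) (A.orbit v)" for v
  have \<beta>: "\<beta> v \<in> B.fibre (A.key v)" if "v \<in> V" for v
    using f[of "A.key v"] that unfolding \<beta>_def by (auto simp: bij_betw_def A.fibre_def)
  have \<beta>_cong: "\<beta> u = \<beta> v" if "v \<in> V" "u \<in> A.orbit v" for u v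
    unfolding \<beta>_def using A.key_orbit[OF that] A.orbit_eq[OF that] by simp
  define r' where "r' v = (SOME w. w \<in> \<beta> v \<and> c' w = c (r (A.orbit v)))" for v
  have r': "r' v \<in> \<beta> v \<and> c' (r' v) = c (r (A.orbit v))" if v: "v \<in> V" for v
  proof -
    obtain w where w: "w \<in> V" "\<beta> v = B.orbit w" "B.key w = A.key v" using \<beta>[OF v] by (auto simp: B.fibre_def)
    then have "c' ` \<beta> v = c ` A.orbit v" by (simp add: A.key_def B.key_def)
    then have "c (r (A.orbit v)) \<in> c' ` \<beta> v" using r[OF v] by simp
    then obtain u where "u \<in> \<beta> v \<and> c' u = c (r (A.orbit v))" by (metis imageE)
    then show ?thesis unfolding r'_def by (rule someI)
  qed
  have r'_cong: "r' u = r' v" if "v \<in> V" "u \<in> A.orbit v" for u v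
    unfolding r'_def using A.orbit_eq[OF that] \<beta>_cong[OF that] by simp
  have props: "r' v \<in> V \<and> B.orbit (r' v) = \<beta> v \<and> B.key (r' v) = A.key v \<and>
      stab act' (r' v) = stab act (r (A.orbit v))" if v: "v \<in> V" for v
  proof -
    obtain w where w: "w \<in> V" "\<beta> v = B.orbit w" "B.key w = A.key v" using \<beta>[OF v] by (auto simp: B.fibre_def)
    have rw: "r' v \<in> B.orbit w" using r'[OF v] w by simp
    have "stab act' (r' v) = stab act v" using B.stab_orbit[OF w(1) rw] w(3) by (simp add: A.key_def B.key_def)
    then show ?thesis
      using B.orbit_eq[OF w(1) rw] B.key_orbit[OF w(1) rw] B.orbit_subset[OF w(1)] rw w
        A.stab_orbit[OF v r[OF v]] by auto
  qed
  \<comment> \<open>Some group element that moves the base point to \<open>v\<close>; two such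
    elements differ by the common stabilizer.\<close>
  define \<gamma> where "\<gamma> v = (SOME g. act g (r (A.orbit v)) = v)" for v
  have \<gamma>: "act (\<gamma> v) (r (A.orbit v)) = v" if v: "v \<in> V" for v
  proof -
    have "v \<in> A.orbit (r (A.orbit v))" using A.orbit_eq[OF v r[OF v]] A.orbit_refl[OF v] by simp
    then have "\<exists>g. act g (r (A.orbit v)) = v" unfolding A.orbit_def[of "r (A.orbit v)"] by (metis imageE)
    then show ?thesis unfolding \<gamma>_def by (rule someI_ex)
  qed
  define \<delta> where "\<delta> v = act' (\<gamma> v) (r' v)" for v
  have \<delta>_act: "\<delta> (act g (r (A.orbit v))) = act' g (r' v)" if v: "v \<in> V" for g v
  proof -
    let ?u = "act g (r (A.orbit v))"
    have uV: "?u \<in> V" using A.closed rV[OF v] by blast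
    have "?u \<in> A.orbit (r (A.orbit v))" by (auto simp: A.orbit_def)
    then have u: "?u \<in> A.orbit v" using A.orbit_eq[OF v r[OF v]] by simp
    have "act (\<gamma> ?u) (r (A.orbit v)) = ?u" using \<gamma>[OF uV] A.orbit_eq[OF v u] by simp
    then have "\<gamma> ?u - g \<in> stab act' (r' v)" using A.act_eq_iff[OF rV[OF v]] props[OF v] by simp
    then show ?thesis unfolding \<delta>_def r'_cong[OF v u] using B.act_eq_iff props[OF v] by blast
  qed
  have equi: "\<delta> (act g v) = act' g (\<delta> v)" if v: "v \<in> V" for g v
  proof -
    have "act g v = act (g + \<gamma> v) (r (A.orbit v))" using A.act_add[OF rV[OF v]] \<gamma>[OF v] by simp
    then have "\<delta> (act g v) = act' (g + \<gamma> v) (r' v)" using \<delta>_act[OF v] by simp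
    also have "\<dots> = act' g (\<delta> v)" unfolding \<delta>_def using B.act_add props[OF v] by simp
    finally show ?thesis .
  qed
  have lab: "c' (\<delta> v) = c v" if v: "v \<in> V" for v
  proof -
    have "c' (\<delta> v) = F (\<gamma> v) (c (r (A.orbit v)))" unfolding \<delta>_def using B.label props[OF v] r'[OF v] by simp
    also have "\<dots> = c v" using A.label[OF rV[OF v], of "\<gamma> v"] \<gamma>[OF v] by simp
    finally show ?thesis .
  qed
  have \<delta>V: "\<delta> v \<in> V" if "v \<in> V" for v unfolding \<delta>_def using B.closed props[OF that] by blast
  have \<delta>_orbit: "B.orbit (\<delta> v) = \<beta> v" if v: "v \<in> V" for v
  proof -
    have "\<delta> v \<in> B.orbit (r' v)" by (auto simp: \<delta>_def B.orbit_def)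
    then show ?thesis using B.orbit_eq props[OF v] by blast
  qed
  \<comment> \<open>Equal images lie in one orbit, which comes from one orbit of \<open>act\<close>
    by injectivity of \<open>f\<close>; within it the stabilizers agree.\<close>
  have "inj_on \<delta> V"
  proof (rule inj_onI)
    fix v w assume v: "v \<in> V" and w: "w \<in> V" and eq: "\<delta> v = \<delta> w"
    have \<beta>vw: "\<beta> v = \<beta> w" using \<delta>_orbit[OF v] \<delta>_orbit[OF w] eq by simp
    have "r' v \<in> B.orbit (r' w)" using r'[OF v] props[OF w] \<beta>vw by simp
    then have key: "A.key v = A.key w" using B.key_orbit[of "r' w" "r' v"] props[OF v] props[OF w] by simp
    have "inj_on (f (A.key v)) (A.fibre (A.key v))" using f by (simp add: bij_betw_def)
    moreover have "A.orbit v \<in> A.fibre (A.key v)" "A.orbit w \<in> A.fibre (A.key v)"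
      using v w key by (auto simp: A.fibre_def)
    ultimately have orb: "A.orbit v = A.orbit w"
      using \<beta>vw key unfolding \<beta>_def by (simp add: inj_on_eq_iff)
    then have "w \<in> A.orbit v" using A.orbit_refl[OF w] by simp
    then have "r' w = r' v" by (rule r'_cong[OF v])
    then have "act' (\<gamma> v) (r' v) = act' (\<gamma> w) (r' v)" using eq by (simp add: \<delta>_def)
    then have "\<gamma> v - \<gamma> w \<in> stab act (r (A.orbit v))" using B.act_eq_iff props[OF v] by simp
    then have "act (\<gamma> v) (r (A.orbit v)) = act (\<gamma> w) (r (A.orbit v))" using A.act_eq_iff[OF rV[OF v]] by simp
    then show "v = w" unfolding \<gamma>[OF v] using \<gamma>[OF w, folded orb] by (rule trans)
  qed
  moreover have "\<delta> ` V = V"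
  proof (intro equalityI subsetI)
    fix w assume w: "w \<in> V"
    have "B.orbit w \<in> B.fibre (B.key w)" using w by (auto simp: B.fibre_def)
    then have "B.orbit w \<in> f (B.key w) ` A.fibre (B.key w)" using f by (simp add: bij_betw_def)
    then obtain v where v: "v \<in> V" "A.key v = B.key w" "B.orbit w = f (B.key w) (A.orbit v)"
      by (auto simp: A.fibre_def)
    then have "\<beta> v = B.orbit w" by (simp add: \<beta>_def)
    then have "w \<in> B.orbit (r' v)" using props[OF v(1)] B.orbit_refl[OF w] by simp
    then obtain g where "w = act' g (r' v)" by (auto simp: B.orbit_def)
    then have "w = \<delta> (act g (r (A.orbit v)))" using \<delta>_act[OF v(1)] by simp
    then show "w \<in> \<delta> ` V" using A.closed[OF rV[OF v(1)]] by blast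
  qed (use \<delta>V in auto)
  ultimately show ?thesis using equi lab by (intro exI[of _ \<delta>]) (simp add: bij_betw_def)
qed

lemma many_orbits_transport:
  assumes "bij_betw \<delta> V V" "\<And>v g. v \<in> V \<Longrightarrow> act g v \<in> V"
    and "\<And>v g. v \<in> V \<Longrightarrow> \<delta> (act g v) = act' g (\<delta> v)" "\<And>v. v \<in> V \<Longrightarrow> c' (\<delta> v) = c v"
    and "many_orbits V act c H x m"
  shows "many_orbits V act' c' H x m"
proof -
  obtain vs where vs: "length vs = m" "set vs \<subseteq> V" "\<forall>v\<in>set vs. stab act v = H \<and> c v = x"
    "\<forall>i<m. \<forall>j<m. i \<noteq> j \<longrightarrow> (\<forall>g. act g (vs ! i) \<noteq> vs ! j)"
    using assms(5) unfolding many_orbits_def by blast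
  have inj: "\<delta> u = \<delta> v \<longleftrightarrow> u = v" if "u \<in> V" "v \<in> V" for u v
    using assms(1) that by (auto simp: bij_betw_def inj_on_eq_iff)
  have eq: "act' g (\<delta> u) = \<delta> v \<longleftrightarrow> act g u = v" if "u \<in> V" "v \<in> V" for u v g
    using inj[of "act g u" v] assms(2)[of u g] that by (simp add: assms(3))
  have nth: "vs ! i \<in> V" if "i < m" for i using vs(1,2) that by auto
  show ?thesis
    unfolding many_orbits_def
  proof (intro exI[of _ "map \<delta> vs"] conjI allI impI ballI)
    show "length (map \<delta> vs) = m" using vs by simp
    show "set (map \<delta> vs) \<subseteq> V" using vs(2) assms(1) by (auto simp: bij_betw_def)
    fix w assume "w \<in> set (map \<delta> vs)"
    then obtain v where v: "v \<in> set vs" "w = \<delta> v" by auto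
    then have "v \<in> V" using vs(2) by blast
    then show "stab act' w = H" "c' w = x"
      using vs(3) v eq[of v v] assms(4)[of v] by (auto simp: stab_def)
  next
    fix i j g assume "i < m" "j < m" "i \<noteq> j"
    then show "act' g (map \<delta> vs ! i) \<noteq> map \<delta> vs ! j"
      using vs(1,4) eq[OF nth nth, of i j g] by simp
  qed
qed


section \<open>The two digraphs over the directed triangle\<close>

lemma int_subgroup_cyclic:
  fixes K :: "int set"
  assumes "0 \<in> K" and diff: "\<And>x y. x \<in> K \<Longrightarrow> y \<in> K \<Longrightarrow> x - y \<in> K"
  shows "\<exists>d\<in>K. \<forall>x. x \<in> K \<longleftrightarrow> d dvd x"
proof -
  have neg: "- x \<in> K" if "x \<in> K" for x using diff[OF assms(1) that] by simp
  have add: "x + y \<in> K" if "x \<in> K" "y \<in> K" for x y using diff[OF that(1) neg[OF that(2)]] by simp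
  have mult: "j * x \<in> K" if "x \<in> K" for j x
  proof (induction j rule: int_induct[where k = 0])
    case base
    show ?case using assms(1) by simp
  next
    case (step1 i)
    then show ?case using add[OF _ that, of "i * x"] by (simp add: algebra_simps)
  next
    case (step2 i)
    then show ?case using diff[OF _ that, of "i * x"] by (simp add: algebra_simps)
  qed
  show ?thesis
  proof (cases "K = {0}")
    case False
    then obtain x where x: "x \<in> K" "x \<noteq> 0" using assms(1) by blast
    have "\<bar>x\<bar> \<in> K" using x(1) neg[OF x(1)] by (simp add: abs_if)
    then have "int (nat \<bar>x\<bar>) \<in> K \<and> 0 < nat \<bar>x\<bar>" using x(2) by simp
    define n where "n = (LEAST n. int n \<in> K \<and> 0 < n)"
    have n: "int n \<in> K \<and> 0 < n" unfolding n_def by (rule LeastI) fact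
    have least: "n \<le> m" if "int m \<in> K" "0 < m" for m unfolding n_def by (rule Least_le) (use that in blast)
    have "int n dvd y" if "y \<in> K" for y
    proof -
      have "y - (y div int n) * int n \<in> K" using diff[OF that mult] n by blast
      then have "int (nat (y mod int n)) \<in> K" using n by (simp add: minus_div_mult_eq_mod)
      moreover have "nat (y mod int n) < n" using n by (simp add: nat_less_iff)
      ultimately have "nat (y mod int n) = 0" using least[of "nat (y mod int n)"] by linarith
      then show ?thesis using n by (auto simp: dvd_eq_mod_eq_0 intro: antisym)
    qed
    then show ?thesis using n mult[of "int n"] by (intro bexI[of _ "int n"]) (auto simp: dvd_def mult.commute)
  qed (auto intro!: bexI[of _ 0])
qed

text \<open>The lattice spanned by \<open>(a, b)\<close> and \<open>(0, d)\<close>, the triangular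
  normal form of a subgroup. It enumerates the possible stabilizers by a countable type.\<close>

definition int_lattice :: "int \<times> int \<times> int \<Rightarrow> (int \<times> int) set" where
  "int_lattice = (\<lambda>(a, b, d). {(k * a, k * b + j * d) |k j. True})"

text \<open>\<open>a\<close> generates the first projection of \<open>H\<close>, and
  \<open>d\<close> the part of \<open>H\<close> over 0; subtracting a multiple of
  \<open>(a, b)\<close> brings any element into that part.\<close>

lemma int_pair_subgroup_lattice:
  fixes H :: "(int \<times> int) set"
  assumes "0 \<in> H" and diff: "\<And>x y. x \<in> H \<Longrightarrow> y \<in> H \<Longrightarrow> x - y \<in> H"
  shows "H \<in> range int_lattice"
proof -
  have neg: "- x \<in> H" if "x \<in> H" for x using diff[OF assms(1) that] by simp
  have add: "x + y \<in> H" if "x \<in> H" "y \<in> H" for x y using diff[OF that(1) neg[OF that(2)]] by simp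
  have mult: "(k * a, k * b) \<in> H" if "(a, b) \<in> H" for a b k
  proof (induction k rule: int_induct[where k = 0])
    case base
    show ?case using assms(1) by (simp add: zero_prod_def)
  next
    case (step1 i)
    then show ?case using add[OF _ that, of "(i * a, i * b)"] by (simp add: algebra_simps)
  next
    case (step2 i)
    then show ?case using diff[OF _ that, of "(i * a, i * b)"] by (simp add: algebra_simps)
  qed
  have "\<exists>a\<in>fst ` H. \<forall>x. x \<in> fst ` H \<longleftrightarrow> a dvd x"
  proof (rule int_subgroup_cyclic)
    show "0 \<in> fst ` H" using assms(1) by (force simp: zero_prod_def)
    fix x y assume "x \<in> fst ` H" "y \<in> fst ` H"
    then obtain p q where "p \<in> H" "q \<in> H" "x = fst p" "y = fst q" by blast
    then show "x - y \<in> fst ` H" using diff[of p q] by (metis fst_diff image_eqI)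
  qed
  then obtain a b where ab: "(a, b) \<in> H" "\<And>x. x \<in> fst ` H \<Longrightarrow> a dvd x" by force
  have "\<exists>d\<in>{x. (0, x) \<in> H}. \<forall>x. x \<in> {x. (0, x) \<in> H} \<longleftrightarrow> d dvd x"
  proof (rule int_subgroup_cyclic)
    show "0 \<in> {x. (0, x) \<in> H}" using assms(1) by (simp add: zero_prod_def)
    show "x - y \<in> {x. (0, x) \<in> H}" if "x \<in> {x. (0, x) \<in> H}" "y \<in> {x. (0, x) \<in> H}" for x y
      using that diff[of "(0, x)" "(0, y)"] by simp
  qed
  then obtain d where d: "(0, d) \<in> H" "\<And>x. (0, x) \<in> H \<Longrightarrow> d dvd x" by blast
  have "H = int_lattice (a, b, d)"
  proof (intro equalityI subsetI)
    fix p assume p: "p \<in> H"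
    then have "a dvd fst p" using ab(2) by blast
    then obtain k where k: "fst p = k * a" by (metis dvd_def mult.commute)
    have "p - (k * a, k * b) \<in> H" by (rule diff[OF p mult[OF ab(1)]])
    then have "(0, snd p - k * b) \<in> H" using k by (cases p) simp
    then obtain j where "snd p - k * b = j * d" using d(2) by (metis dvd_def mult.commute)
    then have "p = (k * a, k * b + j * d)" using k by (cases p) simp
    then show "p \<in> int_lattice (a, b, d)" by (auto simp: int_lattice_def)
  next
    fix p assume "p \<in> int_lattice (a, b, d)"
    then obtain k j where p: "p = (k * a, k * b + j * d)" by (auto simp: int_lattice_def)
    show "p \<in> H" using add[OF mult[OF ab(1), of k] mult[OF d(1), of j]] by (simp add: p)
  qed
  then show ?thesis by blast
qed

lemma (in labelled_action) stab_diff: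
  assumes "v \<in> V" shows "0 \<in> stab act v" "g \<in> stab act v \<Longrightarrow> h \<in> stab act v \<Longrightarrow> g - h \<in> stab act v"
proof -
  show "0 \<in> stab act v" using act_0[OF assms] by (simp add: stab_def)
  show "g - h \<in> stab act v" if "g \<in> stab act v" "h \<in> stab act v"
    using that by (simp flip: act_eq_iff[OF assms]) (simp add: stab_def)
qed

lemma stab_lattice:
  fixes act :: "int \<times> int \<Rightarrow> 'a \<Rightarrow> 'a"
  assumes "labelled_action V act c F" "v \<in> V"
  shows "stab act v \<in> range int_lattice"
proof -
  interpret labelled_action V act c F by fact
  show ?thesis using stab_diff[OF assms(2)] by (intro int_pair_subgroup_lattice)
qed

section \<open>Integer powers of an automorphism\<close>

definition aut_pow :: "'a digraph \<Rightarrow> ('a \<Rightarrow> 'a) \<Rightarrow> int \<Rightarrow> 'a \<Rightarrow> 'a" where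
  "aut_pow G \<phi> k = \<phi> [^]\<^bsub>aut_group G\<^esub> k"

lemma aut_pow_automorphism: "\<phi> \<in> automorphisms G \<Longrightarrow> aut_pow G \<phi> k \<in> automorphisms G"
  unfolding aut_pow_def using group.int_pow_closed[OF group_aut_group, of \<phi> G k] by simp

lemma aut_pow_0: "v \<in> verts G \<Longrightarrow> aut_pow G \<phi> 0 v = v"
  by (simp add: aut_pow_def) (simp add: aut_group_def BijGroup_def)

lemma aut_pow_1: "\<phi> \<in> automorphisms G \<Longrightarrow> aut_pow G \<phi> 1 = \<phi>"
  unfolding aut_pow_def using group.int_pow_1[OF group_aut_group, of \<phi> G] by simp

lemma aut_pow_add:
  assumes "\<phi> \<in> automorphisms G" "v \<in> verts G"
  shows "aut_pow G \<phi> (k + l) v = aut_pow G \<phi> k (aut_pow G \<phi> l v)"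
proof -
  have "aut_pow G \<phi> (k + l) = aut_pow G \<phi> k \<otimes>\<^bsub>aut_group G\<^esub> aut_pow G \<phi> l"
    unfolding aut_pow_def using group.int_pow_mult[OF group_aut_group, of \<phi> G k l] assms(1) by simp
  then show ?thesis using automorphism_mult[OF aut_pow_automorphism aut_pow_automorphism] assms by simp
qed

lemma aut_pow_minus:
  assumes "\<phi> \<in> automorphisms G" "v \<in> verts G"
  shows "aut_pow G \<phi> (- k) (aut_pow G \<phi> k v) = v"
  using aut_pow_add[OF assms, of "- k" k] aut_pow_0[OF assms(2)] by simp

lemma aut_pow_intertwine:
  assumes "\<phi> \<in> automorphisms G" "\<psi> \<in> automorphisms G"
    and \<delta>: "\<And>v. v \<in> verts G \<Longrightarrow> \<delta> v \<in> verts G" "\<And>v. v \<in> verts G \<Longrightarrow> \<delta> (\<phi> v) = \<psi> (\<delta> v)" and v: "v \<in> verts G"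
  shows "\<delta> (aut_pow G \<phi> k v) = aut_pow G \<psi> k (\<delta> v)"
proof -
  have nat: "\<delta> (aut_pow G \<phi> (int n) v) = aut_pow G \<psi> (int n) (\<delta> v)" if "v \<in> verts G" for n v
  proof (induction n)
    case 0
    show ?case by (simp add: aut_pow_0 \<delta>(1) that)
  next
    case (Suc n)
    have "\<delta> (aut_pow G \<phi> (1 + int n) v) = \<psi> (\<delta> (aut_pow G \<phi> (int n) v))"
      using aut_pow_add[OF assms(1) that, of 1 "int n"] \<delta>(2) that
        automorphism_mem[OF aut_pow_automorphism[OF assms(1)] that]
      by (simp add: aut_pow_1[OF assms(1)])
    also have "\<dots> = aut_pow G \<psi> (1 + int n) (\<delta> v)"
      using aut_pow_add[OF assms(2) \<delta>(1)[OF that], of 1 "int n"] Suc by (simp add: aut_pow_1[OF assms(2)])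
    finally show ?case by simp
  qed
  show ?thesis
  proof (cases "0 \<le> k")
    case True
    then show ?thesis using nat[OF v, of "nat k"] by simp
  next
    case False
    \<comment> \<open>A negative power is reduced to the opposite positive power, applied at its
      result \<open>u\<close>.\<close>
    define u where "u = aut_pow G \<phi> k v"
    have u: "u \<in> verts G" unfolding u_def using automorphism_mem[OF aut_pow_automorphism[OF assms(1)] v] .
    have "aut_pow G \<phi> (- k) u = v" unfolding u_def by (rule aut_pow_minus[OF assms(1) v])
    then have "\<delta> v = aut_pow G \<psi> (- k) (\<delta> u)" using nat[OF u, of "nat (- k)"] False by simp
    then have "aut_pow G \<psi> k (\<delta> v) = \<delta> u" using aut_pow_minus[OF assms(2) \<delta>(1)[OF u], of "- k"] by simp
    then show ?thesis by (simp add: u_def)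
  qed
qed

lemma pred_aut_eval:
  assumes "v \<in> verts G"
  shows "Measurable.pred (borel_of (aut_topology G)) (\<lambda>\<phi>. P (\<phi> v))"
  unfolding pred_def
proof -
  show "{\<phi> \<in> space (borel_of (aut_topology G)). P (\<phi> v)} \<in> sets (borel_of (aut_topology G))"
    using openin_aut_topology_eval[OF assms, of P] by (simp add: sets_borel_of sigma_sets.Basic)
qed

text \<open>A power is a chain of evaluations through countably many possible intermediate vertices;
  for a negative exponent \<open>v\<close> and \<open>w\<close> change places.\<close>

lemma pred_aut_pow:
  fixes G :: "'a :: countable digraph"
  assumes "v \<in> verts G"
  shows "Measurable.pred (borel_of (aut_topology G)) (\<lambda>\<phi>. aut_pow G \<phi> k v = w)"
proof -
  let ?M = "borel_of (aut_topology G)"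
  have nat: "Measurable.pred ?M (\<lambda>\<phi>. aut_pow G \<phi> (int n) v = w)" if "v \<in> verts G" for n v w
    using that
  proof (induction n arbitrary: v)
    case 0
    then show ?case by (simp add: aut_pow_0)
  next
    case (Suc n)
    have "Measurable.pred ?M (\<lambda>\<phi>. \<phi> v = u \<and> u \<in> verts G \<and> aut_pow G \<phi> (int n) u = w)" for u
    proof (cases "u \<in> verts G")
      case True
      note Suc.IH[OF True, measurable] pred_aut_eval[OF Suc.prems, of "\<lambda>x. x = u", measurable]
      show ?thesis by measurable
    qed simp
    then have "Measurable.pred ?M (\<lambda>\<phi>. \<exists>u. \<phi> v = u \<and> u \<in> verts G \<and> aut_pow G \<phi> (int n) u = w)"
      by (rule pred_intros_countable)
    moreover have "(\<exists>u. \<phi> v = u \<and> u \<in> verts G \<and> aut_pow G \<phi> (int n) u = w) \<longleftrightarrow>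
        aut_pow G \<phi> (int (Suc n)) v = w" if "\<phi> \<in> space ?M" for \<phi>
    proof -
      have "\<phi> \<in> automorphisms G" using that by (simp add: topspace_aut_topology)
      then show ?thesis
        using aut_pow_add[of \<phi> G v "int n" 1] Suc.prems automorphism_mem[of \<phi> G v]
        by (simp add: aut_pow_1 add.commute)
    qed
    ultimately show ?case by (subst measurable_cong) (auto intro: sym)
  qed
  show ?thesis
  proof (cases "0 \<le> k")
    case True
    then show ?thesis using nat[OF assms, of "nat k"] by simp
  next
    case False
    have "Measurable.pred ?M (\<lambda>\<phi>. w \<in> verts G \<and> aut_pow G \<phi> (int (nat (- k))) w = v)"
    proof (cases "w \<in> verts G")
      case True
      then show ?thesis using nat[OF True, of "nat (- k)" v] by simp
    qed simp
    moreover have "(w \<in> verts G \<and> aut_pow G \<phi> (int (nat (- k))) w = v) \<longleftrightarrow> aut_pow G \<phi> k v = w"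
      if "\<phi> \<in> space ?M" for \<phi>
    proof -
      have a: "\<phi> \<in> automorphisms G" using that by (simp add: topspace_aut_topology)
      show ?thesis
        using False aut_pow_minus[OF a, of w "- k"] aut_pow_minus[OF a assms, of k]
          automorphism_mem[OF aut_pow_automorphism[OF a] assms] by auto
    qed
    ultimately show ?thesis by (subst measurable_cong) (auto intro: sym)
  qed
qed

lemma pred_many_orbits:
  fixes act :: "'m \<Rightarrow> 'g :: countable \<Rightarrow> 'a :: countable \<Rightarrow> 'a"
  assumes "\<And>g v w. v \<in> V \<Longrightarrow> Measurable.pred M (\<lambda>\<phi>. act \<phi> g v = w)"
  shows "Measurable.pred M (\<lambda>\<phi>. many_orbits V (act \<phi>) c H x m)"
  unfolding many_orbits_def
proof (intro pred_intros_countable(2) pred_intros_conj1' pred_intros_logic(3))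
  fix vs :: "'a list" assume vs: "length vs = m" "set vs \<subseteq> V"
  show "Measurable.pred M (\<lambda>\<phi>. \<forall>v\<in>set vs. stab (act \<phi>) v = H \<and> c v = x)"
  proof (intro pred_intros_finite(3) pred_intros_conj2')
    fix v assume "v \<in> set vs"
    then have "v \<in> V" using vs(2) by blast
    note assms[OF this, measurable]
    have "Measurable.pred M (\<lambda>\<phi>. \<forall>g. act \<phi> g v = v \<longleftrightarrow> g \<in> H)" by measurable
    then show "Measurable.pred M (\<lambda>\<phi>. stab (act \<phi>) v = H)" by (simp add: stab_def set_eq_iff)
  qed simp
  have "vs ! i \<in> V" if "i < m" for i using vs that by auto
  then show "Measurable.pred M (\<lambda>\<phi>. \<forall>i<m. \<forall>j<m. i \<noteq> j \<longrightarrow> (\<forall>g. act \<phi> g (vs ! i) \<noteq> vs ! j))"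
    by (intro pred_intros_countable(1) pred_intros_imp' pred_intros_logic(2) assms)
qed

section \<open>The directed triangle and its disjoint copies\<close>

lemma C3_edge: "(a, b) \<in> edges C3 \<longleftrightarrow> a < 3 \<and> b = Suc a mod 3"
proof -
  have "a < 3 \<longleftrightarrow> a = 0 \<or> a = 1 \<or> a = 2" by linarith
  then show ?thesis unfolding C3_def by auto
qed

lemma C3_verts: "verts C3 = {..<3}"
  by (auto simp: C3_def)

lemma conjugacy_sym:
  assumes "(\<phi>, \<psi>) \<in> conjugacy (aut_group G)" shows "(\<psi>, \<phi>) \<in> conjugacy (aut_group G)"
proof -
  obtain \<delta> where a: "\<phi> \<in> automorphisms G" "\<psi> \<in> automorphisms G" and \<delta>: "\<delta> \<in> automorphisms G"
      "\<forall>v\<in>verts G. \<delta> (\<phi> v) = \<psi> (\<delta> v)"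
    using assms by (auto simp: conjugacy_aut_iff)
  define \<epsilon> where "\<epsilon> = aut_pow G \<delta> (- 1)"
  have \<epsilon>: "\<epsilon> \<in> automorphisms G" unfolding \<epsilon>_def by (rule aut_pow_automorphism[OF \<delta>(1)])
  have \<epsilon>\<delta>: "\<epsilon> (\<delta> v) = v" and \<delta>\<epsilon>: "\<delta> (\<epsilon> v) = v" if "v \<in> verts G" for v
    using aut_pow_minus[OF \<delta>(1) that, of 1] aut_pow_minus[OF \<delta>(1) that, of "- 1"]
    by (simp_all add: \<epsilon>_def aut_pow_1[OF \<delta>(1)])
  have "\<epsilon> (\<psi> v) = \<phi> (\<epsilon> v)" if v: "v \<in> verts G" for v
  proof -
    have "\<delta> (\<phi> (\<epsilon> v)) = \<psi> v" using \<delta>(2) automorphism_mem[OF \<epsilon> v] \<delta>\<epsilon>[OF v] by simp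
    then show ?thesis using \<epsilon>\<delta>[of "\<phi> (\<epsilon> v)"] automorphism_mem[OF a(1) automorphism_mem[OF \<epsilon> v]] by simp
  qed
  then show ?thesis using a \<epsilon> by (auto simp: conjugacy_aut_iff)
qed

text \<open>The edges of the disjoint union are the pairs \<open>(v, rot 1 v)\<close>, so its automorphisms are the
  permutations that commute with \<open>rot 1\<close>.\<close>

definition rot :: "int \<Rightarrow> nat \<times> nat \<Rightarrow> nat \<times> nat" where
  "rot j = (\<lambda>(i, a). (i, nat ((int a + j) mod 3)))"

abbreviation C3_copies :: "(nat \<times> nat) digraph" where
  "C3_copies \<equiv> copies \<infinity> C3"

lemma verts_C3_copies: "verts C3_copies = UNIV \<times> {..<3}"
  by (simp add: copies_def C3_verts)

lemma rot_mem: "v \<in> verts C3_copies \<Longrightarrow> rot j v \<in> verts C3_copies"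
  by (auto simp: verts_C3_copies rot_def nat_less_iff split: prod.splits)

lemma rot_add: "rot (j + k) v = rot j (rot k v)"
  by (simp add: rot_def mod_simps ac_simps split: prod.splits)

lemma rot_0: "v \<in> verts C3_copies \<Longrightarrow> rot 0 v = v"
  by (auto simp: verts_C3_copies rot_def)

lemma edge_C3_copies:
  assumes "u \<in> verts C3_copies" "v \<in> verts C3_copies"
  shows "(u, v) \<in> edges C3_copies \<longleftrightarrow> v = rot 1 u"
proof -
  have "nat ((int a + 1) mod 3) = Suc a mod 3" for a
    by (simp add: nat_mod_distrib nat_add_distrib)
  then show ?thesis using assms by (auto simp: copies_def C3_edge C3_verts verts_C3_copies rot_def)
qed

lemma automorphism_rot:
  assumes "\<phi> \<in> automorphisms C3_copies" "v \<in> verts C3_copies"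
  shows "\<phi> (rot j v) = rot j (\<phi> v)"
proof -
  have one: "\<phi> (rot 1 v) = rot 1 (\<phi> v)" if "v \<in> verts C3_copies" for v
    using automorphism_edge[OF assms(1) that rot_mem[OF that, of 1]] that
    by (simp add: edge_C3_copies rot_mem automorphism_mem[OF assms(1)])
  have nat: "\<phi> (rot (int n) v) = rot (int n) (\<phi> v)" for n
  proof (induction n)
    case 0
    then show ?case using assms by (simp add: rot_0 automorphism_mem)
  next
    case (Suc n)
    have "\<phi> (rot (1 + int n) v) = rot (1 + int n) (\<phi> v)"
      using one[OF rot_mem[OF assms(2), of "int n"]] Suc by (simp add: rot_add)
    then show ?case by simp
  qed
  \<comment> \<open>\<open>rot\<close> depends on \<open>j\<close> only modulo 3, so nonnegative
    \<open>j\<close> suffice.\<close>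
  have eq: "rot (int (nat (j mod 3))) = rot j" by (simp add: rot_def fun_eq_iff mod_simps)
  show ?thesis using nat[of "nat (j mod 3)"] unfolding eq .
qed

definition copies_act :: "(nat \<times> nat \<Rightarrow> nat \<times> nat) \<Rightarrow> int \<times> int \<Rightarrow> nat \<times> nat \<Rightarrow> nat \<times> nat" where
  "copies_act \<phi> g v = aut_pow C3_copies \<phi> (fst g) (rot (snd g) v)"

lemma copies_labelled_action:
  assumes "\<phi> \<in> automorphisms C3_copies"
  shows "labelled_action (verts C3_copies) (copies_act \<phi>) (\<lambda>_. ()) (\<lambda>_ _. ())"
proof
  fix v :: "nat \<times> nat" assume v: "v \<in> verts C3_copies"
  show "copies_act \<phi> g v \<in> verts C3_copies" for g
    unfolding copies_act_def by (intro automorphism_mem[OF aut_pow_automorphism] assms rot_mem v)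
  show "copies_act \<phi> 0 v = v" using v by (simp add: copies_act_def rot_0 aut_pow_0)
  show "copies_act \<phi> (g + h) v = copies_act \<phi> g (copies_act \<phi> h v)" for g h
    using v assms
    by (simp add: copies_act_def rot_add rot_mem aut_pow_add automorphism_rot[OF aut_pow_automorphism])
qed (auto simp: countableI_type)

text \<open>A bijection that respects both factors of the action commutes with \<open>rot 1\<close>,
  so it is an automorphism, and it intertwines the given automorphisms. All points have the same
  label, and there is no ambiguity, so the index set is a singleton.\<close>

lemma conjugacy_smooth_copies_C3: "conjugacy_smooth C3_copies"
  unfolding conjugacy_smooth_def
proof (rule smooth_finite_ambiguity[where S = "{()}" and ?s0.0 = "()"])
  let ?V = "verts C3_copies" and ?M = "borel_of (aut_topology C3_copies)"
  let ?b = "\<lambda>(_::unit) n \<phi>. case from_nat n of (l, m) \<Rightarrow>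
      many_orbits ?V (copies_act \<phi>) (\<lambda>_. ()) (int_lattice l) () m"
  show "Measurable.pred ?M (?b s n)" for s n
  proof (cases "from_nat n :: (int \<times> int \<times> int) \<times> nat")
    case (Pair l m)
    show ?thesis
      unfolding Pair prod.case
      by (rule pred_many_orbits) (simp add: copies_act_def pred_aut_pow rot_mem)
  qed
  show "(y, x) \<in> conjugacy (aut_group C3_copies)" if "(x, y) \<in> conjugacy (aut_group C3_copies)" for x y
    by (rule conjugacy_sym[OF that])
  have transport: "many_orbits ?V (copies_act y) (\<lambda>_. ()) H () m"
    if xy: "(x, y) \<in> conjugacy (aut_group C3_copies)"
      and many: "many_orbits ?V (copies_act x) (\<lambda>_. ()) H () m" for x y H m
  proof -
    obtain \<delta> where a: "x \<in> automorphisms C3_copies" "y \<in> automorphisms C3_copies"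
      and \<delta>: "\<delta> \<in> automorphisms C3_copies" "\<forall>v\<in>?V. \<delta> (x v) = y (\<delta> v)"
      using xy by (auto simp: conjugacy_aut_iff)
    interpret labelled_action ?V "copies_act x" "\<lambda>_. ()" "\<lambda>_ _. ()" by (rule copies_labelled_action[OF a(1)])
    show ?thesis
    proof (rule many_orbits_transport[OF automorphism_bij[OF \<delta>(1)] closed _ _ many])
      fix v g assume v: "v \<in> ?V"
      show "\<delta> (copies_act x g v) = copies_act y g (\<delta> v)"
        using aut_pow_intertwine[OF a, of \<delta>] \<delta> v
        by (simp add: copies_act_def rot_mem automorphism_mem[OF \<delta>(1)] automorphism_rot[OF \<delta>(1)])
    qed auto
  qed
  show "\<exists>t\<in>{()}. \<forall>n. ?b s n x = ?b t n y" if "(x, y) \<in> conjugacy (aut_group C3_copies)" for x y s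
    using transport[OF that] transport[OF conjugacy_sym[OF that]] by (auto split: prod.splits)
  fix x y t assume x: "x \<in> space ?M" and y: "y \<in> space ?M" and eq: "\<forall>n. ?b () n x = ?b t n y"
  have a: "x \<in> automorphisms C3_copies" "y \<in> automorphisms C3_copies" using x y by (simp_all add: topspace_aut_topology)
  have "\<exists>\<delta>. bij_betw \<delta> ?V ?V \<and> (\<forall>v\<in>?V. () = () \<and> (\<forall>g. \<delta> (copies_act x g v) = copies_act y g (\<delta> v)))"
  proof (rule labelled_action_iso[OF copies_labelled_action[OF a(1)] copies_labelled_action[OF a(2)]])
    fix H u m assume "H \<in> stab (copies_act x) ` ?V \<union> stab (copies_act y) ` ?V"
    then have "H \<in> range int_lattice"
      using stab_lattice[OF copies_labelled_action[OF a(1)]] stab_lattice[OF copies_labelled_action[OF a(2)]]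
      by blast
    then obtain l where "H = int_lattice l" by blast
    then show "many_orbits ?V (copies_act x) (\<lambda>_. ()) H u m \<longleftrightarrow> many_orbits ?V (copies_act y) (\<lambda>_. ()) H u m"
      using eq[rule_format, of "to_nat (l, m)"] by simp
  qed
  then obtain \<delta> where \<delta>: "bij_betw \<delta> ?V ?V" "\<And>v g. v \<in> ?V \<Longrightarrow> \<delta> (copies_act x g v) = copies_act y g (\<delta> v)"
    by blast
  have mem: "\<delta> v \<in> ?V" if "v \<in> ?V" for v using \<delta>(1) that by (auto simp: bij_betw_def)
  \<comment> \<open>The group element \<open>(0, 1)\<close> acts as the rotation, and
    \<open>(1, 0)\<close> below acts as the given automorphism.\<close>
  have rot: "\<delta> (rot 1 v) = rot 1 (\<delta> v)" if "v \<in> ?V" for v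
    using \<delta>(2)[OF that, of "(0, 1)"] that mem[OF that] by (simp add: copies_act_def aut_pow_0 rot_mem)
  have "restrict \<delta> ?V \<in> automorphisms C3_copies"
  proof (rule restrict_automorphism[OF \<delta>(1)])
    fix u v assume uv: "u \<in> ?V" "v \<in> ?V"
    have "\<delta> v = \<delta> (rot 1 u) \<longleftrightarrow> v = rot 1 u"
      using \<delta>(1) uv(2) rot_mem[OF uv(1), of 1] by (auto simp: bij_betw_def inj_on_eq_iff)
    then show "(\<delta> u, \<delta> v) \<in> edges C3_copies \<longleftrightarrow> (u, v) \<in> edges C3_copies"
      using uv mem rot by (simp add: edge_C3_copies)
  qed
  moreover have "\<delta> (x v) = y (\<delta> v)" if "v \<in> ?V" for v
    using \<delta>(2)[OF that, of "(1, 0)"] that mem[OF that] a by (simp add: copies_act_def aut_pow_1 rot_0)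
  ultimately show "(x, y) \<in> conjugacy (aut_group C3_copies)"
    using a automorphism_mem[OF a(1)]
    by (auto simp: conjugacy_aut_iff intro!: bexI[of _ "restrict \<delta> ?V"])
qed auto

section \<open>The blown-up triangle\<close>

abbreviation C3_blowup :: "(nat \<times> nat) digraph" where
  "C3_blowup \<equiv> blowup C3 \<infinity>"

lemma verts_C3_blowup: "verts C3_blowup = {..<3} \<times> UNIV"
  by (simp add: blowup_def C3_verts)

lemma edge_C3_blowup:
  assumes "u \<in> verts C3_blowup" "v \<in> verts C3_blowup"
  shows "(u, v) \<in> edges C3_blowup \<longleftrightarrow> int (fst v) = (int (fst u) + 1) mod 3"
proof -
  have "b = Suc a mod 3 \<longleftrightarrow> int b = (int a + 1) mod 3" for a b
  proof -
    have "int (Suc a mod 3) = (int a + 1) mod 3" by (simp add: zmod_int add.commute)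
    then show ?thesis by (metis of_nat_eq_iff)
  qed
  then show ?thesis using assms by (cases u; cases v) (simp add: blowup_def C3_edge C3_verts)
qed

text \<open>The rotation of the three parts, read off at one vertex.\<close>

definition turn :: "(nat \<times> nat \<Rightarrow> nat \<times> nat) \<Rightarrow> int" where
  "turn \<phi> = int (fst (\<phi> (0, 0)))"

text \<open>The out-neighbours of a vertex are exactly the next part, so the image of one vertex in
  each part determines where all other vertices go.\<close>

lemma automorphism_turn:
  assumes \<phi>: "\<phi> \<in> automorphisms C3_blowup" and v: "v \<in> verts C3_blowup"
  shows "int (fst (\<phi> v)) = (int (fst v) + turn \<phi>) mod 3"
proof -
  let ?f = "\<lambda>v. int (fst (\<phi> v))"
  have lt: "0 \<le> int (fst v) \<and> int (fst v) < 3" if "v \<in> verts C3_blowup" for v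
    using that by (auto simp: verts_C3_blowup)
  have step: "?f u = (?f w + 1) mod 3" if "w \<in> verts C3_blowup" "u \<in> verts C3_blowup"
    "int (fst u) = (int (fst w) + 1) mod 3" for u w
    using automorphism_edge[OF \<phi> that(1,2)] that
    by (simp add: edge_C3_blowup automorphism_mem[OF \<phi>])
  have V: "(0, 0) \<in> verts C3_blowup" "(1, 0) \<in> verts C3_blowup" "(2, 0) \<in> verts C3_blowup"
    by (auto simp: verts_C3_blowup)
  have f1: "?f (1, 0) = (turn \<phi> + 1) mod 3" using step[OF V(1,2)] by (simp add: turn_def)
  have f2: "?f (2, 0) = (turn \<phi> + 2) mod 3" using step[OF V(2,3)] f1 by (simp add: mod_simps ac_simps)
  have f0: "turn \<phi> mod 3 = turn \<phi>"
    using lt[OF automorphism_mem[OF \<phi> V(1)]] by (simp add: turn_def)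
  consider "fst v = 0" | "fst v = 1" | "fst v = 2" using v by (force simp: verts_C3_blowup)
  then show ?thesis
  proof cases
    case 1
    \<comment> \<open>Going once around from part 2 reaches all of part 0, not only
      \<open>(0, 0)\<close>.\<close>
    then have "?f v = (?f (2, 0) + 1) mod 3" using step[OF V(3) v] by simp
    then show ?thesis using 1 f2 f0 by (simp add: mod_simps ac_simps)
  next
    case 2
    then have "?f v = (?f (0, 0) + 1) mod 3" using step[OF V(1) v] by simp
    then show ?thesis using 2 by (simp add: turn_def ac_simps)
  next
    case 3
    then have "?f v = (?f (1, 0) + 1) mod 3" using step[OF V(2) v] by simp
    then show ?thesis using 3 f1 by (simp add: mod_simps ac_simps)
  qed
qed

text \<open>Here the group acts through its first factor; the second one only makes the count of
  stabilizers from the previous case applicable.\<close>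

definition blowup_act :: "(nat \<times> nat \<Rightarrow> nat \<times> nat) \<Rightarrow> int \<times> int \<Rightarrow> nat \<times> nat \<Rightarrow> nat \<times> nat" where
  "blowup_act \<phi> g = aut_pow C3_blowup \<phi> (fst g)"

text \<open>Parts are renumbered with part \<open>s\<close> as 0, so that a conjugator with turn
  \<open>t\<close> matches \<open>part 0\<close> with \<open>part t\<close>.\<close>

definition part :: "int \<Rightarrow> nat \<times> nat \<Rightarrow> int" where
  "part s v = (int (fst v) - s) mod 3"

lemma aut_pow_part:
  assumes \<phi>: "\<phi> \<in> automorphisms C3_blowup" and v: "v \<in> verts C3_blowup"
  shows "part s (aut_pow C3_blowup \<phi> k v) = (part s v + k * turn \<phi>) mod 3"
proof -
  have step: "part s (\<phi> v) = (part s v + turn \<phi>) mod 3" if "v \<in> verts C3_blowup" for v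
    using automorphism_turn[OF \<phi> that] by (simp add: part_def mod_simps algebra_simps)
  have nat: "part s (aut_pow C3_blowup \<phi> (int n) v) = (part s v + int n * turn \<phi>) mod 3"
    if v: "v \<in> verts C3_blowup" for n v
  proof (induction n)
    case 0
    then show ?case using v by (simp add: aut_pow_0 part_def)
  next
    case (Suc n)
    have "part s (aut_pow C3_blowup \<phi> (1 + int n) v) =
        (part s (aut_pow C3_blowup \<phi> (int n) v) + turn \<phi>) mod 3"
      using aut_pow_add[OF \<phi> v, of 1 "int n"] step automorphism_mem[OF aut_pow_automorphism[OF \<phi>] v]
      by (simp add: aut_pow_1[OF \<phi>])
    then show ?case using Suc by (simp add: mod_simps algebra_simps)
  qed
  show ?thesis
  proof (cases "0 \<le> k")
    case True
    then show ?thesis using nat[OF v, of "nat k"] by simp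
  next
    case False
    define u where "u = aut_pow C3_blowup \<phi> k v"
    have u: "u \<in> verts C3_blowup" unfolding u_def using automorphism_mem[OF aut_pow_automorphism[OF \<phi>] v] .
    have "aut_pow C3_blowup \<phi> (- k) u = v" unfolding u_def by (rule aut_pow_minus[OF \<phi> v])
    then have "part s v = (part s u + (- k) * turn \<phi>) mod 3" using nat[OF u, of "nat (- k)"] False by simp
    then have "(part s v + k * turn \<phi>) mod 3 = part s u mod 3" by (simp add: mod_simps)
    then show ?thesis by (simp add: u_def part_def)
  qed
qed

lemma blowup_labelled_action:
  assumes "\<phi> \<in> automorphisms C3_blowup"
  shows "labelled_action (verts C3_blowup) (blowup_act \<phi>) (part s) (\<lambda>g x. (x + fst g * turn \<phi>) mod 3)"
proof
  fix v :: "nat \<times> nat" assume v: "v \<in> verts C3_blowup"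
  show "blowup_act \<phi> g v \<in> verts C3_blowup" for g
    unfolding blowup_act_def by (intro automorphism_mem[OF aut_pow_automorphism] assms v)
  show "blowup_act \<phi> 0 v = v" using v by (simp add: blowup_act_def aut_pow_0)
  show "blowup_act \<phi> (g + h) v = blowup_act \<phi> g (blowup_act \<phi> h v)" for g h
    using v assms by (simp add: blowup_act_def aut_pow_add)
  show "part s (blowup_act \<phi> g v) = (part s v + fst g * turn \<phi>) mod 3" for g
    unfolding blowup_act_def by (rule aut_pow_part[OF assms v])
qed (auto simp: countableI_type)

text \<open>A conjugator may rotate the parts by any of three amounts, which is the finite
  ambiguity: the counts for \<open>part 0\<close> at one automorphism have to agree with those for
  \<open>part t\<close> at the other, for some \<open>t\<close>.\<close>

lemma conjugacy_smooth_blowup_C3: "conjugacy_smooth C3_blowup"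
  unfolding conjugacy_smooth_def
proof (rule smooth_finite_ambiguity[where S = "{0, 1, 2}" and ?s0.0 = 0])
  let ?V = "verts C3_blowup" and ?M = "borel_of (aut_topology C3_blowup)"
  \<comment> \<open>\<open>Inl\<close> records the turn, because the two actions must move labels in
    the same way; \<open>Inr\<close> records the counts.\<close>
  let ?b = "\<lambda>(s::int) n \<phi>. case from_nat n of
      Inl r \<Rightarrow> turn \<phi> = r
    | Inr (l, x, m) \<Rightarrow> many_orbits ?V (blowup_act \<phi>) (part s) (int_lattice l) x m"
  have V0: "(0, 0) \<in> ?V" by (simp add: verts_C3_blowup)
  show "Measurable.pred ?M (?b s n)" for s n
  proof (cases "from_nat n :: int + (int \<times> int \<times> int) \<times> int \<times> nat")
    case (Inl r)
    show ?thesis unfolding Inl sum.case turn_def by (rule pred_aut_eval[OF V0])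
  next
    case (Inr p)
    obtain l u m where p: "p = (l, u, m)" by (rule prod_cases3)
    show ?thesis
      unfolding Inr p sum.case prod.case
      by (rule pred_many_orbits) (simp add: blowup_act_def pred_aut_pow)
  qed
  show "(y, x) \<in> conjugacy (aut_group C3_blowup)" if "(x, y) \<in> conjugacy (aut_group C3_blowup)" for x y
    by (rule conjugacy_sym[OF that])
  have conj_turn: "turn y = turn x" "s \<in> {0, 1, 2} \<Longrightarrow> (s + turn \<delta>) mod 3 \<in> {0, 1, 2}"
      "v \<in> ?V \<Longrightarrow> part ((s + turn \<delta>) mod 3) (\<delta> v) = part s v"
      "v \<in> ?V \<Longrightarrow> \<delta> (blowup_act x g v) = blowup_act y g (\<delta> v)"
    if a: "x \<in> automorphisms C3_blowup" "y \<in> automorphisms C3_blowup"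
      and \<delta>: "\<delta> \<in> automorphisms C3_blowup" "\<forall>v\<in>?V. \<delta> (x v) = y (\<delta> v)" for x y \<delta> s v g
  proof -
    have lt: "turn f mod 3 = turn f" if "f \<in> automorphisms C3_blowup" for f
      using automorphism_mem[OF that V0] by (auto simp: turn_def verts_C3_blowup)
    \<comment> \<open>Rotations of the three parts commute, so the turn is invariant under
      conjugacy.\<close>
    have "(turn x + turn \<delta>) mod 3 = (turn \<delta> + turn y) mod 3"
      using automorphism_turn[OF \<delta>(1) automorphism_mem[OF a(1) V0]]
        automorphism_turn[OF a(2) automorphism_mem[OF \<delta>(1) V0]] \<delta>(2) V0 by (simp add: turn_def)
    then have "turn x mod 3 = turn y mod 3"
      by (metis add.commute mod_add_right_eq add_diff_cancel_left' mod_diff_left_eq)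
    then show "turn y = turn x" using lt a by simp
    have "0 \<le> (s + turn \<delta>) mod 3" "(s + turn \<delta>) mod 3 < 3" by simp_all
    then show "(s + turn \<delta>) mod 3 \<in> {0, 1, 2}" by (simp only: insert_iff) linarith
    show "part ((s + turn \<delta>) mod 3) (\<delta> v) = part s v" if "v \<in> ?V"
      using automorphism_turn[OF \<delta>(1) that] by (simp add: part_def mod_simps)
    show "\<delta> (blowup_act x g v) = blowup_act y g (\<delta> v)" if "v \<in> ?V"
      unfolding blowup_act_def
      by (rule aut_pow_intertwine[OF a _ _ that]) (use \<delta> automorphism_mem[OF \<delta>(1)] in auto)
  qed
  show "\<exists>t\<in>{0, 1, 2}. \<forall>n. ?b s n x = ?b t n y"
    if "(x, y) \<in> conjugacy (aut_group C3_blowup)" "s \<in> {0, 1, 2}" for x y s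
  proof -
    obtain \<delta> where a: "x \<in> automorphisms C3_blowup" "y \<in> automorphisms C3_blowup"
      and \<delta>: "\<delta> \<in> automorphisms C3_blowup" "\<forall>v\<in>?V. \<delta> (x v) = y (\<delta> v)"
      using \<open>(x, y) \<in> _\<close> by (auto simp: conjugacy_aut_iff)
    note ct = conj_turn[OF a \<delta>]
    let ?t = "(s + turn \<delta>) mod 3"
    let ?\<epsilon> = "inv_into ?V \<delta>"
    have bij: "bij_betw \<delta> ?V ?V" by (rule automorphism_bij[OF \<delta>(1)])
    have \<epsilon>: "bij_betw ?\<epsilon> ?V ?V" by (rule bij_betw_inv_into[OF bij])
    have \<epsilon>V: "?\<epsilon> v \<in> ?V" if "v \<in> ?V" for v using \<epsilon> that by (auto simp: bij_betw_def)
    have \<delta>\<epsilon>: "\<delta> (?\<epsilon> v) = v" if "v \<in> ?V" for v by (rule bij_betw_inv_into_right[OF bij that])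
    have \<epsilon>\<delta>: "?\<epsilon> (\<delta> v) = v" if "v \<in> ?V" for v by (rule bij_betw_inv_into_left[OF bij that])
    interpret X: labelled_action ?V "blowup_act x" "part s" "\<lambda>g u. (u + fst g * turn x) mod 3"
      by (rule blowup_labelled_action[OF a(1)])
    interpret Y: labelled_action ?V "blowup_act y" "part s" "\<lambda>g u. (u + fst g * turn y) mod 3"
      by (rule blowup_labelled_action[OF a(2)])
    have "many_orbits ?V (blowup_act x) (part s) H u m \<longleftrightarrow> many_orbits ?V (blowup_act y) (part ?t) H u m" for H u m
    proof
      show "many_orbits ?V (blowup_act y) (part ?t) H u m" if "many_orbits ?V (blowup_act x) (part s) H u m"
        by (rule many_orbits_transport[OF bij X.closed ct(4) ct(3) that])
      show "many_orbits ?V (blowup_act x) (part s) H u m" if "many_orbits ?V (blowup_act y) (part ?t) H u m"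
      proof (rule many_orbits_transport[OF \<epsilon> Y.closed _ _ that])
        fix v g assume v: "v \<in> ?V"
        have "blowup_act y g v = \<delta> (blowup_act x g (?\<epsilon> v))" using ct(4)[OF \<epsilon>V[OF v]] \<delta>\<epsilon>[OF v] by simp
        then show "?\<epsilon> (blowup_act y g v) = blowup_act x g (?\<epsilon> v)" using \<epsilon>\<delta>[OF X.closed[OF \<epsilon>V[OF v]]] by simp
        show "part s (?\<epsilon> v) = part ?t v" using ct(3)[OF \<epsilon>V[OF v]] \<delta>\<epsilon>[OF v] by simp
      qed
    qed
    then show ?thesis using ct(1) ct(2)[OF \<open>s \<in> _\<close>]
      by (intro bexI[of _ ?t]) (auto split: prod.splits sum.splits)
  qed
  fix x y t assume x: "x \<in> space ?M" and y: "y \<in> space ?M" and eq: "\<forall>n. ?b 0 n x = ?b t n y"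
  have a: "x \<in> automorphisms C3_blowup" "y \<in> automorphisms C3_blowup" using x y by (simp_all add: topspace_aut_topology)
  have turn: "turn y = turn x" using eq[rule_format, of "to_nat (Inl (turn x) :: _ + (int \<times> int \<times> int) \<times> int \<times> nat)"] by simp
  note act_x = blowup_labelled_action[OF a(1), of 0]
  note act_y = blowup_labelled_action[OF a(2), of t, unfolded turn]
  have "\<exists>\<delta>. bij_betw \<delta> ?V ?V \<and>
      (\<forall>v\<in>?V. part t (\<delta> v) = part 0 v \<and> (\<forall>g. \<delta> (blowup_act x g v) = blowup_act y g (\<delta> v)))"
  proof (rule labelled_action_iso[OF act_x act_y])
    fix H u m assume "H \<in> stab (blowup_act x) ` ?V \<union> stab (blowup_act y) ` ?V"
    then have "H \<in> range int_lattice" using stab_lattice[OF act_x] stab_lattice[OF act_y] by blast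
    then obtain l where "H = int_lattice l" by blast
    then show "many_orbits ?V (blowup_act x) (part 0) H u m \<longleftrightarrow> many_orbits ?V (blowup_act y) (part t) H u m"
      using eq[rule_format, of "to_nat (Inr (l, u, m) :: int + _)"] by simp
  qed
  then obtain \<delta> where \<delta>: "bij_betw \<delta> ?V ?V" "\<And>v. v \<in> ?V \<Longrightarrow> part t (\<delta> v) = part 0 v"
      "\<And>v g. v \<in> ?V \<Longrightarrow> \<delta> (blowup_act x g v) = blowup_act y g (\<delta> v)" by blast
  have mem: "\<delta> v \<in> ?V" if "v \<in> ?V" for v using \<delta>(1) that by (auto simp: bij_betw_def)
  have "restrict \<delta> ?V \<in> automorphisms C3_blowup"
  proof (rule restrict_automorphism[OF \<delta>(1)])
    fix u v assume uv: "u \<in> ?V" "v \<in> ?V"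
    have lt: "int (fst w) mod 3 = int (fst w)" if "w \<in> ?V" for w using that by (auto simp: verts_C3_blowup)
    \<comment> \<open>Matching labels means that \<delta> rotates the parts by \<open>t\<close>,
      which preserves edges.\<close>
    have part: "int (fst (\<delta> w)) = (int (fst w) + t) mod 3" if "w \<in> ?V" for w
    proof -
      have "(int (fst (\<delta> w)) - t) mod 3 = int (fst w) mod 3" using \<delta>(2)[OF that] by (simp add: part_def)
      then have "((int (fst (\<delta> w)) - t) mod 3 + t) mod 3 = (int (fst w) mod 3 + t) mod 3" by simp
      then show ?thesis using lt[OF mem[OF that]] by (simp add: mod_simps)
    qed
    have "(int (fst v) + t) mod 3 = ((int (fst u) + t) mod 3 + 1) mod 3 \<longleftrightarrow> int (fst v) = (int (fst u) + 1) mod 3"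
    proof -
      have "(int (fst v) + t) mod 3 = ((int (fst u) + t) mod 3 + 1) mod 3 \<longleftrightarrow>
          int (fst v) mod 3 = (int (fst u) + 1) mod 3"
        unfolding mod_add_left_eq mod_eq_dvd_iff by (simp add: algebra_simps)
      then show ?thesis using lt[OF uv(2)] by simp
    qed
    then show "(\<delta> u, \<delta> v) \<in> edges C3_blowup \<longleftrightarrow> (u, v) \<in> edges C3_blowup"
      using uv mem by (simp add: edge_C3_blowup part)
  qed
  moreover have "\<delta> (x v) = y (\<delta> v)" if "v \<in> ?V" for v
    using \<delta>(3)[OF that, of "(1, 0)"] a by (simp add: blowup_act_def aut_pow_1)
  ultimately show "(x, y) \<in> conjugacy (aut_group C3_blowup)"
    using a automorphism_mem[OF a(1)]
    by (auto simp: conjugacy_aut_iff intro!: bexI[of _ "restrict \<delta> ?V"])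
qed auto

theorem theorem4p3:
  shows
    "(conjugacy_smooth (copies \<infinity> C3) \<and> conjugacy_smooth (blowup C3 \<infinity>)) \<and>
     (\<forall>n :: enat. 1 \<le> n \<longrightarrow>
        conjugacy_borel_complete (copies n rat_order) \<and>
        conjugacy_borel_complete (blowup rat_order n) \<and>
        (\<forall>D. local_order_points D \<longrightarrow>
           conjugacy_borel_complete (copies n (local_order D)) \<and>
           conjugacy_borel_complete (blowup (local_order D) n)) \<and>
        (\<forall>T :: 't digraph. generic_tournament T \<longrightarrow>
           conjugacy_borel_complete (copies n T) \<and>
           conjugacy_borel_complete (blowup T n)) \<and>
        (\<forall>G :: 'g digraph.
           tournament G \<and> countable (verts G) \<and> conjugacy_borel_complete G \<longrightarrow>
           conjugacy_borel_complete (copies n G) \<and>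
           conjugacy_borel_complete (blowup G n)))"
  by (intro conjI allI impI)
    (simp_all add: conjugacy_smooth_copies_C3 conjugacy_smooth_blowup_C3
      conjugacy_borel_complete_copies conjugacy_borel_complete_blowup
      rat_order_tournament rat_order_borel_complete local_order_tournament local_order_borel_complete
      generic_tournament_tournament generic_tournament_borel_complete)

end
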